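(* Let $d\ge 2$ be an integer and let $s\in\mathbb{R}$ with $s<\frac{d}{d+2}$. (i) The maximal operator $f\mapsto \sup_{0<t<1}|e^{it\Delta}f|$ is not bounded from $H^s(\mathbb{T}^d)$ to $L^{2,\infty}(\mathbb{T}^d)$, even on trigonometric polynomials. That is, there is no constant $C<\infty$ such that $$\left\|\sup_{0<t<1}|e^{it\Delta}f|\right\|_{L^{2,\infty}(\mathbb{T}^d)}\le C\|f\|_{H^s(\mathbb{T}^d)}$$ holds for every trigonometric polynomial $f$ on $\mathbb{T}^d$. (ii) Moreover, there exist $f\in H^s(\mathbb{T}^d)\cap L^2(\mathbb{T}^d)$, a measurable set $E\subseteq\mathbb{T}^d$ of positive measure, and a sequence of positive times $t_j\to 0^+$ such that $$\limsup_{j\to\infty}|e^{it_j\Delta}f(x)|=\infty\qquad\text{for every }x\in E.$$ In particular, $e^{it\Delta}f(x)$ does not converge to $f(x)$ as $t\to0^+$ for $x\in E$.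
   Context: $\mathbb{T}^d=(\mathbb{R}/2\pi\mathbb{Z})^d$ carries normalized Haar measure $(2\pi)^{-d}\,dx$; $|A|$ denotes the normalized measure of a measurable set $A$. Fourier coefficients are $\widehat f(n)=(2\pi)^{-d}\int_{[0,2\pi)^d}f(x)e^{-in\cdot x}\,dx$ for $n\in\mathbb{Z}^d$, and $|n|$ is the Euclidean length. A trigonometric polynomial is a finite linear combination (complex coefficients) of the functions $x\mapsto e^{in\cdot x}$, $n\in\mathbb{Z}^d$. The Sobolev norm is $\|f\|_{H^s(\mathbb{T}^d)}^2=\sum_{n\in\mathbb{Z}^d}(1+|n|^2)^s|\widehat f(n)|^2$. The weak $L^2$ norm is $\|g\|_{L^{2,\infty}(\mathbb{T}^d)}=\sup_{\lambda>0}\lambda\,|\{x\in\mathbb{T}^d: |g(x)|>\lambda\}|^{1/2}$. The Schrödinger evolution is $e^{it\Delta}f(x)=\sum_{n\in\mathbb{Z}^d}\widehat f(n)e^{i(n\cdot x-t|n|^2)}$: a finite sum for trigonometric polynomials, and for $f\in L^2(\mathbb{T}^d)$ the $L^2$ function with Fourier coefficients $\widehat f(n)e^{-it|n|^2}$. In (ii), the values $e^{it_j\Delta}f(x)$ at the times $t_j$ are those given by the almost everywhere limits, as $L\to\infty$, of the full Fourier cube truncations $\sum_{|n|_\infty\le L}\widehat f(n)e^{i(n\cdot x-t_j|n|^2)}$, where $|n|_\infty=\max_{1\le r\le d}|n_r|$; these limits define a representative of the $L^2$ function $e^{it_j\Delta}f$. *)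

theory Defs
  imports "HOL-Analysis.Analysis"
begin

text \<open>
  The torus \<open>(\<real>/2\<pi>\<int>)^d\<close> is represented by its fundamental domain \<open>[0,2\<pi>)^d\<close>, with
  \<open>d = CARD('d)\<close>, and functions on it by functions on \<open>real ^ 'd\<close> that are \<open>2\<pi>\<close>-periodic in each
  coordinate.
\<close>

definition torus_box :: "(real ^ 'd::finite) set" where
  "torus_box = {x. \<forall>i. 0 \<le> x $ i \<and> x $ i < 2 * pi}"

definition torus :: "(real ^ 'd::finite) measure" where
  "torus = density (lebesgue_on torus_box) (\<lambda>_. ennreal (1 / (2 * pi) ^ CARD('d)))"

definition torus_periodic :: "(real ^ 'd::finite \<Rightarrow> 'b) \<Rightarrow> bool" where
  "torus_periodic f \<longleftrightarrow> (\<forall>x i. f (x + axis i (2 * pi)) = f x)"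

definition real_vec :: "int ^ 'd::finite \<Rightarrow> real ^ 'd" where
  "real_vec n = (\<chi> i. real_of_int (n $ i))"

definition fourier :: "(real ^ 'd::finite \<Rightarrow> complex) \<Rightarrow> int ^ 'd \<Rightarrow> complex" where
  "fourier f n = (\<integral>x. f x * cis (- (real_vec n \<bullet> x)) \<partial>torus)"

definition trig_poly :: "(real ^ 'd::finite \<Rightarrow> complex) \<Rightarrow> bool" where
  "trig_poly f \<longleftrightarrow>
     (\<exists>N c. finite N \<and> f = (\<lambda>x. \<Sum>n\<in>N. c n * cis (real_vec n \<bullet> x)))"

definition L2_torus :: "(real ^ 'd::finite \<Rightarrow> complex) \<Rightarrow> bool" where
  "L2_torus f \<longleftrightarrow> torus_periodic f \<and> f \<in> borel_measurable torus \<and>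
     integrable torus (\<lambda>x. (cmod (f x))\<^sup>2)"

definition sobolev_term :: "real \<Rightarrow> (real ^ 'd::finite \<Rightarrow> complex) \<Rightarrow> int ^ 'd \<Rightarrow> real" where
  "sobolev_term s f n = (1 + (norm (real_vec n))\<^sup>2) powr s * (cmod (fourier f n))\<^sup>2"

definition finite_sobolev :: "real \<Rightarrow> (real ^ 'd::finite \<Rightarrow> complex) \<Rightarrow> bool" where
  "finite_sobolev s f \<longleftrightarrow> sobolev_term s f summable_on UNIV"

text \<open>Meaningful only under \<^const>\<open>finite_sobolev\<close>, since a divergent \<^const>\<open>infsum\<close> is \<open>0\<close>;
  trigonometric polynomials have only finitely many nonzero terms.\<close>

definition sobolev_norm :: "real \<Rightarrow> (real ^ 'd::finite \<Rightarrow> complex) \<Rightarrow> real" where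
  "sobolev_norm s f = sqrt (\<Sum>\<^sub>\<infinity>n. sobolev_term s f n)"

text \<open>The weak \<open>L\<^sup>2\<close> norm of a function with values in \<open>[0,\<infinity>]\<close>.\<close>

definition weak_L2_norm :: "(real ^ 'd::finite \<Rightarrow> ennreal) \<Rightarrow> ennreal" where
  "weak_L2_norm g =
     (SUP l\<in>{0<..}. ennreal (l * sqrt (measure torus {x \<in> torus_box. g x > ennreal l})))"

definition evolution_term ::
    "real \<Rightarrow> (real ^ 'd::finite \<Rightarrow> complex) \<Rightarrow> real ^ 'd \<Rightarrow> int ^ 'd \<Rightarrow> complex" where
  "evolution_term t f x n = fourier f n * cis (real_vec n \<bullet> x - t * (norm (real_vec n))\<^sup>2)"

text \<open>The evolution of a trigonometric polynomial, whose frequency set is finite.\<close>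

definition evolution_poly ::
    "real \<Rightarrow> (real ^ 'd::finite \<Rightarrow> complex) \<Rightarrow> real ^ 'd \<Rightarrow> complex" where
  "evolution_poly t f x = (\<Sum>n | fourier f n \<noteq> 0. evolution_term t f x n)"

definition maximal_poly :: "(real ^ 'd::finite \<Rightarrow> complex) \<Rightarrow> real ^ 'd \<Rightarrow> ennreal" where
  "maximal_poly f x = (SUP t\<in>{0<..<1}. ennreal (cmod (evolution_poly t f x)))"

definition is_evolution ::
    "real \<Rightarrow> (real ^ 'd::finite \<Rightarrow> complex) \<Rightarrow> (real ^ 'd \<Rightarrow> complex) \<Rightarrow> bool" where
  "is_evolution t f g \<longleftrightarrow> L2_torus g \<and>
     (\<forall>n. fourier g n = fourier f n * cis (- t * (norm (real_vec n))\<^sup>2))"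

definition cube_truncation ::
    "nat \<Rightarrow> real \<Rightarrow> (real ^ 'd::finite \<Rightarrow> complex) \<Rightarrow> real ^ 'd \<Rightarrow> complex" where
  "cube_truncation L t f x = (\<Sum>n | infnorm (real_vec n) \<le> real L. evolution_term t f x n)"

text \<open>A genuine value only at points where the cube truncations converge.\<close>

definition evolution_value ::
    "real \<Rightarrow> (real ^ 'd::finite \<Rightarrow> complex) \<Rightarrow> real ^ 'd \<Rightarrow> complex" where
  "evolution_value t f x = lim (\<lambda>L. cube_truncation L t f x)"

end

theory Submission
  imports Defs
begin

text \<open>
  Both parts rest on exponential sums over \<open>\<gamma>\<^sup>d\<close> frequencies of size at most of order
  \<open>\<gamma> powr ((d + 2) / 2)\<close> whose evolution has modulus at least \<open>\<gamma>\<^sup>d / 2\<close> at some time \<open>0 < t < 1\<close>, for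
  all \<open>x\<close> in a set whose measure is bounded below in terms of \<open>d\<close> only (\<open>ex_focusing_frequencies\<close>).

  Let \<open>m\<^sub>i\<close> be pairwise orthogonal integer vectors with \<open>m\<^sub>i \<bullet> m\<^sub>i = D\<close>, where \<open>D\<close> is of order
  \<open>\<gamma>\<^sup>d\<close>, and let \<open>v\<close> be an integer vector. For \<open>n = v + \<Sum>\<^sub>i k\<^sub>i m\<^sub>i\<close> with \<open>1 \<le> k\<^sub>i \<le> \<gamma>\<close> one has
  \<open>|n|\<^sup>2 = |v|\<^sup>2 + 2 \<Sum>\<^sub>i k\<^sub>i (m\<^sub>i \<bullet> v) + D \<Sum>\<^sub>i k\<^sub>i\<^sup>2\<close>. At a time \<open>t = 2 \<pi> a / D\<close> with \<open>a\<close> an integer the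
  quadratic term is a multiple of \<open>2 \<pi>\<close>, and up to a constant phase the evolution is the linear sum
  \<open>\<Sum>\<^sub>k exp (\<i> \<Sum>\<^sub>i k\<^sub>i (m\<^sub>i \<bullet> x - 4 \<pi> a (m\<^sub>i \<bullet> v) / D))\<close>. It is coherent when all the numbers
  \<open>m\<^sub>i \<bullet> x - 4 \<pi> a (m\<^sub>i \<bullet> v) / D\<close> are within a small multiple of \<open>1/\<gamma>\<close> of \<open>2 \<pi> \<int>\<close>. Since
  \<open>x \<mapsto> (m\<^sub>i \<bullet> x)\<^sub>i\<close> preserves the normalized measure of the torus (\<open>nn_integral_torus_linear\<close>), each \<open>a\<close>
  contributes a set of measure of order \<open>\<gamma> powr (- d)\<close>. If the points \<open>2 a (m\<^sub>i \<bullet> v) / D\<close>, with \<open>a\<close> taken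
  modulo \<open>D\<close>, are separated by a multiple of \<open>1/\<gamma>\<close> modulo \<open>\<int>\<^sup>d\<close>, these sets are disjoint, and the
  \<open>\<gamma>\<^sup>d\<close> available values of \<open>a\<close> fill a fixed proportion of the torus.

  Such \<open>m\<^sub>i\<close> and \<open>v\<close> come from Gaussian integers (\<open>ex_design\<close>): the coordinates are grouped in pairs,
  on each of which the \<open>m\<^sub>i\<close> are \<open>\<omega>\<close> and \<open>\<i> \<omega>\<close> for a primitive Gaussian integer \<open>\<omega>\<close> of norm \<open>D\<close>, and
  the component of \<open>v\<close> in the \<open>j\<close>-th pair is \<open>\<gamma>\<^sup>j\<close>. Expansion in base \<open>\<gamma>\<close> gives the separation. For
  odd \<open>d\<close> one coordinate is left over; then \<open>\<omega>\<close> is taken to be a square, so that \<open>D\<close> is a perfect square, and the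
  last entry of \<open>v\<close> is chosen to separate the few values of \<open>a\<close> that the pairs do not distinguish.

  For such a sum \<open>f\<close> the squared \<open>H\<^sup>s\<close> norm is at most of order \<open>\<gamma> powr (d + (d + 2) s)\<close> (for \<open>s \<ge> 0\<close>),
  while the squared weak norm of the maximal function is at least of order \<open>\<gamma> powr (2 d)\<close>. This contradicts
  the maximal inequality when \<open>s < d / (d + 2)\<close>.

  For the second part the frequencies are dilated by an integer \<open>p\<close>, which confines the times to
  \<open>(0, 1/p)\<close> and keeps the measure of the focusing set, and \<open>f\<close> is a rapidly growing series of such
  sums. The coefficients are so small that the later pieces are summable almost everywhere at all the
  times used by the earlier ones; the earlier pieces are beaten by the size of the current one. The
  almost everywhere convergence of the cube truncations follows from an elementary maximal estimate
  for truncations (\<open>trunc_sum_bound\<close>), which loses a factor \<open>card S powr (1/4)\<close> over the \<open>L\<^sup>2\<close> norm;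
  this is harmless because the pieces gain \<open>sqrt (card S)\<close>.
\<close>

section \<open>Integration over the torus\<close>

lemma torus_box_sets [measurable]: "torus_box \<in> sets borel"
proof -
  have "torus_box = (\<Inter>i::'d::finite. {x::real^'d. 0 \<le> x $ i} \<inter> {x. x $ i < 2 * pi})"
    by (auto simp: torus_box_def)
  also have "\<dots> \<in> sets borel"
    by (intro sets.finite_INT sets.Int borel_closed borel_open open_Collect_less closed_Collect_le
          continuous_intros) auto
  finally show ?thesis .
qed

lemma space_torus [simp]: "space (torus :: (real^'d::finite) measure) = torus_box"
  by (simp add: torus_def)

lemma sets_torus: "sets (torus :: (real^'d::finite) measure) = sets (lebesgue_on torus_box)"
  by (simp add: torus_def)

lemma borel_Int_box_sets_torus:
  assumes "A \<in> sets borel"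
  shows "A \<inter> torus_box \<in> sets (torus :: (real^'d::finite) measure)"
proof -
  have "A \<in> sets lebesgue" using assms by simp
  then have "torus_box \<inter> A \<in> sets (lebesgue_on torus_box)"
    unfolding sets_restrict_space by (rule imageI)
  then show ?thesis unfolding sets_torus by (subst Int_commute)
qed

lemma borel_measurable_torus:
  fixes g :: "real^'d::finite \<Rightarrow> 'b::topological_space"
  assumes "g \<in> borel_measurable borel"
  shows "g \<in> borel_measurable torus"
proof -
  have "g \<in> borel_measurable lebesgue"
    by (intro measurable_completion) (simp add: assms)
  then have "g \<in> borel_measurable (lebesgue_on torus_box)"
    by (rule measurable_restrict_space1)
  then show ?thesis
    by (simp add: torus_def)
qed

lemma nn_integral_torus:
  fixes g :: "real^'d::finite \<Rightarrow> ennreal"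
  assumes g: "g \<in> borel_measurable borel"
  shows "(\<integral>\<^sup>+x. g x \<partial>torus) =
    ennreal (1 / (2 * pi) ^ CARD('d)) * (\<integral>\<^sup>+x. g x * indicator torus_box x \<partial>lborel)"
proof -
  have m: "g \<in> borel_measurable (lebesgue_on torus_box)"
    using borel_measurable_torus[OF g] by (simp add: torus_def)
  have b: "torus_box \<in> sets (lebesgue :: (real^'d) measure)"
    by (simp add: torus_box_sets)
  have "(\<integral>\<^sup>+x. g x \<partial>torus) = (\<integral>\<^sup>+x. ennreal (1 / (2 * pi) ^ CARD('d)) * g x \<partial>lebesgue_on torus_box)"
    unfolding torus_def using m by (subst nn_integral_density) auto
  also have "\<dots> = ennreal (1 / (2 * pi) ^ CARD('d)) * (\<integral>\<^sup>+x. g x \<partial>lebesgue_on torus_box)"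
    using m by (rule nn_integral_cmult)
  also have "(\<integral>\<^sup>+x. g x \<partial>lebesgue_on torus_box) = (\<integral>\<^sup>+x. g x * indicator torus_box x \<partial>lebesgue)"
    using b by (subst nn_integral_restrict_space) auto
  also have "\<dots> = (\<integral>\<^sup>+x. g x * indicator torus_box x \<partial>lborel)"
    by (rule nn_integral_completion)
  finally show ?thesis .
qed

lemma emeasure_lborel_torus_box:
  "emeasure lborel (torus_box :: (real^'d::finite) set) = ennreal ((2 * pi) ^ CARD('d))"
proof (rule antisym)
  let ?u = "(\<chi> i. 2 * pi) :: real^'d"
  have p: "(\<Prod>b\<in>Basis. (?u - 0) \<bullet> b) = (2 * pi) ^ CARD('d)"
  proof -
    have "(\<Prod>b\<in>Basis. (?u - 0) \<bullet> b) = (\<Prod>b\<in>(Basis::(real^'d) set). 2 * pi)"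
      by (rule prod.cong) (auto simp: Basis_vec_def inner_axis)
    then show ?thesis by simp
  qed
  have nn: "0 \<bullet> b \<le> ?u \<bullet> b" if "b \<in> Basis" for b
    using that by (auto simp: Basis_vec_def inner_axis)
  have "emeasure lborel (torus_box :: (real^'d) set) \<le> emeasure lborel (cbox 0 ?u)"
    by (intro emeasure_mono) (auto simp: torus_box_def mem_box_cart less_imp_le)
  also have "\<dots> = ennreal ((2 * pi) ^ CARD('d))"
    by (subst emeasure_lborel_cbox[OF nn]) (simp_all only: p)
  finally show "emeasure lborel (torus_box :: (real^'d) set) \<le> ennreal ((2 * pi) ^ CARD('d))" .
  have "ennreal ((2 * pi) ^ CARD('d)) = emeasure lborel (box 0 ?u)"
    by (subst emeasure_lborel_box[OF nn]) (simp_all only: p)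
  also have "\<dots> \<le> emeasure lborel (torus_box :: (real^'d) set)"
    by (intro emeasure_mono) (auto simp: torus_box_def mem_box_cart less_imp_le torus_box_sets)
  finally show "ennreal ((2 * pi) ^ CARD('d)) \<le> emeasure lborel (torus_box :: (real^'d) set)" .
qed

lemma emeasure_torus_space:
  "emeasure (torus :: (real^'d::finite) measure) torus_box = 1"
proof -
  have "emeasure (torus :: (real^'d) measure) torus_box = (\<integral>\<^sup>+x. 1 \<partial>(torus :: (real^'d) measure))"
    using nn_integral_const[of "torus :: (real^'d) measure" 1] by simp
  also have "\<dots> = ennreal (1 / (2 * pi) ^ CARD('d)) * ennreal ((2 * pi) ^ CARD('d))"
    by (subst nn_integral_torus) (auto simp: torus_box_sets emeasure_lborel_torus_box)
  also have "\<dots> = 1"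
    by (subst ennreal_mult[symmetric]) auto
  finally show ?thesis .
qed

lemma finite_measure_torus: "finite_measure (torus :: (real^'d::finite) measure)"
  by (rule finite_measureI) (simp add: emeasure_torus_space)

lemma measure_torus_box: "measure (torus :: (real^'d::finite) measure) torus_box = 1"
  by (simp add: measure_def emeasure_torus_space)

lemma torus_periodic_real_vec:
  fixes g :: "real^'d::finite \<Rightarrow> 'b"
  assumes "torus_periodic g"
  shows "g (x + (2 * pi) *\<^sub>R real_vec m) = g x"
proof -
  have per: "g (x + axis i (2 * pi)) = g x" for x i
    using assms by (simp add: torus_periodic_def)
  have nat: "g (x + real k *\<^sub>R axis i (2 * pi)) = g x" for x i k
  proof (induction k)
    case (Suc k)
    have "g (x + real (Suc k) *\<^sub>R axis i (2 * pi)) = g ((x + real k *\<^sub>R axis i (2 * pi)) + axis i (2 * pi))"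
      by (simp add: algebra_simps)
    then show ?case using per Suc by simp
  qed simp
  have int: "g (x + real_of_int k *\<^sub>R axis i (2 * pi)) = g x" for x i k
  proof (cases "k \<ge> 0")
    case True
    then show ?thesis using nat[of x "nat k" i] by simp
  next
    case False
    then show ?thesis
      using nat[of "x + real_of_int k *\<^sub>R axis i (2 * pi)" "nat (-k)" i]
      by (simp add: algebra_simps)
  qed
  have fin: "g (x + (\<Sum>i\<in>A. real_of_int (m $ i) *\<^sub>R axis i (2 * pi))) = g x" if "finite A" for A
    using that
  proof (induction A)
    case (insert i A)
    then show ?case
      using int[of "x + (\<Sum>i\<in>A. real_of_int (m $ i) *\<^sub>R axis i (2 * pi))" "m $ i" i]
      by (simp add: algebra_simps)
  qed simp
  have "(2 * pi) *\<^sub>R real_vec m = (\<Sum>i\<in>UNIV. real_of_int (m $ i) *\<^sub>R axis i (2 * pi))"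
    by (simp add: vec_eq_iff real_vec_def axis_def if_distrib cong: if_cong)
  then show ?thesis using fin[of UNIV] by simp
qed

lemma torus_box_unique_shift:
  fixes x :: "real^'d::finite"
  obtains m where "\<And>k. x - (2 * pi) *\<^sub>R real_vec k \<in> torus_box \<longleftrightarrow> k = m"
proof -
  define m :: "int^'d" where "m = (\<chi> i. \<lfloor>x $ i / (2 * pi)\<rfloor>)"
  have "x - (2 * pi) *\<^sub>R real_vec k \<in> torus_box \<longleftrightarrow> k = m" for k
  proof -
    have "0 \<le> x $ i - 2 * pi * real_of_int (k $ i) \<and> x $ i - 2 * pi * real_of_int (k $ i) < 2 * pi
      \<longleftrightarrow> \<lfloor>x $ i / (2 * pi)\<rfloor> = k $ i" for i
      by (simp add: floor_eq_iff field_simps)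
    then show ?thesis
      by (auto simp: torus_box_def real_vec_def m_def vec_eq_iff)
  qed
  then show ?thesis using that by blast
qed

lemma nn_integral_lborel_shift:
  fixes h :: "real^'d::finite \<Rightarrow> ennreal"
  assumes "h \<in> borel_measurable borel"
  shows "(\<integral>\<^sup>+x. h (x + z) \<partial>lborel) = (\<integral>\<^sup>+x. h x \<partial>lborel)"
proof -
  have "(\<integral>\<^sup>+x. h x \<partial>lborel) = (\<integral>\<^sup>+x. h x \<partial>distr lborel borel ((+) z))"
    by (simp add: lborel_distr_plus)
  also have "\<dots> = (\<integral>\<^sup>+x. h (x + z) \<partial>lborel)"
    using assms by (subst nn_integral_distr) (auto simp: add.commute)
  finally show ?thesis by simp
qed

text \<open>
  Invariance of the Haar integral under translations. The translated box is cut along the lattice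
  \<open>2 \<pi> \<int>\<^sup>d\<close> and its parts are moved back into the fundamental domain.
\<close>
lemma nn_integral_torus_translate:
  fixes g :: "real^'d::finite \<Rightarrow> ennreal"
  assumes g: "g \<in> borel_measurable borel" and per: "torus_periodic g"
  shows "(\<integral>\<^sup>+x. g (x + z) \<partial>torus) = (\<integral>\<^sup>+x. g x \<partial>torus)"
proof -
  note [measurable] = g
  let ?I = "indicator torus_box :: real^'d \<Rightarrow> ennreal"
  let ?v = "\<lambda>m::int^'d. (2 * pi) *\<^sub>R real_vec m :: real^'d"
  have one: "(\<integral>\<^sup>+m. ?I (x - ?v m) \<partial>count_space UNIV) = 1" for x :: "real^'d"
  proof -
    obtain m where m: "\<And>k. x - ?v k \<in> torus_box \<longleftrightarrow> k = m"
      using torus_box_unique_shift by blast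
    have "(\<integral>\<^sup>+k. ?I (x - ?v k) \<partial>count_space UNIV) = (\<integral>\<^sup>+k. indicator {m} k \<partial>count_space UNIV)"
      by (rule nn_integral_cong) (auto simp: indicator_def m)
    then show ?thesis by simp
  qed
  have "(\<integral>\<^sup>+x. g (x + z) * ?I x \<partial>lborel) = (\<integral>\<^sup>+x. g x * ?I (x - z) \<partial>lborel)"
    using nn_integral_lborel_shift[of "\<lambda>x. g x * ?I (x - z)" z] by simp
  also have "\<dots> = (\<integral>\<^sup>+x. (\<integral>\<^sup>+m. g x * ?I (x - z) * ?I (x - ?v m) \<partial>count_space UNIV) \<partial>lborel)"
    by (simp add: nn_integral_cmult one)
  also have "\<dots> = (\<integral>\<^sup>+m. (\<integral>\<^sup>+x. g x * ?I (x - z) * ?I (x - ?v m) \<partial>lborel) \<partial>count_space UNIV)"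
    by (rule nn_integral_count_space_nn_integral) auto
  also have "\<dots> = (\<integral>\<^sup>+m. (\<integral>\<^sup>+x. g x * ?I (x - z + ?v m) * ?I x \<partial>lborel) \<partial>count_space UNIV)"
  proof (rule nn_integral_cong)
    fix m :: "int^'d"
    have "g (x + ?v m) = g x" for x
      by (rule torus_periodic_real_vec[OF per])
    then show "(\<integral>\<^sup>+x. g x * ?I (x - z) * ?I (x - ?v m) \<partial>lborel)
        = (\<integral>\<^sup>+x. g x * ?I (x - z + ?v m) * ?I x \<partial>lborel)"
      using nn_integral_lborel_shift[of "\<lambda>x. g x * ?I (x - z) * ?I (x - ?v m)" "?v m"]
      by (simp add: algebra_simps)
  qed
  also have "\<dots> = (\<integral>\<^sup>+x. (\<integral>\<^sup>+m. g x * ?I (x - z + ?v m) * ?I x \<partial>count_space UNIV) \<partial>lborel)"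
    by (rule nn_integral_count_space_nn_integral[symmetric]) auto
  also have "\<dots> = (\<integral>\<^sup>+x. g x * ?I x \<partial>lborel)"
  proof (rule nn_integral_cong)
    fix x :: "real^'d"
    have "(\<integral>\<^sup>+m. g x * ?I (x - z + ?v m) * ?I x \<partial>count_space UNIV)
        = g x * ?I x * (\<integral>\<^sup>+m. ?I (x - z + ?v m) \<partial>count_space UNIV)"
      by (subst nn_integral_cmult[symmetric]) (auto simp: mult_ac)
    also have "(\<integral>\<^sup>+m. ?I (x - z + ?v m) \<partial>count_space UNIV) = (\<integral>\<^sup>+m. ?I (x - z - ?v m) \<partial>count_space UNIV)"
    proof -
      have bij: "bij (uminus :: int^'d \<Rightarrow> int^'d)"
        by (rule bij_uminus)
      have "(\<integral>\<^sup>+m. ?I (x - z - ?v m) \<partial>count_space UNIV) = (\<integral>\<^sup>+m. ?I (x - z - ?v (- m)) \<partial>count_space UNIV)"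
        using nn_integral_bij_count_space[OF bij, of "\<lambda>m. ?I (x - z - ?v m)"] by simp
      moreover have "?v (- m) = - ?v m" for m
        by (simp add: vec_eq_iff real_vec_def)
      ultimately show ?thesis by simp
    qed
    also have "\<dots> = 1" by (rule one)
    finally show "(\<integral>\<^sup>+m. g x * ?I (x - z + ?v m) * ?I x \<partial>count_space UNIV) = g x * ?I x" by simp
  qed
  finally have "(\<integral>\<^sup>+x. g (x + z) * ?I x \<partial>lborel) = (\<integral>\<^sup>+x. g x * ?I x \<partial>lborel)" .
  moreover have "(\<lambda>x. g (x + z)) \<in> borel_measurable borel"
    by measurable
  ultimately show ?thesis
    using nn_integral_torus[OF g] nn_integral_torus[of "\<lambda>x. g (x + z)"] by simp
qed

text \<open>
  A surjective linear map that descends to the torus preserves the Haar integral: the left-hand side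
  does not change when \<open>T x\<close> is replaced by \<open>T x + z\<close>, because \<open>z\<close> is itself a value of \<open>T\<close>, so it may be
  averaged over \<open>z\<close>.
\<close>
lemma nn_integral_torus_linear:
  fixes g :: "real^'d::finite \<Rightarrow> ennreal" and T :: "real^'d \<Rightarrow> real^'d"
  assumes g: "g \<in> borel_measurable borel" and per: "torus_periodic g"
    and T: "linear T" "surj T" and Tper: "torus_periodic (\<lambda>x. g (T x))"
  shows "(\<integral>\<^sup>+x. g (T x) \<partial>torus) = (\<integral>\<^sup>+x. g x \<partial>torus)"
proof -
  note [measurable] = g
  have [measurable]: "T \<in> borel_measurable borel"
    using linear_continuous_on[of T UNIV] T(1)
    by (simp add: borel_measurable_continuous_onI linear_conv_bounded_linear)
  let ?I = "indicator torus_box :: real^'d \<Rightarrow> ennreal"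
  let ?c = "ennreal (1 / (2 * pi) ^ CARD('d))"
  have cI: "?c * (\<integral>\<^sup>+z. c * ?I z \<partial>lborel) = c" for c
  proof -
    have "?c * (\<integral>\<^sup>+z. c * ?I z \<partial>(lborel :: (real^'d) measure)) = (\<integral>\<^sup>+z. c \<partial>(torus :: (real^'d) measure))"
      by (subst nn_integral_torus) auto
    then show ?thesis by (simp add: emeasure_torus_space)
  qed
  have shift: "(\<integral>\<^sup>+x. g (T x + z) \<partial>torus) = (\<integral>\<^sup>+x. g (T x) \<partial>torus)" for z
  proof -
    obtain y where "T y = z" using T(2) by (metis surjD)
    then have "(\<lambda>x. g (T x + z)) = (\<lambda>x. g (T (x + y)))"
      using T(1) by (simp add: linear_add)
    then show ?thesis
      using nn_integral_torus_translate[OF _ Tper, of y] by simp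
  qed
  have gT: "(\<lambda>x. g (T x + z)) \<in> borel_measurable borel" for z
    by measurable
  have inner1: "(\<integral>\<^sup>+x. g (T x + z) \<partial>torus) * ?I z
      = ?c * (\<integral>\<^sup>+x. g (T x + z) * ?I x * ?I z \<partial>lborel)" for z
    unfolding nn_integral_torus[OF gT] by (subst nn_integral_multc) (auto simp: mult.assoc)
  have inner2: "?c * (\<integral>\<^sup>+z. g (T x + z) * ?I x * ?I z \<partial>lborel) = (\<integral>\<^sup>+z. g z \<partial>torus) * ?I x" for x
  proof -
    have "(\<integral>\<^sup>+z. g (T x + z) * ?I x * ?I z \<partial>lborel) = (\<integral>\<^sup>+z. g (z + T x) * ?I z * ?I x \<partial>lborel)"
      by (intro nn_integral_cong) (simp add: mult.assoc mult.commute[of "?I x"] add.commute)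
    also have "\<dots> = (\<integral>\<^sup>+z. g (z + T x) * ?I z \<partial>lborel) * ?I x"
      by (rule nn_integral_multc) measurable
    finally have "?c * (\<integral>\<^sup>+z. g (T x + z) * ?I x * ?I z \<partial>lborel) = (\<integral>\<^sup>+z. g (z + T x) \<partial>torus) * ?I x"
      by (subst nn_integral_torus) (auto simp: mult.assoc)
    then show ?thesis
      by (simp only: nn_integral_torus_translate[OF g per])
  qed
  have "(\<integral>\<^sup>+x. g (T x) \<partial>torus) = ?c * (\<integral>\<^sup>+z. (\<integral>\<^sup>+x. g (T x + z) \<partial>torus) * ?I z \<partial>lborel)"
    by (simp only: shift cI)
  also have "\<dots> = ?c * (?c * (\<integral>\<^sup>+z. (\<integral>\<^sup>+x. g (T x + z) * ?I x * ?I z \<partial>lborel) \<partial>lborel))"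
    unfolding inner1 by (subst nn_integral_cmult) auto
  also have "(\<integral>\<^sup>+z. (\<integral>\<^sup>+x. g (T x + z) * ?I x * ?I z \<partial>lborel) \<partial>lborel)
      = (\<integral>\<^sup>+x. (\<integral>\<^sup>+z. g (T x + z) * ?I x * ?I z \<partial>lborel) \<partial>lborel)"
    by (rule lborel_pair.Fubini') measurable
  also have "?c * \<dots> = (\<integral>\<^sup>+x. ?c * (\<integral>\<^sup>+z. g (T x + z) * ?I x * ?I z \<partial>lborel) \<partial>lborel)"
    by (subst nn_integral_cmult) auto
  also have "?c * \<dots> = (\<integral>\<^sup>+z. g z \<partial>torus)"
    by (simp only: inner2 cI)
  finally show ?thesis .
qed

section \<open>Characters of the torus\<close>

lemma real_vec_zero [simp]: "real_vec 0 = 0"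
  by (simp add: real_vec_def vec_eq_iff)

lemma real_vec_diff: "real_vec (m - n) = real_vec m - real_vec n"
  by (simp add: real_vec_def vec_eq_iff)

lemma real_vec_eq_iff [simp]: "real_vec m = real_vec n \<longleftrightarrow> m = n"
  by (simp add: real_vec_def vec_eq_iff)

lemma torus_periodic_cis:
  fixes n :: "int^'d::finite"
  shows "torus_periodic (\<lambda>x. cis (real_vec n \<bullet> x + \<phi>))"
  unfolding torus_periodic_def
proof (intro allI)
  fix x :: "real^'d" and i
  have "real_vec n \<bullet> (x + axis i (2 * pi)) + \<phi> = (real_vec n \<bullet> x + \<phi>) + 2 * pi * real_of_int (n $ i)"
    by (simp add: inner_add_right inner_axis real_vec_def)
  then show "cis (real_vec n \<bullet> (x + axis i (2 * pi)) + \<phi>) = cis (real_vec n \<bullet> x + \<phi>)"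
    by (simp only: cis_mult[symmetric] cis_multiple_2pi[OF Ints_of_int] mult_1_right)
qed

lemma integrable_torus_continuous:
  fixes f :: "real^'d::finite \<Rightarrow> 'b::{banach, second_countable_topology}"
  assumes "continuous_on UNIV f" and "\<And>x. norm (f x) \<le> B"
  shows "integrable torus f"
proof (rule finite_measure.integrable_const_bound[OF finite_measure_torus])
  show "AE x in torus. norm (f x) \<le> B" using assms by simp
  show "f \<in> borel_measurable torus"
    by (intro borel_measurable_torus borel_measurable_continuous_onI assms)
qed

text \<open>
  A translation by \<open>z\<close> with \<open>n \<bullet> z = \<pi>\<close> changes the sign of the integrand.
\<close>
lemma integral_torus_cos:
  fixes n :: "int^'d::finite"
  assumes "n \<noteq> 0"
  shows "(\<integral>x. cos (real_vec n \<bullet> x + \<phi>) \<partial>torus) = 0"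
proof -
  let ?h = "\<lambda>x. real_vec n \<bullet> x + \<phi>"
  let ?g = "\<lambda>x. ennreal (1 + cos (?h x))"
  define z where "z = (pi / (norm (real_vec n))\<^sup>2) *\<^sub>R real_vec n"
  have n0: "norm (real_vec n) \<noteq> 0"
    using assms real_vec_eq_iff[of n 0] by (simp del: real_vec_eq_iff)
  have z: "real_vec n \<bullet> z = pi"
    using n0 by (simp add: z_def power2_norm_eq_inner[symmetric])
  have per: "torus_periodic ?g"
    using torus_periodic_cis[of n \<phi>] by (simp add: torus_periodic_def complex_eq_iff)
  have m: "?g \<in> borel_measurable borel"
    by measurable
  have int: "integrable torus (\<lambda>x::real^'d. cos (?h x))"
    by (rule integrable_torus_continuous[where B=1]) (auto intro!: continuous_intros)
  have c1: "integrable torus (\<lambda>_::real^'d. 1::real)"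
    by (rule integrable_torus_continuous[where B=1]) auto
  \<comment> \<open>The constant \<open>1\<close> makes the integrand nonnegative, as translation invariance is stated for
    nonnegative functions.\<close>
  have "ennreal (\<integral>x. 1 - cos (?h x) \<partial>torus) = (\<integral>\<^sup>+x. ennreal (1 - cos (?h x)) \<partial>torus)"
    by (rule nn_integral_eq_integral[symmetric]) (use int c1 in \<open>auto\<close>)
  also have "\<dots> = (\<integral>\<^sup>+x. ?g (x + z) \<partial>torus)"
  proof -
    have "?h (x + z) = ?h x + pi" for x
      by (simp add: inner_add_right z)
    then have "cos (?h (x + z)) = - cos (?h x)" for x
      by (simp only: cos_periodic_pi)
    then show ?thesis by simp
  qed
  also have "\<dots> = (\<integral>\<^sup>+x. ?g x \<partial>torus)"
    by (rule nn_integral_torus_translate[OF m per])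
  also have "\<dots> = ennreal (\<integral>x. 1 + cos (?h x) \<partial>torus)"
  proof (rule nn_integral_eq_integral)
    show "integrable torus (\<lambda>x. 1 + cos (?h x))" using int c1 by simp
    have "0 \<le> 1 + cos y" for y :: real using cos_ge_minus_one[of y] by linarith
    then show "AE x in torus. 0 \<le> 1 + cos (?h x)" by simp
  qed
  finally have "(\<integral>x. 1 - cos (?h x) \<partial>torus) = (\<integral>x. 1 + cos (?h x) \<partial>torus)"
  proof (subst (asm) ennreal_inj)
    have "0 \<le> 1 + cos y" for y :: real using cos_ge_minus_one[of y] by linarith
    then show "0 \<le> (\<integral>x. 1 + cos (?h x) \<partial>torus)" by (intro integral_nonneg_AE) simp
  qed (auto intro!: integral_nonneg_AE)
  then show ?thesis
    using int c1 by simp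
qed

lemma integral_torus_cis:
  fixes n :: "int^'d::finite"
  shows "(\<integral>x. cis (real_vec n \<bullet> x) \<partial>torus) = (if n = 0 then 1 else 0)"
proof (cases "n = 0")
  case True
  then show ?thesis by (simp add: measure_torus_box)
next
  case False
  have int: "integrable torus (\<lambda>x. cis (real_vec n \<bullet> x))"
    by (rule integrable_torus_continuous[where B=1]) (auto intro!: continuous_intros simp: cis_conv_exp)
  have "Re (\<integral>x. cis (real_vec n \<bullet> x) \<partial>torus) = (\<integral>x. cos (real_vec n \<bullet> x) \<partial>torus)"
    using int by (subst integral_Re[symmetric]) auto
  moreover have "Im (\<integral>x. cis (real_vec n \<bullet> x) \<partial>torus) = (\<integral>x. sin (real_vec n \<bullet> x) \<partial>torus)"
    using int by (subst integral_Im[symmetric]) auto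
  moreover have "(\<integral>x. sin (real_vec n \<bullet> x) \<partial>torus) = 0"
    using integral_torus_cos[OF False, of "- (pi / 2)"] by (simp add: cos_diff)
  ultimately show ?thesis
    using integral_torus_cos[OF False, of 0] False by (simp add: complex_eq_iff)
qed

lemma continuous_on_cis [continuous_intros]:
  "continuous_on A f \<Longrightarrow> continuous_on A (\<lambda>x. cis (f x))"
  by (simp add: cis_conv_exp continuous_intros)

lemma integrable_torus_trig:
  fixes n :: "int^'d::finite"
  shows "integrable torus (\<lambda>x. c * cis (real_vec n \<bullet> x + \<phi>) :: complex)"
proof (rule integrable_torus_continuous)
  show "continuous_on UNIV (\<lambda>x. c * cis (real_vec n \<bullet> x + \<phi>))"
    by (intro continuous_intros)
  show "cmod (c * cis (real_vec n \<bullet> x + \<phi>)) \<le> cmod c" for x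
    by (simp add: norm_mult)
qed

lemma fourier_trig:
  fixes N :: "(int^'d::finite) set"
  assumes "finite N"
  shows "fourier (\<lambda>x. \<Sum>n\<in>N. c n * cis (real_vec n \<bullet> x)) m = (if m \<in> N then c m else 0)"
proof -
  have "fourier (\<lambda>x. \<Sum>n\<in>N. c n * cis (real_vec n \<bullet> x)) m
      = (\<integral>x. (\<Sum>n\<in>N. c n * cis (real_vec (n - m) \<bullet> x)) \<partial>torus)"
    unfolding fourier_def
    by (simp add: sum_distrib_right mult.assoc cis_mult real_vec_diff inner_diff_left)
  also have "\<dots> = (\<Sum>n\<in>N. \<integral>x. c n * cis (real_vec (n - m) \<bullet> x) \<partial>torus)"
    using integrable_torus_trig[where \<phi>=0] by (subst Bochner_Integration.integral_sum) auto
  also have "\<dots> = (\<Sum>n\<in>N. if n = m then c n else 0)"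
    by (rule sum.cong) (auto simp: integral_torus_cis)
  also have "\<dots> = (if m \<in> N then c m else 0)"
    using assms by (simp add: sum.delta')
  finally show ?thesis .
qed

lemma parseval_trig:
  fixes N :: "(int^'d::finite) set"
  assumes "finite N"
  shows "(\<integral>x. (cmod (\<Sum>n\<in>N. c n * cis (real_vec n \<bullet> x)))\<^sup>2 \<partial>torus) = (\<Sum>n\<in>N. (cmod (c n))\<^sup>2)"
proof -
  let ?f = "\<lambda>x. \<Sum>n\<in>N. c n * cis (real_vec n \<bullet> x)"
  have eq: "complex_of_real ((cmod (?f x))\<^sup>2)
      = (\<Sum>n\<in>N. \<Sum>m\<in>N. (c n * cnj (c m)) * cis (real_vec (n - m) \<bullet> x))" for x
    by (simp only: complex_norm_square cnj_sum sum_product complex_cnj_mult cis_cnj)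
       (simp add: mult_ac cis_mult real_vec_diff inner_diff_left)
  have "complex_of_real (\<integral>x. (cmod (?f x))\<^sup>2 \<partial>torus) = (\<integral>x. complex_of_real ((cmod (?f x))\<^sup>2) \<partial>torus)"
    by (rule integral_complex_of_real[symmetric])
  also have "\<dots> = (\<Sum>n\<in>N. \<Sum>m\<in>N. \<integral>x. (c n * cnj (c m)) * cis (real_vec (n - m) \<bullet> x) \<partial>torus)"
    unfolding eq using integrable_torus_trig[where \<phi>=0 and 'd='d]
    by (subst Bochner_Integration.integral_sum,
        (intro Bochner_Integration.integrable_sum, simp))
       (intro sum.cong refl Bochner_Integration.integral_sum, simp)
  also have "\<dots> = (\<Sum>n\<in>N. \<Sum>m\<in>N. if n = m then c n * cnj (c n) else 0)"
    by (intro sum.cong) (auto simp: integral_torus_cis)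
  also have "\<dots> = (\<Sum>n\<in>N. c n * cnj (c n))"
    using assms by (simp add: sum.delta)
  also have "\<dots> = complex_of_real (\<Sum>n\<in>N. (cmod (c n))\<^sup>2)"
    by (simp only: of_real_sum complex_norm_square)
  finally show ?thesis
    by (simp only: of_real_eq_iff)
qed

lemma closed_coords:
  "closed {y :: real^'d::finite. \<forall>i. \<bar>y $ i - b i\<bar> \<le> r}"
  by (intro closed_Collect_all closed_Collect_le continuous_intros)

text \<open>
  The points whose image under \<open>T\<close> lies within \<open>r\<close> of the translate of \<open>2 \<pi> \<int>\<^sup>d\<close> by \<open>z\<close>. Their exact
  measure is \<open>(min 1 (r / \<pi>)) ^ d\<close>; the bound only counts the part \<open>[0, r]\<^sup>d\<close> of the cube
  \<open>[- r, r]\<^sup>d\<close>, because that part lies in the fundamental domain.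
\<close>
lemma measure_torus_pullback:
  fixes T :: "real^'d::finite \<Rightarrow> real^'d"
  assumes T: "linear T" "surj T"
    and Tper: "\<And>x i. \<exists>b::int^'d. T (x + axis i (2 * pi)) = T x + (2 * pi) *\<^sub>R real_vec b"
    and r: "0 < r" "r < 2 * pi"
  shows "{x\<in>torus_box. \<exists>b::int^'d. \<forall>i. \<bar>T x $ i - z $ i - 2 * pi * real_of_int (b $ i)\<bar> \<le> r} \<in> sets torus" (is "?A \<in> _")
    and "measure torus {x\<in>torus_box. \<exists>b::int^'d. \<forall>i. \<bar>T x $ i - z $ i - 2 * pi * real_of_int (b $ i)\<bar> \<le> r}
          \<ge> (r / (2 * pi)) ^ CARD('d)"
proof -
  define P where "P = (\<Union>b::int^'d. {y :: real^'d. \<forall>i. \<bar>y $ i - (z $ i + 2 * pi * real_of_int (b $ i))\<bar> \<le> r})"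
  have P: "y \<in> P \<longleftrightarrow> (\<exists>b::int^'d. \<forall>i. \<bar>y $ i - z $ i - 2 * pi * real_of_int (b $ i)\<bar> \<le> r)" for y
    by (simp add: P_def algebra_simps)
  have Pm [measurable]: "P \<in> sets borel"
    unfolding P_def by (intro sets.countable_UN' borel_closed closed_coords) auto
  have Pshift: "y + (2 * pi) *\<^sub>R real_vec c \<in> P \<longleftrightarrow> y \<in> P" for y and c :: "int^'d"
  proof
    assume "y + (2 * pi) *\<^sub>R real_vec c \<in> P"
    then obtain b :: "int^'d" where b: "\<And>i. \<bar>(y + (2 * pi) *\<^sub>R real_vec c) $ i - z $ i - 2 * pi * real_of_int (b $ i)\<bar> \<le> r"
      unfolding P by blast
    have "\<bar>y $ i - z $ i - 2 * pi * real_of_int ((b - c) $ i)\<bar> \<le> r" for i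
      using b[of i] by (simp add: real_vec_def algebra_simps)
    then show "y \<in> P" unfolding P by blast
  next
    assume "y \<in> P"
    then obtain b :: "int^'d" where b: "\<And>i. \<bar>y $ i - z $ i - 2 * pi * real_of_int (b $ i)\<bar> \<le> r"
      unfolding P by blast
    have "\<bar>(y + (2 * pi) *\<^sub>R real_vec c) $ i - z $ i - 2 * pi * real_of_int ((b + c) $ i)\<bar> \<le> r" for i
      using b[of i] by (simp add: real_vec_def algebra_simps)
    then show "y + (2 * pi) *\<^sub>R real_vec c \<in> P" unfolding P by blast
  qed
  have Tm [measurable]: "T \<in> borel_measurable borel"
    using linear_continuous_on[of T UNIV] T(1)
    by (simp add: borel_measurable_continuous_onI linear_conv_bounded_linear)
  have A: "?A = (T -` P) \<inter> torus_box"
    by (simp add: set_eq_iff P conj_commute)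
  have TP: "T -` P \<in> sets borel"
    using measurable_sets[OF Tm Pm] by simp
  show meas: "?A \<in> sets torus"
    unfolding A using TP by (rule borel_Int_box_sets_torus)
  let ?g = "indicator P :: real^'d \<Rightarrow> ennreal"
  have per: "torus_periodic ?g"
  proof -
    have "?g (x + axis i (2 * pi)) = ?g x" for x i
    proof -
      have "axis i (2 * pi) = (2 * pi) *\<^sub>R real_vec (axis i 1)"
        by (simp add: vec_eq_iff real_vec_def axis_def)
      then show ?thesis using Pshift[of x "axis i 1"] by (simp add: indicator_def)
    qed
    then show ?thesis by (simp add: torus_periodic_def)
  qed
  have perT: "torus_periodic (\<lambda>x. ?g (T x))"
    unfolding torus_periodic_def
  proof (intro allI)
    fix x i
    obtain b :: "int^'d" where "T (x + axis i (2 * pi)) = T x + (2 * pi) *\<^sub>R real_vec b"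
      using Tper by blast
    then show "?g (T (x + axis i (2 * pi))) = ?g (T x)"
      using Pshift[of "T x" b] by (simp add: indicator_def)
  qed
  let ?u = "(\<chi> i. r) :: real^'d"
  have gm: "?g \<in> borel_measurable borel" by measurable
  have "emeasure torus ?A = (\<integral>\<^sup>+x. indicator ?A x \<partial>torus)"
    using meas by simp
  also have "\<dots> = (\<integral>\<^sup>+x. ?g (T x) \<partial>torus)"
    by (rule nn_integral_cong) (auto simp: A indicator_def)
  also have "\<dots> = (\<integral>\<^sup>+x. ?g x \<partial>torus)"
    by (rule nn_integral_torus_linear[OF gm per T perT])
  also have "\<dots> = (\<integral>\<^sup>+x. ?g (x + z) \<partial>torus)"
    by (rule nn_integral_torus_translate[OF gm per, symmetric])
  also have "\<dots> \<ge> (\<integral>\<^sup>+x. indicator (cbox 0 ?u) x \<partial>torus)"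
  proof (rule nn_integral_mono)
    fix x :: "real^'d"
    have "x + z \<in> P" if "x \<in> cbox 0 ?u"
      unfolding P using that by (intro exI[of _ 0]) (auto simp: mem_box_cart)
    then show "indicator (cbox 0 ?u) x \<le> ?g (x + z)"
      by (auto simp: indicator_def)
  qed
  also have "(\<integral>\<^sup>+x. indicator (cbox 0 ?u) x \<partial>torus)
      = ennreal (1 / (2 * pi) ^ CARD('d)) * (\<integral>\<^sup>+x. indicator (cbox 0 ?u) x * indicator torus_box x \<partial>lborel)"
    by (rule nn_integral_torus) simp
  also have "(\<integral>\<^sup>+x. indicator (cbox 0 ?u) x * indicator torus_box x \<partial>lborel) = (\<integral>\<^sup>+x. indicator (cbox 0 ?u) x \<partial>lborel)"
  proof -
    have "cbox 0 ?u \<subseteq> torus_box"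
    proof
      fix x assume "x \<in> cbox 0 ?u"
      then have "0 \<le> x $ i \<and> x $ i \<le> r" for i by (auto simp: mem_box_cart)
      then show "x \<in> torus_box"
        using r(2) le_less_trans by (fastforce simp: torus_box_def)
    qed
    then show ?thesis
      by (intro nn_integral_cong) (auto simp: indicator_def)
  qed
  also have "\<dots> = ennreal (r ^ CARD('d))"
  proof -
    have "emeasure lborel (cbox 0 ?u) = (\<Prod>b\<in>Basis. (?u - 0) \<bullet> b)"
      using r by (intro emeasure_lborel_cbox) (auto simp: Basis_vec_def inner_axis)
    also have "(\<Prod>b\<in>Basis. (?u - 0) \<bullet> b) = (\<Prod>b\<in>(Basis::(real^'d) set). r)"
      by (rule prod.cong) (auto simp: Basis_vec_def inner_axis)
    finally show ?thesis by simp
  qed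
  also have "ennreal (1 / (2 * pi) ^ CARD('d)) * ennreal (r ^ CARD('d)) = ennreal ((r / (2 * pi)) ^ CARD('d))"
    using r by (simp add: ennreal_mult[symmetric] power_divide)
  finally have "ennreal ((r / (2 * pi)) ^ CARD('d)) \<le> emeasure torus ?A" .
  then show "measure torus ?A \<ge> (r / (2 * pi)) ^ CARD('d)"
    unfolding finite_measure.emeasure_eq_measure[OF finite_measure_torus] by (simp add: ennreal_le_iff)
qed

section \<open>Arithmetic of orthogonal frequency lattices\<close>

text \<open>
  The arithmetic data behind a focusing sum: pairwise orthogonal integer vectors \<open>m\<^sub>i\<close> of squared
  length \<open>D\<close>, where \<open>D\<close> is comparable to \<open>g ^ d\<close>, and an integer vector \<open>v\<close> such that the points
  \<open>2 a (m\<^sub>i \<bullet> v) / D\<close>, for \<open>a\<close> modulo \<open>D\<close>, are separated by \<open>1 / (8 g)\<close> modulo \<open>\<int>\<^sup>d\<close>.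
\<close>
definition design :: "nat \<Rightarrow> nat \<Rightarrow> ('d::finite \<Rightarrow> int ^ 'd) \<Rightarrow> int ^ 'd \<Rightarrow> bool" where
  "design g D m v \<longleftrightarrow>
     (\<forall>i j. real_vec (m i) \<bullet> real_vec (m j) = (if i = j then real D else 0)) \<and>
     g ^ CARD('d) \<le> D \<and> D \<le> 4 * g ^ CARD('d) \<and> (\<forall>i. (v $ i)\<^sup>2 \<le> int D) \<and>
     (\<forall>a::int. (\<forall>i. \<exists>b::int. \<bar>real_of_int (2 * a) * (real_vec (m i) \<bullet> real_vec v) / real D - real_of_int b\<bar>
         < 1 / (8 * real g)) \<longrightarrow> int D dvd a)"

text \<open>
  Digit expansion: if \<open>y g\<^sup>j\<close> is within \<open>1 / (8 g)\<close> of an integer for all \<open>j < r\<close>, then multiplication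
  of the error by \<open>g\<close> never wraps around, so \<open>y\<close> itself is within \<open>1 / (8 g\<^sup>r)\<close> of an integer.
\<close>
lemma near_integer_chain:
  fixes y :: real and g r :: nat
  assumes g: "g \<ge> 1" and r: "r \<ge> 1"
    and near: "\<And>j. j < r \<Longrightarrow> \<exists>b::int. \<bar>y * real g ^ j - real_of_int b\<bar> < 1 / (8 * real g)"
  shows "\<exists>b::int. \<bar>y - real_of_int b\<bar> * real g ^ r < 1 / 8"
proof -
  obtain b :: int where b: "\<bar>y * real g ^ 0 - real_of_int b\<bar> < 1 / (8 * real g)"
    using near[of 0] r by auto
  have step: "\<bar>y - real_of_int b\<bar> * real g ^ j < 1 / (8 * real g)" if "j < r" for j
    using that
  proof (induction j)
    case 0
    then show ?case using b by simp
  next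
    case (Suc j)
    define e where "e = (y - real_of_int b) * real g ^ Suc j"
    have "\<bar>y - real_of_int b\<bar> * real g ^ j * real g < 1 / (8 * real g) * real g"
      using Suc g by (intro mult_strict_right_mono) auto
    moreover have "\<bar>e\<bar> = \<bar>y - real_of_int b\<bar> * real g ^ j * real g"
      by (simp add: e_def abs_mult)
    ultimately have e: "\<bar>e\<bar> < 1 / 8"
      using g by simp
    obtain c :: int where c: "\<bar>y * real g ^ Suc j - real_of_int c\<bar> < 1 / (8 * real g)"
      using near[OF Suc.prems] by blast
    define k where "k = c - b * int g ^ Suc j"
    have eq: "y * real g ^ Suc j - real_of_int c = e - real_of_int k"
      by (simp add: e_def k_def algebra_simps)
    have "1 / (8 * real g) \<le> 1 / 8"
      using g by (simp add: field_simps)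
    then have "\<bar>real_of_int k\<bar> < 1"
      using c e unfolding eq by linarith
    then have "k = 0" by linarith
    then have "\<bar>e\<bar> < 1 / (8 * real g)" using c unfolding eq by simp
    then show ?case by (simp add: e_def abs_mult)
  qed
  have "\<bar>y - real_of_int b\<bar> * real g ^ r = \<bar>y - real_of_int b\<bar> * real g ^ (r - 1) * real g"
    using r by (cases r) auto
  also have "\<dots> < 1 / (8 * real g) * real g"
    using step[of "r - 1"] r g by (intro mult_strict_right_mono) auto
  also have "\<dots> = 1 / 8"
    using g by simp
  finally have "\<bar>y - real_of_int b\<bar> * real g ^ r < 1 / 8" .
  then show ?thesis by blast
qed

text \<open>
  In terms of Gaussian integers: an ordinary integer divisible by a primitive \<open>A + \<i> B\<close> is divisible by the
  norm of \<open>A + \<i> B\<close>.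
\<close>
lemma sum_squares_dvd:
  fixes A B b b' \<theta> :: int
  assumes "coprime A B" "A \<noteq> 0" "B * b = A * b'" "\<theta> = A * b + B * b'"
  shows "A\<^sup>2 + B\<^sup>2 dvd \<theta>"
proof -
  have "A dvd B * b" using assms by simp
  then have "A dvd b" using assms(1) by (simp add: coprime_dvd_mult_right_iff)
  then obtain c where c: "b = A * c" by blast
  then have "b' = B * c" using assms by simp
  then have "\<theta> = (A\<^sup>2 + B\<^sup>2) * c"
    using c assms(4) by (simp add: power2_eq_square algebra_simps)
  then show ?thesis by simp
qed

text \<open>
  If \<open>\<theta> / (A + \<i> B)\<close> is within \<open>1 / (8 G)\<close> of a Gaussian integer in each coordinate, then \<open>\<theta>\<close> is congruent
  modulo \<open>A + \<i> B\<close> to a Gaussian integer \<open>x + \<i> y\<close> of norm less than \<open>D / (32 G\<^sup>2)\<close>. The quotient is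
  \<open>b - \<i> b'\<close>.
\<close>
lemma gaussian_remainder:
  fixes A B \<theta> :: int and D :: nat and G :: real
  assumes D: "int D = A\<^sup>2 + B\<^sup>2" "D > 0" and G: "G > 0"
    and "\<exists>b::int. \<bar>real_of_int \<theta> * real_of_int A / real D - real_of_int b\<bar> * G < 1 / 8"
    and "\<exists>b::int. \<bar>real_of_int \<theta> * real_of_int B / real D - real_of_int b\<bar> * G < 1 / 8"
  obtains b b' x y :: int where
    "\<theta> = x + A * b + B * b'" "0 = y + B * b - A * b'"
    "real_of_int (x\<^sup>2 + y\<^sup>2) * (32 * G\<^sup>2) < real D"
proof -
  obtain b b' :: int
    where b: "\<bar>real_of_int \<theta> * real_of_int A / real D - real_of_int b\<bar> * G < 1 / 8"
      and b': "\<bar>real_of_int \<theta> * real_of_int B / real D - real_of_int b'\<bar> * G < 1 / 8"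
    using assms by blast
  define e where "e = real_of_int \<theta> * real_of_int A / real D - real_of_int b"
  define e' where "e' = real_of_int \<theta> * real_of_int B / real D - real_of_int b'"
  define x where "x = \<theta> - (A * b + B * b')"
  define y where "y = A * b' - B * b"
  have rD: "real D = real_of_int A ^ 2 + real_of_int B ^ 2"
    using arg_cong[OF D(1), of real_of_int] by simp
  have D0: "real D > 0" using D by simp
  have De: "real D * e = real_of_int (\<theta> * A) - real D * real_of_int b"
    using D0 by (simp add: e_def field_simps)
  have De': "real D * e' = real_of_int (\<theta> * B) - real D * real_of_int b'"
    using D0 by (simp add: e'_def field_simps)
  have x: "real_of_int x = real_of_int A * e + real_of_int B * e'"
  proof -
    have "real D * (real_of_int A * e + real_of_int B * e') = real D * real_of_int x"
    proof -
      have "real D * (real_of_int A * e + real_of_int B * e')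
        = real_of_int A * (real D * e) + real_of_int B * (real D * e')" by (simp add: algebra_simps)
      also have "\<dots> = real D * real_of_int x"
        unfolding De De' unfolding x_def rD by (simp add: algebra_simps power2_eq_square)
      finally show ?thesis .
    qed
    then show ?thesis using D0 by simp
  qed
  have y: "real_of_int y = real_of_int B * e - real_of_int A * e'"
  proof -
    have "real D * (real_of_int B * e - real_of_int A * e') = real D * real_of_int y"
    proof -
      have "real D * (real_of_int B * e - real_of_int A * e')
        = real_of_int B * (real D * e) - real_of_int A * (real D * e')" by (simp add: algebra_simps)
      also have "\<dots> = real D * real_of_int y"
        unfolding De De' y_def by (simp add: algebra_simps)
      finally show ?thesis .
    qed
    then show ?thesis using D0 by simp
  qed
  have xy: "real_of_int (x\<^sup>2 + y\<^sup>2) = real D * (e\<^sup>2 + e'\<^sup>2)"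
    by (simp add: x y rD power2_eq_square algebra_simps)
  have "(e * G)\<^sup>2 < (1 / 8)\<^sup>2" "(e' * G)\<^sup>2 < (1 / 8)\<^sup>2"
    using b b' G by (auto simp: abs_square_less_1[symmetric] e_def e'_def abs_mult
        intro!: power2_strict_mono)
  then have "(e\<^sup>2 + e'\<^sup>2) * (32 * G\<^sup>2) < 1"
    by (simp add: power2_eq_square algebra_simps)
  then have "real D * ((e\<^sup>2 + e'\<^sup>2) * (32 * G\<^sup>2)) < real D * 1"
    using D0 by (intro mult_strict_left_mono)
  then have "real_of_int (x\<^sup>2 + y\<^sup>2) * (32 * G\<^sup>2) < real D"
    unfolding xy by (simp add: mult_ac)
  moreover have "\<theta> = x + A * b + B * b'" "0 = y + B * b - A * b'"
    by (auto simp: x_def y_def)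
  ultimately show ?thesis using that by blast
qed

text \<open>
  The separation for \<open>d = 2 r\<close>, with \<open>g\<^sup>r + \<i>\<close> as the Gaussian integer: the remainder has norm less than
  \<open>1\<close>. As \<open>g\<close> is even, \<open>D\<close> is odd and the factor \<open>2\<close> can be cancelled.
\<close>
lemma even_separation:
  fixes g r :: nat and a :: int
  defines "D \<equiv> g ^ (2 * r) + 1"
  assumes g: "even g" "g \<ge> 2" and r: "r \<ge> 1"
    and A: "\<And>j. j < r \<Longrightarrow> \<exists>b::int. \<bar>real_of_int (2 * a) * real_of_int (int g ^ r) / real D * real g ^ j - real_of_int b\<bar> < 1 / (8 * real g)"
    and B: "\<And>j. j < r \<Longrightarrow> \<exists>b::int. \<bar>real_of_int (2 * a) * real_of_int 1 / real D * real g ^ j - real_of_int b\<bar> < 1 / (8 * real g)"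
  shows "int D dvd a"
proof -
  have D: "int D = (int g ^ r)\<^sup>2 + 1\<^sup>2" "D > 0"
    by (auto simp: D_def power_mult mult.commute[of 2])
  have G: "real g ^ r > 0" using g by simp
  have g1: "g \<ge> 1" using g by simp
  obtain b b' x y :: int where eq: "2 * a = x + int g ^ r * b + 1 * b'" "0 = y + 1 * b - int g ^ r * b'"
    and bd: "real_of_int (x\<^sup>2 + y\<^sup>2) * (32 * (real g ^ r)\<^sup>2) < real D"
    by (rule gaussian_remainder[OF D G near_integer_chain[OF g1 r A] near_integer_chain[OF g1 r B]]; (assumption | rule that; assumption))
  have "real g ^ r \<ge> 1" using g by simp
  then have gr1: "(real g ^ r)\<^sup>2 \<ge> 1" by simp
  have "real D = (real g ^ r)\<^sup>2 + 1"
    by (simp add: D_def power_mult mult.commute[of 2])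
  then have "real_of_int (x\<^sup>2 + y\<^sup>2) * (32 * (real g ^ r)\<^sup>2) < 1 * (32 * (real g ^ r)\<^sup>2)"
    using bd gr1 by linarith
  then have "real_of_int (x\<^sup>2 + y\<^sup>2) < 1"
    using gr1 g by (subst (asm) mult_less_cancel_right_pos) auto
  then have "x\<^sup>2 + y\<^sup>2 < 1"
    by linarith
  moreover have "0 \<le> x\<^sup>2" "0 \<le> y\<^sup>2" by auto
  ultimately have "x\<^sup>2 = 0" "y\<^sup>2 = 0" by linarith+
  then have "x = 0" "y = 0" by auto
  then have "(int g ^ r)\<^sup>2 + 1\<^sup>2 dvd 2 * a"
    using eq g by (intro sum_squares_dvd[of _ _ b b']) auto
  then have "int D dvd 2 * a"
    by (simp add: D)
  moreover have "odd D" using g r by (simp add: D_def)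
  then have "coprime (int D) 2" by simp
  ultimately show ?thesis
    by (simp add: coprime_dvd_mult_right_iff)
qed

text \<open>
  The linear form \<open>u ((u + 1) x + u k\<^sup>2 y) / m\<close> with \<open>m = (u + 1)\<^sup>2 + (u k\<^sup>2)\<^sup>2\<close> is roughly
  \<open>x / k\<^sup>4 + y / k\<^sup>2\<close>. On integers with \<open>|x|, |y| \<le> k\<^sup>2 / 2\<close> its modulus is at most \<open>11/16\<close>, and it is
  not close to \<open>0\<close> unless \<open>x = y = 0\<close>; so only then is it within \<open>1 / (8 k\<^sup>4)\<close> of an integer.
\<close>
lemma odd_no_wrap:
  fixes k u x y c :: int
  assumes k: "k \<ge> 2" and u: "u \<ge> 2"
    and x: "2 * \<bar>x\<bar> \<le> k\<^sup>2" and y: "2 * \<bar>y\<bar> \<le> k\<^sup>2"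
    and near: "8 * k ^ 4 * \<bar>u * ((u + 1) * x + u * k\<^sup>2 * y) - c * ((u + 1)\<^sup>2 + (u * k\<^sup>2)\<^sup>2)\<bar>
        < (u + 1)\<^sup>2 + (u * k\<^sup>2)\<^sup>2"
  shows "x = 0 \<and> y = 0"
proof -
  define q where "q = k\<^sup>2"
  have q: "q \<ge> 4" using k power_mono[of 2 k 2] by (simp add: q_def)
  have k4: "k ^ 4 = q\<^sup>2" by (simp add: q_def power_mult[symmetric])
  define w where "w = (u + 1) * x + u * q * y"
  define m where "m = (u + 1)\<^sup>2 + (u * q)\<^sup>2"
  have near': "8 * q\<^sup>2 * \<bar>u * w - c * m\<bar> < m"
    using near unfolding k4 w_def m_def q_def by simp
  have uq: "u * q \<ge> 2 * 4" using u q by (intro mult_mono) auto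
  have uq1: "u + 1 \<le> u * q"
  proof -
    have "u * 2 \<le> u * q" using u q by (intro mult_left_mono) auto
    then show ?thesis using u by linarith
  qed
  have m_ub: "m \<le> 2 * (u * q)\<^sup>2"
    using power_mono[OF uq1, of 2] u by (simp add: m_def)
  have m_lb: "m \<ge> (u * q)\<^sup>2" by (simp add: m_def)
  have m0: "m > 0" using u by (simp add: m_def add_pos_nonneg)
  have w_ub: "2 * \<bar>w\<bar> \<le> (u + 1) * q + u * q * q"
  proof -
    have "\<bar>w\<bar> \<le> (u + 1) * \<bar>x\<bar> + u * q * \<bar>y\<bar>"
      using u q unfolding w_def by (simp add: abs_mult order_trans[OF abs_triangle_ineq])
    moreover have "(u + 1) * (2 * \<bar>x\<bar>) \<le> (u + 1) * q" "u * q * (2 * \<bar>y\<bar>) \<le> u * q * q"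
      using x y u q unfolding q_def[symmetric] by (intro mult_left_mono; simp)+
    ultimately show ?thesis by (simp add: algebra_simps)
  qed
  have uw: "16 * \<bar>u * w\<bar> \<le> 11 * m"
  proof -
    have "u * (2 * \<bar>w\<bar>) \<le> u * ((u + 1) * q + u * q * q)"
      using u w_ub by (intro mult_left_mono) auto
    then have "16 * \<bar>u * w\<bar> \<le> 8 * (u * ((u + 1) * q + u * q * q))"
      using u by (simp add: abs_mult)
    also have "\<dots> = 8 * (u * u * q) + 8 * (u * q) + 8 * (u * q)\<^sup>2"
      by (simp add: algebra_simps power2_eq_square)
    also have "8 * (u * u * q) \<le> 2 * (u * q)\<^sup>2"
    proof -
      have "(u * u * q) * 4 \<le> (u * u * q) * q" using u q by (intro mult_left_mono) auto
      then show ?thesis by (simp add: algebra_simps power2_eq_square)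
    qed
    also have "8 * (u * q) \<le> (u * q)\<^sup>2"
      using uq by (simp add: power2_eq_square mult_right_mono)
    finally show ?thesis using m_lb by linarith
  qed
  have q2: "q\<^sup>2 \<ge> 16" using power_mono[OF q, of 2] by simp
  have "16 * \<bar>u * w - c * m\<bar> \<le> q\<^sup>2 * \<bar>u * w - c * m\<bar>"
    using q2 by (intro mult_right_mono) auto
  moreover have "0 \<le> q\<^sup>2 * \<bar>u * w - c * m\<bar>" by simp
  ultimately have "16 * \<bar>u * w - c * m\<bar> < m"
    using near' by linarith
  moreover have "\<bar>c * m\<bar> \<le> \<bar>u * w\<bar> + \<bar>u * w - c * m\<bar>"
  proof -
    have "\<bar>t\<bar> \<le> \<bar>z\<bar> + \<bar>z - t\<bar>" for z t :: int by linarith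
    then show ?thesis .
  qed
  moreover have "16 * z < 16 * m" if "16 * y < m" "z \<le> x + y" "16 * x \<le> 11 * m" for x y z :: int
    using that m0 by linarith
  ultimately have "16 * \<bar>c * m\<bar> < 16 * m"
    using uw by blast
  then have "\<bar>c\<bar> * m < 1 * m" using m0 by (simp add: abs_mult)
  then have "\<bar>c\<bar> < 1" using m0 by (subst (asm) mult_less_cancel_right_pos) auto
  then have "c = 0" by linarith
  then have "8 * q\<^sup>2 * (u * \<bar>w\<bar>) < m"
    using near' u by (simp add: abs_mult)
  then have "(q\<^sup>2 * u) * (8 * \<bar>w\<bar>) < (q\<^sup>2 * u) * (2 * u)"
    using m_ub by (simp add: algebra_simps power2_eq_square)
  moreover have "q\<^sup>2 * u > 0" using q u by simp
  ultimately have w: "4 * \<bar>w\<bar> < u"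
    by (subst (asm) mult_less_cancel_left_pos) auto
  have y0: "y = 0"
  proof (rule ccontr)
    assume "y \<noteq> 0"
    then have "\<bar>y\<bar> \<ge> 1" by linarith
    then have 1: "u * q * \<bar>y\<bar> \<ge> u * q" using u q mult_left_mono[of 1 "\<bar>y\<bar>" "u * q"] by simp
    have 2: "(u + 1) * (2 * \<bar>x\<bar>) \<le> (u + 1) * q"
      using x u unfolding q_def[symmetric] by (intro mult_left_mono) auto
    have "u * q * \<bar>y\<bar> = \<bar>w - (u + 1) * x\<bar>"
      using u q by (simp add: w_def abs_mult)
    also have "\<dots> \<le> \<bar>w\<bar> + (u + 1) * \<bar>x\<bar>"
      using u by (simp add: abs_mult order_trans[OF abs_triangle_ineq4])
    finally have "2 * (u * q) \<le> 2 * \<bar>w\<bar> + (u + 1) * q"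
      using 1 2 by linarith
    then have "(u - 1) * q \<le> 2 * \<bar>w\<bar>" by (simp add: algebra_simps)
    moreover have "(u - 1) * 4 \<le> (u - 1) * q" using u q by (intro mult_left_mono) auto
    ultimately have "(u - 1) * 4 \<le> 2 * \<bar>w\<bar>" by (rule order_trans[rotated])
    then have "4 * u - 4 \<le> 2 * \<bar>w\<bar>" by (simp add: algebra_simps)
    then show False using w u by linarith
  qed
  have "x = 0"
  proof (rule ccontr)
    assume "x \<noteq> 0"
    then have "\<bar>x\<bar> \<ge> 1" by linarith
    then have "(u + 1) * \<bar>x\<bar> \<ge> u + 1" using u mult_left_mono[of 1 "\<bar>x\<bar>" "u + 1"] by simp
    moreover have "\<bar>w\<bar> = (u + 1) * \<bar>x\<bar>"
      using u by (simp add: w_def y0 abs_mult)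
    ultimately show False using w u by linarith
  qed
  then show ?thesis using y0 by simp
qed

text \<open>
  The separation for \<open>d = 2 r + 1\<close>. The Gaussian integer is the square of \<open>P + \<i> Q\<close>, so \<open>D = M\<^sup>2\<close> with
  \<open>M = P\<^sup>2 + Q\<^sup>2\<close>. The \<open>r\<close> pairs of coordinates leave a remainder \<open>x + \<i> y\<close> of \<open>2 a\<close> with
  \<open>|x|, |y| \<le> k\<^sup>2 / 2\<close>; since \<open>P + \<i> Q\<close> divides the modulus, the last coordinate is
  \<open>u (P x + Q y) / M\<close> modulo \<open>1\<close>, and it detects the remainder by the preceding lemma.
\<close>
lemma odd_separation:
  fixes k r :: nat and a :: int
  defines "u \<equiv> int k ^ (2 * r - 1)"
  defines "P \<equiv> u + 1" and "Q \<equiv> u * (int k)\<^sup>2"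
  defines "M \<equiv> P\<^sup>2 + Q\<^sup>2"
  assumes D: "int D = M\<^sup>2" and k: "k \<ge> 2" and r: "r \<ge> 1" and g: "g = k ^ 4"
    and A: "\<And>j. j < r \<Longrightarrow> \<exists>b::int. \<bar>real_of_int (2 * a) * real_of_int (P\<^sup>2 - Q\<^sup>2) / real D * real g ^ j - real_of_int b\<bar> < 1 / (8 * real g)"
    and B: "\<And>j. j < r \<Longrightarrow> \<exists>b::int. \<bar>real_of_int (2 * a) * real_of_int (2 * P * Q) / real D * real g ^ j - real_of_int b\<bar> < 1 / (8 * real g)"
    and L: "\<exists>b::int. \<bar>real_of_int (2 * a) * real_of_int (M * (u * P)) / real D - real_of_int b\<bar> < 1 / (8 * real g)"
  shows "int D dvd a"
proof -
  have g1: "g \<ge> 1" unfolding g using k by (simp add: Suc_le_eq)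
  have u2: "u \<ge> 2"
  proof -
    have "2 * r - 1 = Suc (2 * r - 2)" using r by simp
    then have "u = int k * int k ^ (2 * r - 2)"
      by (simp only: u_def power_Suc)
    moreover have "int k ^ (2 * r - 2) \<ge> 1" using k by simp
    ultimately show ?thesis using k mult_mono[of 2 "int k" 1 "int k ^ (2 * r - 2)"] by simp
  qed
  have P0: "P > 0" using u2 by (simp add: P_def)
  have M0: "M > 0" using P0 by (simp add: M_def add_pos_nonneg)
  have D': "int D = (P\<^sup>2 - Q\<^sup>2)\<^sup>2 + (2 * P * Q)\<^sup>2"
    unfolding D M_def by (simp add: power2_eq_square algebra_simps)
  have Dpos: "D > 0" using D M0 by (metis of_nat_0_less_iff zero_less_power)
  have G: "real g ^ r > 0" using g1 by simp
  obtain b b' x y :: int where eq: "2 * a = x + (P\<^sup>2 - Q\<^sup>2) * b + (2 * P * Q) * b'"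
      "0 = y + (2 * P * Q) * b - (P\<^sup>2 - Q\<^sup>2) * b'"
    and bd: "real_of_int (x\<^sup>2 + y\<^sup>2) * (32 * (real g ^ r)\<^sup>2) < real D"
    by (rule gaussian_remainder[OF D' Dpos G near_integer_chain[OF g1 r A] near_integer_chain[OF g1 r B]];
        (assumption | rule that; assumption))
  have "2 * r + 1 = (2 * r - 1) + 2" using r by simp
  then have Qk: "Q = int k ^ (2 * r + 1)"
    by (simp only: Q_def u_def power_add)
  have M_ub: "M \<le> 2 * (int k ^ (2 * r + 1))\<^sup>2"
  proof -
    have k2: "(int k)\<^sup>2 \<ge> 4" using k power_mono[of 2 "int k" 2] by simp
    have "u * 2 \<le> u * (int k)\<^sup>2" using u2 k2 by (intro mult_left_mono) auto
    then have "P \<le> Q" using u2 unfolding P_def Q_def by linarith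
    then have "P\<^sup>2 \<le> Q\<^sup>2" using P0 by (intro power_mono) auto
    then have "M \<le> 2 * Q\<^sup>2" by (simp add: M_def)
    then show ?thesis by (simp only: Qk)
  qed
  have small: "8 * (x\<^sup>2 + y\<^sup>2) \<le> int k ^ 4"
  proof -
    have "M\<^sup>2 \<le> (2 * (int k ^ (2 * r + 1))\<^sup>2)\<^sup>2"
      using M_ub M0 by (intro power_mono) auto
    also have "\<dots> = 4 * (int k ^ 4 * (int g ^ r)\<^sup>2)"
      by (simp add: g power_mult_distrib power_mult[symmetric] algebra_simps)
    finally have "int D \<le> 4 * (int k ^ 4 * (int g ^ r)\<^sup>2)" using D by simp
    moreover have "(x\<^sup>2 + y\<^sup>2) * (32 * (int g ^ r)\<^sup>2) < int D"
    proof -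
      have "real_of_int ((x\<^sup>2 + y\<^sup>2) * (32 * (int g ^ r)\<^sup>2)) < real_of_int (int D)"
        using bd by simp
      then show ?thesis by (simp only: of_int_less_iff)
    qed
    ultimately have "(8 * (x\<^sup>2 + y\<^sup>2)) * (4 * (int g ^ r)\<^sup>2) < int k ^ 4 * (4 * (int g ^ r)\<^sup>2)"
      by linarith
    moreover have "4 * (int g ^ r)\<^sup>2 > 0" using g1 by simp
    ultimately show ?thesis by (subst (asm) mult_less_cancel_right_pos) auto
  qed
  have half: "2 * \<bar>t\<bar> \<le> (int k)\<^sup>2" if "4 * t\<^sup>2 \<le> int k ^ 4" for t
  proof (rule power2_le_imp_le)
    show "(2 * \<bar>t\<bar>)\<^sup>2 \<le> ((int k)\<^sup>2)\<^sup>2" using that by (simp add: power_mult_distrib)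
  qed simp
  have "4 * x\<^sup>2 \<le> int k ^ 4" "4 * y\<^sup>2 \<le> int k ^ 4"
    using small zero_le_power2[of x] zero_le_power2[of y] unfolding distrib_left by linarith+
  then have x2: "2 * \<bar>x\<bar> \<le> (int k)\<^sup>2" and y2: "2 * \<bar>y\<bar> \<le> (int k)\<^sup>2"
    by (auto intro: half)
  obtain c :: int where c: "\<bar>real_of_int (2 * a) * real_of_int (M * (u * P)) / real D - real_of_int c\<bar> < 1 / (8 * real g)"
    using L by blast
  have rD: "real D = real_of_int M * real_of_int M"
    using arg_cong[OF D, of real_of_int] by (simp add: power2_eq_square)
  have "real_of_int (2 * a) * real_of_int (M * (u * P)) / real D = real_of_int (u * P * (2 * a)) / real_of_int M"
    unfolding rD using M0 by (simp add: field_simps)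
  then have "\<bar>real_of_int (u * P * (2 * a)) / real_of_int M - real_of_int c\<bar> < 1 / (8 * real g)"
    using c by simp
  moreover have "real_of_int (u * P * (2 * a)) / real_of_int M - real_of_int c
      = real_of_int (u * P * (2 * a) - c * M) / real_of_int M"
    using M0 by (simp add: field_simps)
  ultimately have "\<bar>real_of_int (u * P * (2 * a) - c * M)\<bar> / real_of_int M < 1 / (8 * real g)"
    using M0 by (simp add: abs_divide)
  then have "8 * real g * \<bar>real_of_int (u * P * (2 * a) - c * M)\<bar> < real_of_int M"
    using M0 g1 by (simp add: field_simps)
  then have "real_of_int (8 * int k ^ 4 * \<bar>u * P * (2 * a) - c * M\<bar>) < real_of_int M"
    by (simp add: g)
  then have near: "8 * int k ^ 4 * \<bar>u * P * (2 * a) - c * M\<bar> < M"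
    by (simp only: of_int_less_iff)
  \<comment> \<open>The congruence of \<open>2 a\<close> and \<open>x + \<i> y\<close> modulo \<open>P + \<i> Q\<close>, multiplied by \<open>P - \<i> Q\<close>: its real part.\<close>
  have key: "P * (2 * a) = P * x + Q * y + M * (P * b + Q * b')"
  proof -
    have y: "y = (P\<^sup>2 - Q\<^sup>2) * b' - (2 * P * Q) * b" using eq(2) by simp
    show ?thesis unfolding eq(1) y M_def by (simp add: power2_eq_square algebra_simps)
  qed
  have "u * P * (2 * a) - c * M = u * (P * x + Q * y) - (c - u * (P * b + Q * b')) * M"
    using arg_cong[OF key, of "\<lambda>t. u * t"] by (simp add: algebra_simps)
  then have "x = 0 \<and> y = 0"
    using near k u2 x2 y2 odd_no_wrap[of "int k" u x y "c - u * (P * b + Q * b')"]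
    by (simp add: P_def Q_def M_def)
  then have xy: "x = 0" "y = 0" by auto
  have cop: "coprime P Q"
  proof -
    have "coprime (u + 1) u" by simp
    moreover have "coprime (u + 1) (int k)"
    proof -
      have "coprime (u + 1) (int k ^ (2 * r - 1))" using \<open>coprime (u + 1) u\<close> by (simp add: u_def)
      then show ?thesis using r by (subst (asm) coprime_power_right_iff) auto
    qed
    ultimately show ?thesis by (simp add: P_def Q_def)
  qed
  have par: "odd (P + Q)"
    using r by (simp add: P_def Q_def u_def)
  have copA: "coprime (P\<^sup>2 - Q\<^sup>2) (2 * P * Q)"
  proof -
    have "coprime (P\<^sup>2 - Q\<^sup>2) P"
    proof (rule coprimeI)
      fix c assume c: "c dvd P\<^sup>2 - Q\<^sup>2" "c dvd P"
      then have "c dvd Q\<^sup>2" by (metis dvd_diff_right_iff dvd_power zero_less_numeral dvd_trans)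
      moreover have "coprime P (Q\<^sup>2)" using cop by simp
      ultimately show "is_unit c" using c(2) coprime_common_divisor by blast
    qed
    moreover have "coprime (P\<^sup>2 - Q\<^sup>2) Q"
    proof (rule coprimeI)
      fix c assume c: "c dvd P\<^sup>2 - Q\<^sup>2" "c dvd Q"
      then have "c dvd P\<^sup>2" by (metis dvd_diff_left_iff dvd_power zero_less_numeral dvd_trans)
      moreover have "coprime (P\<^sup>2) Q" using cop by simp
      ultimately show "is_unit c" using c(2) coprime_common_divisor by blast
    qed
    moreover have "odd (P\<^sup>2 - Q\<^sup>2)" using par by simp
    ultimately show ?thesis by simp
  qed
  have "odd (P\<^sup>2 - Q\<^sup>2)" using par by simp
  then have "P\<^sup>2 - Q\<^sup>2 \<noteq> 0" by (metis dvd_0_right)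
  then have "(P\<^sup>2 - Q\<^sup>2)\<^sup>2 + (2 * P * Q)\<^sup>2 dvd 2 * a"
    using eq xy copA by (intro sum_squares_dvd[of _ _ b b']) auto
  then have "int D dvd 2 * a"
    by (simp only: D')
  moreover have "odd M" using par by (simp add: M_def)
  then have "odd (int D)" by (simp add: D)
  then have "coprime (int D) 2" by simp
  ultimately show ?thesis
    by (simp add: coprime_dvd_mult_right_iff)
qed

text \<open>
  Assembly of the vectors. The coordinates are numbered by \<open>h\<close>; those with numbers \<open>j\<close> and \<open>j + r\<close>, for
  \<open>j < r\<close>, form a pair, exchanged by the involution \<open>\<tau>\<close>. On a pair the two vectors are \<open>(A, B)\<close> and
  \<open>(- B, A)\<close> and \<open>v\<close> is \<open>(g\<^sup>j, 0)\<close>; in the last coordinate, present for odd \<open>d\<close>, they are \<open>M\<close> and \<open>V\<close>.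
\<close>
lemma design_from_params:
  fixes A B M V :: int and g D r :: nat
  assumes r: "r = CARD('d::finite) div 2" and D: "int D = A\<^sup>2 + B\<^sup>2"
    and M: "odd CARD('d) \<Longrightarrow> M\<^sup>2 = int D" and V: "odd CARD('d) \<Longrightarrow> V\<^sup>2 \<le> int D"
    and g: "g \<ge> 1" and bounds: "g ^ CARD('d) \<le> D" "D \<le> 4 * g ^ CARD('d)"
    and sep: "\<And>a::int. (\<And>j. j < r \<Longrightarrow> \<exists>b::int. \<bar>real_of_int (2 * a) * real_of_int A / real D * real g ^ j - real_of_int b\<bar> < 1 / (8 * real g)) \<Longrightarrow>
       (\<And>j. j < r \<Longrightarrow> \<exists>b::int. \<bar>real_of_int (2 * a) * real_of_int B / real D * real g ^ j - real_of_int b\<bar> < 1 / (8 * real g)) \<Longrightarrow>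
       (odd CARD('d) \<Longrightarrow> \<exists>b::int. \<bar>real_of_int (2 * a) * real_of_int (M * V) / real D - real_of_int b\<bar> < 1 / (8 * real g)) \<Longrightarrow> int D dvd a"
  shows "\<exists>(m :: 'd \<Rightarrow> int ^ 'd) v. design g D m v"
proof -
  let ?d = "CARD('d)"
  obtain h :: "'d \<Rightarrow> nat" where h: "bij_betw h UNIV {0..<?d}"
    using ex_bij_betw_finite_nat[of "UNIV :: 'd set"] by auto
  define e where "e = inv_into UNIV h"
  have he: "h (e j) = j" if "j < ?d" for j
    using bij_betw_inv_into_right[OF h] that by (simp add: e_def)
  have eh: "e (h i) = i" for i
    using bij_betw_inv_into_left[OF h] by (simp add: e_def)
  have hd: "h i < ?d" for i
    using bij_betwE[OF h] by auto
  have d2r: "2 * r \<le> ?d" "even ?d \<Longrightarrow> ?d = 2 * r" "odd ?d \<Longrightarrow> ?d = 2 * r + 1"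
    using r by auto
  have h_last: "odd ?d" "h i = 2 * r" if "\<not> h i < 2 * r" for i
    using that hd[of i] d2r by (cases "even ?d"; auto)+
  define \<tau> where "\<tau> i = (if h i < r then e (h i + r) else if h i < 2 * r then e (h i - r) else i)" for i
  define \<alpha> where "\<alpha> i = (if h i < 2 * r then A else M)" for i
  define \<beta> where "\<beta> i = (if h i < r then B else if h i < 2 * r then - B else 0)" for i
  define v :: "int ^ 'd" where "v = (\<chi> i. if h i < r then int g ^ h i else if h i < 2 * r then 0 else V)"
  define m :: "'d \<Rightarrow> int ^ 'd" where "m i = axis i (\<alpha> i) + axis (\<tau> i) (\<beta> i)" for i
  have h\<tau>: "h (\<tau> i) = (if h i < r then h i + r else if h i < 2 * r then h i - r else h i)" for i
    using d2r(1) hd[of i] by (auto simp: \<tau>_def he)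
  have \<tau>\<tau>: "\<tau> (\<tau> i) = i" for i
  proof -
    have "h (\<tau> (\<tau> i)) = h i"
      by (auto simp: h\<tau>)
    then show ?thesis using eh by metis
  qed
  have \<alpha>\<tau>: "\<alpha> (\<tau> i) = \<alpha> i" and \<beta>\<tau>: "\<beta> (\<tau> i) = - \<beta> i" for i
    by (auto simp: \<alpha>_def \<beta>_def h\<tau>)
  have \<beta>0: "\<beta> i = 0" if "\<tau> i = i" for i
  proof -
    have "h (\<tau> i) = h i" using that by simp
    then have "\<not> h i < 2 * r" by (auto simp: h\<tau> split: if_splits)
    then show ?thesis by (simp add: \<beta>_def)
  qed
  have \<alpha>\<beta>: "(\<alpha> i)\<^sup>2 + (\<beta> i)\<^sup>2 = int D" for i
    using D M h_last[of i] by (auto simp: \<alpha>_def \<beta>_def)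
  have inner_m: "real_vec (m i) \<bullet> real_vec x = real_of_int (\<alpha> i * x $ i + \<beta> i * x $ \<tau> i)" for i x
  proof -
    have "real_vec (m i) = axis i (real_of_int (\<alpha> i)) + axis (\<tau> i) (real_of_int (\<beta> i))"
      by (simp add: m_def real_vec_def vec_eq_iff axis_def)
    then show ?thesis
      by (simp add: inner_add_left inner_axis' real_vec_def)
  qed
  have orth: "real_vec (m i) \<bullet> real_vec (m j) = (if i = j then real D else 0)" for i j
  proof (cases "i = j")
    case True
    have "\<alpha> i * m i $ i + \<beta> i * m i $ \<tau> i = (\<alpha> i)\<^sup>2 + (\<beta> i)\<^sup>2"
      using \<beta>0[of i] by (cases "\<tau> i = i") (auto simp: m_def axis_def power2_eq_square)
    then show ?thesis
      using True \<alpha>\<beta>[of i] by (simp add: inner_m)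
  next
    case False
    have "\<alpha> i * m j $ i + \<beta> i * m j $ \<tau> i = 0"
    proof (cases "j = \<tau> i")
      case True
      then show ?thesis using False by (simp add: m_def axis_def \<tau>\<tau> \<alpha>\<tau> \<beta>\<tau>)
    next
      case F: False
      then have "\<tau> j \<noteq> i" using \<tau>\<tau> by metis
      moreover have "\<tau> j \<noteq> \<tau> i" using False \<tau>\<tau> by metis
      ultimately show ?thesis using False F by (simp add: m_def axis_def)
    qed
    then show ?thesis using False by (simp add: inner_m)
  qed
  have w: "real_vec (m i) \<bullet> real_vec v = real_of_int
      (if h i < r then A * int g ^ h i else if h i < 2 * r then - B * int g ^ (h i - r) else M * V)" for i
    by (auto simp: inner_m v_def h\<tau> \<alpha>_def \<beta>_def)
  have vb: "(v $ i)\<^sup>2 \<le> int D" for i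
  proof -
    consider "h i < r" | "r \<le> h i" "h i < 2 * r" | "\<not> h i < 2 * r" by linarith
    then show ?thesis
    proof cases
      case 1
      have "(int g ^ h i)\<^sup>2 = int (g ^ (h i * 2))" by (simp add: power_mult)
      also have "g ^ (h i * 2) \<le> g ^ ?d"
        using 1 d2r(1) g by (intro power_increasing) auto
      also have "\<dots> \<le> D" by (rule bounds)
      finally show ?thesis using 1 by (simp add: v_def)
    next
      case 2
      then show ?thesis by (simp add: v_def)
    next
      case 3
      then show ?thesis using V h_last by (simp add: v_def)
    qed
  qed
  have "int D dvd a" if near: "\<And>i. \<exists>b::int. \<bar>real_of_int (2 * a) * (real_vec (m i) \<bullet> real_vec v) / real D - real_of_int b\<bar>
         < 1 / (8 * real g)" for a :: int
  proof (rule sep)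
    fix j assume j: "j < r"
    then have hj: "h (e j) = j" using d2r(1) by (intro he) simp
    show "\<exists>b::int. \<bar>real_of_int (2 * a) * real_of_int A / real D * real g ^ j - real_of_int b\<bar> < 1 / (8 * real g)"
      using near[of "e j"] j unfolding w hj by (simp add: mult_ac)
    have hj': "h (e (j + r)) = j + r" using j d2r(1) by (intro he) simp
    obtain b :: int where "\<bar>real_of_int (2 * a) * (real_vec (m (e (j + r))) \<bullet> real_vec v) / real D - real_of_int b\<bar>
         < 1 / (8 * real g)"
      using near by blast
    moreover have "real_of_int (2 * a) * (real_vec (m (e (j + r))) \<bullet> real_vec v) / real D
        = - (real_of_int (2 * a) * real_of_int B / real D * real g ^ j)"
      unfolding w hj' using j by simp
    ultimately have "\<bar>real_of_int (2 * a) * real_of_int B / real D * real g ^ j - real_of_int (- b)\<bar> < 1 / (8 * real g)"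
      using abs_minus_cancel[of "real_of_int (2 * a) * real_of_int B / real D * real g ^ j + real_of_int b"]
      by (simp only: of_int_minus minus_minus minus_add_distrib diff_conv_add_uminus)
    then show "\<exists>b::int. \<bar>real_of_int (2 * a) * real_of_int B / real D * real g ^ j - real_of_int b\<bar> < 1 / (8 * real g)"
      by blast
  next
    assume "odd ?d"
    then have "h (e (2 * r)) = 2 * r" using d2r by (intro he) simp
    then show "\<exists>b::int. \<bar>real_of_int (2 * a) * real_of_int (M * V) / real D - real_of_int b\<bar> < 1 / (8 * real g)"
      using near[of "e (2 * r)"] unfolding w by simp
  qed
  then have "design g D m v"
    using orth bounds vb by (simp add: design_def)
  then show ?thesis by blast
qed

theorem ex_design:
  assumes d: "CARD('d::finite) \<ge> 2"
  shows "\<exists>g D (m :: 'd \<Rightarrow> int ^ 'd) v. g \<ge> G \<and> g \<ge> 2 \<and> design g D m v"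
proof (cases "even CARD('d)")
  case True
  define r where "r = CARD('d) div 2"
  have dr: "CARD('d) = 2 * r" and r: "r \<ge> 1" using True d by (auto simp: r_def)
  define g where "g = 2 * (G + 1)"
  have g: "even g" "g \<ge> 2" "g \<ge> G" by (auto simp: g_def)
  have "\<exists>(m :: 'd \<Rightarrow> int ^ 'd) v. design g (g ^ (2 * r) + 1) m v"
  proof (rule design_from_params[where r = r and A = "int g ^ r" and B = 1])
    show "r = CARD('d) div 2" by (rule r_def)
    show "int (g ^ (2 * r) + 1) = (int g ^ r)\<^sup>2 + 1\<^sup>2"
      by (simp add: power_mult mult.commute[of 2])
    show "g \<ge> 1" using g by simp
    have "1 \<le> g ^ (2 * r)" using g by simp
    then show "g ^ CARD('d) \<le> g ^ (2 * r) + 1" "g ^ (2 * r) + 1 \<le> 4 * g ^ CARD('d)"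
      by (auto simp: dr)
  qed (use even_separation[OF g(1,2) r] True in auto)
  then show ?thesis using g by blast
next
  case False
  define r where "r = CARD('d) div 2"
  have dr: "CARD('d) = 2 * r + 1" and r: "r \<ge> 1" using False d by (auto simp: r_def)
  define k where "k = G + 2"
  have k: "k \<ge> 2" by (simp add: k_def)
  define g where "g = k ^ 4"
  have "k ^ 1 \<le> g" unfolding g_def using k by (intro power_increasing) auto
  then have g: "g \<ge> G" "g \<ge> 2" using k by (auto simp: k_def)
  define u where "u = int k ^ (2 * r - 1)"
  define P where "P = u + 1"
  define Q where "Q = u * (int k)\<^sup>2"
  define M where "M = P\<^sup>2 + Q\<^sup>2"
  define D where "D = nat (M\<^sup>2)"
  have D: "int D = M\<^sup>2" by (simp add: D_def)
  have u1: "u \<ge> 1" using k by (simp add: u_def)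
  have "2 * r + 1 = (2 * r - 1) + 2" using r by simp
  then have Qk: "Q = int k ^ (2 * r + 1)"
    by (simp only: Q_def u_def power_add)
  have PQ: "P \<le> Q"
  proof -
    have k2: "(int k)\<^sup>2 \<ge> 4" using k power_mono[of 2 "int k" 2] by simp
    have "u * 2 \<le> u * (int k)\<^sup>2" using u1 k2 by (intro mult_left_mono) auto
    then show ?thesis using u1 unfolding P_def Q_def by linarith
  qed
  have P0: "0 < P" using u1 by (simp add: P_def)
  have "P\<^sup>2 \<le> Q\<^sup>2" using PQ P0 by (intro power_mono) auto
  then have MQ: "Q\<^sup>2 \<le> M" "M \<le> 2 * Q\<^sup>2" by (auto simp: M_def)
  have gd: "int (g ^ CARD('d)) = (Q\<^sup>2)\<^sup>2"
    by (simp add: g_def Qk dr power_mult[symmetric] algebra_simps)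
  have up: "u * P \<le> M"
  proof -
    have "u * P \<le> P * P" using P0 by (intro mult_right_mono) (auto simp: P_def)
    moreover have "P * P \<le> P * P + Q * Q" by simp
    ultimately show ?thesis unfolding M_def power2_eq_square by linarith
  qed
  have "\<exists>(m :: 'd \<Rightarrow> int ^ 'd) v. design g D m v"
  proof (rule design_from_params[where r = r and A = "P\<^sup>2 - Q\<^sup>2" and B = "2 * P * Q" and M = M and V = "u * P"])
    show "r = CARD('d) div 2" by (rule r_def)
    show "int D = (P\<^sup>2 - Q\<^sup>2)\<^sup>2 + (2 * P * Q)\<^sup>2"
      unfolding D M_def by (simp add: power2_eq_square algebra_simps)
    show "M\<^sup>2 = int D" by (simp add: D)
    show "(u * P)\<^sup>2 \<le> int D"
      unfolding D using up u1 P0 by (intro power_mono) auto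
    show "g \<ge> 1" using g by simp
    have "int (g ^ CARD('d)) \<le> int D"
      unfolding gd D using MQ by (intro power_mono) auto
    then show "g ^ CARD('d) \<le> D" by (simp only: of_nat_le_iff)
    have "int D \<le> (2 * Q\<^sup>2)\<^sup>2"
      unfolding D using MQ by (intro power_mono) (auto simp: M_def)
    also have "\<dots> = int (4 * g ^ CARD('d))"
      using gd by (simp add: power_mult_distrib)
    finally show "D \<le> 4 * g ^ CARD('d)" by (simp only: of_nat_le_iff)
  next
    fix a :: int
    assume "\<And>j. j < r \<Longrightarrow> \<exists>b::int. \<bar>real_of_int (2 * a) * real_of_int (P\<^sup>2 - Q\<^sup>2) / real D * real g ^ j - real_of_int b\<bar> < 1 / (8 * real g)"
      "\<And>j. j < r \<Longrightarrow> \<exists>b::int. \<bar>real_of_int (2 * a) * real_of_int (2 * P * Q) / real D * real g ^ j - real_of_int b\<bar> < 1 / (8 * real g)"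
      "odd CARD('d) \<Longrightarrow> \<exists>b::int. \<bar>real_of_int (2 * a) * real_of_int (M * (u * P)) / real D - real_of_int b\<bar> < 1 / (8 * real g)"
    then show "int D dvd a"
      using False D k r by (intro odd_separation[where k = k and r = r and g = g and a = a])
        (auto simp only: u_def P_def Q_def M_def g_def)
  qed
  then show ?thesis using g by blast
qed

section \<open>Focusing of the evolution at many times\<close>

text \<open>
  The points at which the evolution of \<open>\<Sum>\<^sub>n\<^sub>\<in>\<^sub>S exp (\<i> n \<bullet> x)\<close> reaches half of its largest conceivable modulus
  \<open>card S\<close> at some time in \<open>T\<close>.
\<close>
definition focus_set :: "(int ^ 'd::finite) set \<Rightarrow> real set \<Rightarrow> (real ^ 'd) set" where
  "focus_set S T = {x\<in>torus_box. \<exists>t\<in>T. real (card S) / 2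
      \<le> cmod (\<Sum>n\<in>S. cis (real_vec n \<bullet> x - t * (norm (real_vec n))\<^sup>2))}"

text \<open>
  The lower bound for the measure of the focusing sets. It matters only that it is positive and depends
  on nothing but \<open>d\<close>.
\<close>
definition focus_const :: "nat \<Rightarrow> real" where
  "focus_const d = (1 / (4 * pi * real d)) ^ d / 16"

lemma focus_const_pos: "d > 0 \<Longrightarrow> focus_const d > 0"
  by (simp add: focus_const_def)

text \<open>
  The frequency \<open>p (v + \<Sum>\<^sub>i k\<^sub>i m\<^sub>i)\<close>, and the range of the index \<open>k\<close>. Starting at \<open>k\<^sub>i = 1\<close> is immaterial.
\<close>
definition lattice_freq :: "nat \<Rightarrow> ('d::finite \<Rightarrow> int ^ 'd) \<Rightarrow> int ^ 'd \<Rightarrow> ('d \<Rightarrow> int) \<Rightarrow> int ^ 'd" where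
  "lattice_freq p m v k = (\<chi> l. int p * (v $ l + (\<Sum>i\<in>UNIV. k i * m i $ l)))"

definition cube_index :: "nat \<Rightarrow> ('d::finite \<Rightarrow> int) set" where
  "cube_index g = {k. \<forall>i. 1 \<le> k i \<and> k i \<le> int g}"

lemma card_cube_index: "finite (cube_index g :: ('d::finite \<Rightarrow> int) set)"
  "card (cube_index g :: ('d::finite \<Rightarrow> int) set) = g ^ CARD('d)"
proof -
  have eq: "(cube_index g :: ('d \<Rightarrow> int) set) = PiE UNIV (\<lambda>_. {1..int g})"
    by (auto simp: cube_index_def PiE_def extensional_def)
  show "finite (cube_index g :: ('d \<Rightarrow> int) set)"
    unfolding eq by (rule finite_PiE) auto
  show "card (cube_index g :: ('d \<Rightarrow> int) set) = g ^ CARD('d)"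
    unfolding eq by (subst card_PiE) auto
qed

lemma real_vec_lattice_freq:
  "real_vec (lattice_freq p m v k)
    = real p *\<^sub>R (real_vec v + (\<Sum>i\<in>UNIV. real_of_int (k i) *\<^sub>R real_vec (m i)))"
  by (simp add: vec_eq_iff real_vec_def lattice_freq_def)

lemma cos_ge_half:
  fixes x :: real
  assumes "\<bar>x\<bar> \<le> 1 / 2"
  shows "1 / 2 \<le> cos x"
proof -
  have "cos (pi / 3) \<le> cos \<bar>x\<bar>"
    using assms pi_gt3 by (intro cos_monotone_0_pi_le) auto
  then show ?thesis by (simp add: cos_60)
qed

context
  fixes g D :: nat and m :: "'d::finite \<Rightarrow> int ^ 'd" and v :: "int ^ 'd" and p :: nat
  assumes des: "design g D m v" and d2: "CARD('d) \<ge> 2" and g4: "g \<ge> 4" and p1: "p \<ge> 1"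
begin

lemma design_D_bounds: "D \<ge> 16" "real D \<le> 4 * real g ^ CARD('d)" "real g ^ CARD('d) \<le> real D"
proof -
  have "4 ^ 2 \<le> g ^ 2" using g4 by (intro power_mono) auto
  also have "\<dots> \<le> g ^ CARD('d)" using g4 d2 by (intro power_increasing) auto
  also have "\<dots> \<le> D" using des by (simp add: design_def)
  finally show "D \<ge> 16" by simp
  have "real D \<le> real (4 * g ^ CARD('d))" using des unfolding design_def by (subst of_nat_le_iff) auto
  then show "real D \<le> 4 * real g ^ CARD('d)" by simp
  have "real (g ^ CARD('d)) \<le> real D" using des unfolding design_def by (subst of_nat_le_iff) auto
  then show "real g ^ CARD('d) \<le> real D" by simp
qed

lemma design_orth: "real_vec (m i) \<bullet> real_vec (m j) = (if i = j then real D else 0)"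
  using des by (simp add: design_def)

lemma inner_lattice_freq:
  "real_vec (m i) \<bullet> real_vec (lattice_freq p m v k)
    = real p * (real_vec (m i) \<bullet> real_vec v + real D * real_of_int (k i))"
  by (simp add: real_vec_lattice_freq inner_add_right inner_sum_right design_orth if_distrib[of "\<lambda>t. _ * t"]
      mult.commute cong: if_cong)

lemma norm_sum_orth:
  "(norm (real_vec v + (\<Sum>i\<in>UNIV. c i *\<^sub>R real_vec (m i))))\<^sup>2
    = (norm (real_vec v))\<^sup>2 + 2 * (\<Sum>i\<in>UNIV. c i * (real_vec (m i) \<bullet> real_vec v)) + real D * (\<Sum>i\<in>UNIV. (c i)\<^sup>2)"
proof -
  have "(\<Sum>i\<in>UNIV. c i *\<^sub>R real_vec (m i)) \<bullet> (\<Sum>i\<in>UNIV. c i *\<^sub>R real_vec (m i)) = real D * (\<Sum>i\<in>UNIV. (c i)\<^sup>2)"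
    by (simp add: inner_sum_left inner_sum_right design_orth if_distrib[of "\<lambda>t. _ * t"] sum_distrib_left
        power2_eq_square mult_ac cong: if_cong)
  moreover have "(\<Sum>i\<in>UNIV. c i *\<^sub>R real_vec (m i)) \<bullet> real_vec v = (\<Sum>i\<in>UNIV. c i * (real_vec (m i) \<bullet> real_vec v))"
    by (simp add: inner_sum_left)
  moreover have "(norm (y + z))\<^sup>2 = (norm y)\<^sup>2 + 2 * (z \<bullet> y) + z \<bullet> z" for y z :: "real ^ 'd"
    by (simp add: power2_norm_eq_inner inner_add_left inner_add_right inner_commute)
  ultimately show ?thesis by simp
qed

lemma inj_lattice_freq: "inj_on (lattice_freq p m v) A"
proof (rule inj_onI)
  fix k k' assume eq: "lattice_freq p m v k = lattice_freq p m v k'"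
  have "k i = k' i" for i
  proof -
    have "real p * (real_vec (m i) \<bullet> real_vec v + real D * real_of_int (k i))
        = real p * (real_vec (m i) \<bullet> real_vec v + real D * real_of_int (k' i))"
      by (simp only: inner_lattice_freq[symmetric] eq)
    then show ?thesis using p1 design_D_bounds(1) by simp
  qed
  then show "k = k'" by blast
qed

text \<open>
  The frequency is \<open>p\<close> times an integer vector, which is nonzero: otherwise all \<open>2 (m\<^sub>i \<bullet> v) / D\<close>
  would be integers, against the separation for \<open>a = 1\<close>.
\<close>
lemma infnorm_lattice_freq: "real p \<le> infnorm (real_vec (lattice_freq p m v k))"
proof -
  have "lattice_freq p m v k \<noteq> 0"
  proof
    assume "lattice_freq p m v k = 0"
    then have z: "real_vec (m i) \<bullet> real_vec v = - real D * real_of_int (k i)" for i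
      using inner_lattice_freq[of i k] p1 by (simp add: eq_neg_iff_add_eq_0)
    have "\<bar>real_of_int (2 * 1) * (real_vec (m i) \<bullet> real_vec v) / real D - real_of_int (- 2 * k i)\<bar> < 1 / (8 * real g)" for i
      unfolding z using design_D_bounds(1) g4 by simp
    then have "int D dvd 1"
      using des unfolding design_def by blast
    then show False using design_D_bounds(1) by simp
  qed
  then obtain l where l: "lattice_freq p m v k $ l \<noteq> 0"
    by (auto simp: vec_eq_iff)
  then have "int p \<le> \<bar>lattice_freq p m v k $ l\<bar>"
  proof -
    define q where "q = v $ l + (\<Sum>i\<in>UNIV. k i * m i $ l)"
    have "lattice_freq p m v k $ l = int p * q"
      by (simp add: lattice_freq_def q_def)
    moreover from this l have "\<bar>q\<bar> \<ge> 1" by auto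
    ultimately show ?thesis
      using mult_left_mono[of 1 "\<bar>q\<bar>" "int p"] by (simp add: abs_mult)
  qed
  then have "real p \<le> \<bar>real_vec (lattice_freq p m v k) $ l\<bar>"
    unfolding real_vec_def by simp
  also have "\<dots> \<le> infnorm (real_vec (lattice_freq p m v k))"
    by (rule component_le_infnorm_cart)
  finally show ?thesis .
qed

lemma norm_lattice_freq:
  assumes k: "k \<in> cube_index g"
  shows "1 + (norm (real_vec (lattice_freq p m v k)))\<^sup>2
    \<le> 17 * (real p)\<^sup>2 * real CARD('d) * real g ^ (CARD('d) + 2)"
proof -
  let ?d = "real CARD('d)"
  let ?s = "\<Sum>i\<in>UNIV. real_of_int (k i) *\<^sub>R real_vec (m i)"
  have v: "(norm (real_vec v))\<^sup>2 \<le> ?d * real D"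
  proof -
    have "(norm (real_vec v))\<^sup>2 = (\<Sum>i\<in>UNIV. (real_of_int (v $ i))\<^sup>2)"
      unfolding power2_norm_eq_inner by (simp add: inner_vec_def real_vec_def power2_eq_square)
    also have "\<dots> \<le> (\<Sum>i\<in>(UNIV::'d set). real D)"
    proof (rule sum_mono)
      fix i
      have "real_of_int ((v $ i)\<^sup>2) \<le> real_of_int (int D)"
        using des unfolding design_def by (subst of_int_le_iff) blast
      then show "(real_of_int (v $ i))\<^sup>2 \<le> real D" by simp
    qed
    finally show ?thesis by simp
  qed
  have s: "(norm ?s)\<^sup>2 \<le> ?d * real D * (real g)\<^sup>2"
  proof -
    have "(norm ?s)\<^sup>2 = real D * (\<Sum>i\<in>UNIV. (real_of_int (k i))\<^sup>2)"
      unfolding power2_norm_eq_inner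
      by (simp add: inner_sum_left inner_sum_right design_orth if_distrib[of "\<lambda>t. _ * t"] sum_distrib_left power2_eq_square mult_ac cong: if_cong)
    also have "\<dots> \<le> real D * (\<Sum>i\<in>(UNIV::'d set). (real g)\<^sup>2)"
    proof (intro mult_left_mono sum_mono power_mono)
      fix i
      have "1 \<le> k i" "k i \<le> int g" using k by (auto simp: cube_index_def)
      then show "real_of_int (k i) \<le> real g" "0 \<le> real_of_int (k i)" by linarith+
    qed auto
    finally show ?thesis by (simp add: mult_ac)
  qed
  have tri: "(norm (real_vec v + ?s))\<^sup>2 \<le> 2 * (norm (real_vec v))\<^sup>2 + 2 * (norm ?s)\<^sup>2"
  proof -
    have "(norm (real_vec v + ?s))\<^sup>2 \<le> (norm (real_vec v) + norm ?s)\<^sup>2"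
      by (intro power_mono norm_triangle_ineq) auto
    also have "\<dots> \<le> 2 * (norm (real_vec v))\<^sup>2 + 2 * (norm ?s)\<^sup>2"
      using zero_le_power2[of "norm (real_vec v) - norm ?s"]
      by (simp add: power2_eq_square algebra_simps)
    finally show ?thesis .
  qed
  have g2: "1 \<le> (real g)\<^sup>2" using g4 by simp
  have "?d * real D \<le> ?d * real D * (real g)\<^sup>2"
    using g2 mult_left_mono[OF g2, of "?d * real D"] by simp
  then have "(norm (real_vec v + ?s))\<^sup>2 \<le> 4 * (?d * real D * (real g)\<^sup>2)"
    using v s tri by linarith
  also have "\<dots> \<le> 4 * (?d * (4 * real g ^ CARD('d)) * (real g)\<^sup>2)"
    using design_D_bounds(2) by (intro mult_left_mono mult_right_mono) auto
  finally have 1: "(norm (real_vec v + ?s))\<^sup>2 \<le> 16 * ?d * real g ^ (CARD('d) + 2)"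
    by (simp add: power_add power2_eq_square mult_ac)
  have "(norm (real_vec (lattice_freq p m v k)))\<^sup>2 = (real p)\<^sup>2 * (norm (real_vec v + ?s))\<^sup>2"
    by (simp add: real_vec_lattice_freq power_mult_distrib)
  also have "\<dots> \<le> (real p)\<^sup>2 * (16 * ?d * real g ^ (CARD('d) + 2))"
    using 1 by (intro mult_left_mono) auto
  finally have 2: "(norm (real_vec (lattice_freq p m v k)))\<^sup>2 \<le> 16 * ((real p)\<^sup>2 * ?d * real g ^ (CARD('d) + 2))"
    by (simp add: mult_ac)
  have "1 \<le> real g ^ (CARD('d) + 2)"
    using g4 by (intro one_le_power) simp
  moreover have "1 \<le> (real p)\<^sup>2" "1 \<le> ?d"
    using p1 d2 by auto
  ultimately have "1 * 1 * 1 \<le> (real p)\<^sup>2 * ?d * real g ^ (CARD('d) + 2)"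
    by (intro mult_mono) simp_all
  then show ?thesis using 2 by simp
qed

text \<open>
  After division by a phase that does not depend on \<open>k\<close>, every term has real part at least \<open>1/2\<close>. The
  integer \<open>N\<close> in the proof collects the multiples of \<open>2 \<pi>\<close>.
\<close>
lemma lattice_phase:
  fixes x :: "real ^ 'd" and a :: nat and t :: real
  defines "t \<equiv> 2 * pi * real a / ((real p)\<^sup>2 * real D)"
  assumes k: "k \<in> cube_index g"
    and near: "\<And>i. \<bar>real p * (real_vec (m i) \<bullet> x) - 4 * pi * real a * (real_vec (m i) \<bullet> real_vec v) / real D
        - 2 * pi * real_of_int (b i)\<bar> \<le> 1 / (2 * real CARD('d) * real g)"
  shows "1 / 2 \<le> Re (cis (- (real p * (real_vec v \<bullet> x) - 2 * pi * real a * (norm (real_vec v))\<^sup>2 / real D)) *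
     cis (real_vec (lattice_freq p m v k) \<bullet> x - t * (norm (real_vec (lattice_freq p m v k)))\<^sup>2))"
proof -
  let ?w = "\<lambda>i. real_vec (m i) \<bullet> real_vec v"
  define \<phi> where "\<phi> i = real p * (real_vec (m i) \<bullet> x) - 4 * pi * real a * ?w i / real D - 2 * pi * real_of_int (b i)" for i
  define N where "N = (\<Sum>i\<in>UNIV. k i * b i) - int a * (\<Sum>i\<in>UNIV. (k i)\<^sup>2)"
  define \<theta>0 where "\<theta>0 = real p * (real_vec v \<bullet> x) - 2 * pi * real a * (norm (real_vec v))\<^sup>2 / real D"
  have D0: "real D > 0" and p0: "real p > 0" using design_D_bounds(1) p1 by auto
  have x: "real_vec (lattice_freq p m v k) \<bullet> x
      = real p * (real_vec v \<bullet> x) + (\<Sum>i\<in>UNIV. real_of_int (k i) * (real p * (real_vec (m i) \<bullet> x)))"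
    by (simp add: real_vec_lattice_freq inner_add_left inner_sum_left distrib_left sum_distrib_left mult_ac)
  have "t * (norm (real_vec (lattice_freq p m v k)))\<^sup>2
      = (2 * pi * real a / real D) * ((norm (real_vec v))\<^sup>2 + 2 * (\<Sum>i\<in>UNIV. real_of_int (k i) * ?w i)
         + real D * (\<Sum>i\<in>UNIV. (real_of_int (k i))\<^sup>2))"
    unfolding norm_sum_orth[symmetric] using p0
    by (simp add: t_def real_vec_lattice_freq power_mult_distrib)
  also have "\<dots> = 2 * pi * real a * (norm (real_vec v))\<^sup>2 / real D
      + (\<Sum>i\<in>UNIV. real_of_int (k i) * (4 * pi * real a * ?w i / real D))
      + 2 * pi * real a * (\<Sum>i\<in>UNIV. (real_of_int (k i))\<^sup>2)"
    using D0 by (simp add: distrib_left sum_distrib_left mult_ac)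
  finally have ph: "real_vec (lattice_freq p m v k) \<bullet> x - t * (norm (real_vec (lattice_freq p m v k)))\<^sup>2
      = \<theta>0 + (\<Sum>i\<in>UNIV. real_of_int (k i) * (real p * (real_vec (m i) \<bullet> x) - 4 * pi * real a * ?w i / real D))
        - 2 * pi * real a * (\<Sum>i\<in>UNIV. (real_of_int (k i))\<^sup>2)"
    unfolding x \<theta>0_def by (simp add: sum_subtractf right_diff_distrib)
  also have "\<dots> = \<theta>0 + (\<Sum>i\<in>UNIV. real_of_int (k i) * \<phi> i) + 2 * pi * real_of_int N"
    by (simp add: \<phi>_def N_def sum_subtractf right_diff_distrib sum_distrib_left mult_ac)
  finally have "cis (- \<theta>0) * cis (real_vec (lattice_freq p m v k) \<bullet> x - t * (norm (real_vec (lattice_freq p m v k)))\<^sup>2)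
      = cis (\<Sum>i\<in>UNIV. real_of_int (k i) * \<phi> i)"
    by (simp add: cis_mult[symmetric] cis_multiple_2pi) (simp add: cis_mult)
  moreover have "\<bar>\<Sum>i\<in>UNIV. real_of_int (k i) * \<phi> i\<bar> \<le> 1 / 2"
  proof -
    have "\<bar>\<Sum>i\<in>UNIV. real_of_int (k i) * \<phi> i\<bar> \<le> (\<Sum>i\<in>(UNIV::'d set). real g * (1 / (2 * real CARD('d) * real g)))"
    proof (rule order_trans[OF sum_abs], rule sum_mono)
      fix i :: 'd
      have "1 \<le> k i" "k i \<le> int g" using k by (auto simp: cube_index_def)
      then have "\<bar>real_of_int (k i)\<bar> \<le> real g" by linarith
      then show "\<bar>real_of_int (k i) * \<phi> i\<bar> \<le> real g * (1 / (2 * real CARD('d) * real g))"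
        unfolding abs_mult using near[of i] by (intro mult_mono) (auto simp: \<phi>_def)
    qed
    also have "\<dots> = 1 / 2" using g4 by simp
    finally show ?thesis .
  qed
  ultimately show ?thesis
    using cos_ge_half unfolding \<theta>0_def by simp
qed


lemma large_set_design:
  defines "S \<equiv> lattice_freq p m v ` cube_index g"
  defines "T \<equiv> (\<lambda>a. 2 * pi * real a / ((real p)\<^sup>2 * real D)) ` {1..D div 8}"
  defines "X \<equiv> focus_set S T"
  shows "finite S" "card S = g ^ CARD('d)" "finite T" "T \<subseteq> {0<..<1 / real p}"
    "X \<in> sets torus" "focus_const CARD('d) \<le> measure torus X"
proof -
  let ?d = "CARD('d)"
  let ?\<rho> = "1 / (2 * real ?d * real g)"
  let ?w = "\<lambda>i. real_vec (m i) \<bullet> real_vec v"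
  have D0: "real D > 0" and p0: "real p > 0" and g0: "real g > 0" using design_D_bounds(1) p1 g4 by auto
  show S: "finite S" "card S = g ^ ?d"
    using card_cube_index[where 'd='d] inj_lattice_freq by (auto simp: S_def card_image)
  show fT: "finite T" by (simp add: T_def)
  \<comment> \<open>The bound \<open>a \<le> D div 8\<close> makes \<open>2 \<pi> a < D\<close>.\<close>
  show "T \<subseteq> {0<..<1 / real p}"
  proof
    fix t assume "t \<in> T"
    then obtain a where a: "1 \<le> a" "a \<le> D div 8" and t: "t = 2 * pi * real a / ((real p)\<^sup>2 * real D)"
      by (auto simp: T_def)
    have "8 * a \<le> D" using a by linarith
    then have "8 * real a \<le> real D" by linarith
    then have "2 * pi * real a < real D"
      using pi_less_4 a mult_strict_right_mono[of pi 4 "real a"] by linarith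
    then have "t < 1 / (real p)\<^sup>2"
      using D0 p0 by (simp add: t field_simps)
    also have "\<dots> \<le> 1 / real p"
      using p1 by (simp add: power2_eq_square field_simps)
    finally have "t < 1 / real p" .
    moreover have "t > 0" using a D0 p0 by (simp add: t)
    ultimately show "t \<in> {0<..<1 / real p}" by simp
  qed
  define TT :: "real ^ 'd \<Rightarrow> real ^ 'd" where "TT x = (\<chi> i. real p * (real_vec (m i) \<bullet> x))" for x
  define z :: "nat \<Rightarrow> real ^ 'd" where "z a = (\<chi> i. 4 * pi * real a * ?w i / real D)" for a
  define A where "A a = {x\<in>torus_box. \<exists>b::int^'d. \<forall>i. \<bar>TT x $ i - z a $ i - 2 * pi * real_of_int (b $ i)\<bar> \<le> ?\<rho>}" for a
  \<comment> \<open>\<open>A a\<close> is the set of points at which the sum is coherent at the time with numerator \<open>a\<close>.\<close>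
  have TTlin: "linear TT"
    by (rule linearI) (simp_all add: TT_def vec_eq_iff inner_add_right distrib_left)
  have TTsurj: "surj TT"
  proof (rule surjI)
    fix y :: "real ^ 'd"
    show "TT (\<Sum>j\<in>UNIV. (y $ j / (real p * real D)) *\<^sub>R real_vec (m j)) = y"
      using D0 p0
      by (simp add: TT_def vec_eq_iff inner_sum_right design_orth if_distrib[of "\<lambda>t. _ * t"] cong: if_cong)
  qed
  have TTper: "\<exists>b::int^'d. TT (x + axis i (2 * pi)) = TT x + (2 * pi) *\<^sub>R real_vec b" for x i
    by (rule exI[of _ "\<chi> j. int p * m j $ i"])
      (simp add: TT_def vec_eq_iff inner_add_right inner_axis real_vec_def distrib_left)
  have "0 < ?\<rho>" using g0 by simp
  moreover have "?\<rho> \<le> 1"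
  proof -
    have "1 * 1 \<le> 2 * real ?d * real g" using g4 d2 by (intro mult_mono) auto
    then show ?thesis using le_imp_inverse_le[of 1 "2 * real ?d * real g"] by (simp add: inverse_eq_divide)
  qed
  then have "?\<rho> < 2 * pi" using pi_gt3 by linarith
  ultimately have \<rho>: "0 < ?\<rho>" "?\<rho> < 2 * pi" by auto
  have Asets: "A a \<in> sets torus" for a
    unfolding A_def by (rule measure_torus_pullback(1)[OF TTlin TTsurj TTper \<rho>])
  have Ameas: "measure torus (A a) \<ge> (?\<rho> / (2 * pi)) ^ ?d" for a
    unfolding A_def by (rule measure_torus_pullback(2)[OF TTlin TTsurj TTper \<rho>])
  have disj: "disjoint_family_on A {1..D div 8}"
    unfolding disjoint_family_on_def
  proof (intro ballI impI)
    fix a a' assume a: "a \<in> {1..D div 8}" "a' \<in> {1..D div 8}" "a \<noteq> a'"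
    show "A a \<inter> A a' = {}"
    proof (rule ccontr)
      assume "A a \<inter> A a' \<noteq> {}"
      then obtain x and b b' :: "int^'d" where
        b: "\<And>i. \<bar>TT x $ i - z a $ i - 2 * pi * real_of_int (b $ i)\<bar> \<le> ?\<rho>" and
        b': "\<And>i. \<bar>TT x $ i - z a' $ i - 2 * pi * real_of_int (b' $ i)\<bar> \<le> ?\<rho>"
        by (auto simp: A_def)
      have "\<exists>c::int. \<bar>real_of_int (2 * (int a - int a')) * ?w i / real D - real_of_int c\<bar> < 1 / (8 * real g)" for i
      proof -
        define y where "y = real_of_int (2 * (int a - int a')) * ?w i / real D - real_of_int (b' $ i - b $ i)"
        have "2 * pi * y = (z a $ i + 2 * pi * real_of_int (b $ i)) - (z a' $ i + 2 * pi * real_of_int (b' $ i))"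
          by (simp add: y_def z_def right_diff_distrib diff_divide_distrib left_diff_distrib)
        then have "\<bar>2 * pi * y\<bar> \<le> 2 * ?\<rho>"
          using b[of i] b'[of i] by linarith
        then have "pi * \<bar>y\<bar> \<le> ?\<rho>"
          by (simp add: abs_mult)
        moreover have "?\<rho> \<le> 1 / (4 * real g)"
          using d2 g0 by (simp add: field_simps)
        moreover have "3 * \<bar>y\<bar> \<le> pi * \<bar>y\<bar>"
          using pi_gt3 by (intro mult_right_mono) auto
        ultimately have "3 * \<bar>y\<bar> \<le> 1 / (4 * real g)" by linarith
        then have "\<bar>y\<bar> < 1 / (8 * real g)"
          using g0 by (simp add: field_simps)
        then show ?thesis unfolding y_def by blast
      qed
      then have dvd: "int D dvd int a - int a'"
        using des unfolding design_def by blast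
      have "\<bar>int a - int a'\<bar> < int D"
        using a design_D_bounds(1) by auto
      then show False
        using dvd a(3) zdvd_not_zless[of "\<bar>int a - int a'\<bar>" "int D"] by auto
    qed
  qed
  have sub: "(\<Union>a\<in>{1..D div 8}. A a) \<subseteq> X"
  proof
    fix x assume "x \<in> (\<Union>a\<in>{1..D div 8}. A a)"
    then obtain a where a: "a \<in> {1..D div 8}" and xA: "x \<in> A a" by blast
    from xA have x: "x \<in> torus_box" unfolding A_def by blast
    from xA obtain b :: "int^'d" where
      b: "\<And>i. \<bar>TT x $ i - z a $ i - 2 * pi * real_of_int (b $ i)\<bar> \<le> ?\<rho>"
      unfolding A_def by blast
    let ?t = "2 * pi * real a / ((real p)\<^sup>2 * real D)"
    let ?c = "cis (- (real p * (real_vec v \<bullet> x) - 2 * pi * real a * (norm (real_vec v))\<^sup>2 / real D))"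
    let ?e = "\<lambda>n. cis (real_vec n \<bullet> x - ?t * (norm (real_vec n))\<^sup>2)"
    have "real (card S) / 2 = (\<Sum>n\<in>S. 1 / 2)" by simp
    also have "\<dots> \<le> (\<Sum>n\<in>S. Re (?c * ?e n))"
    proof (rule sum_mono)
      fix n assume "n \<in> S"
      then obtain k where k: "k \<in> cube_index g" "n = lattice_freq p m v k" by (auto simp: S_def)
      show "1 / 2 \<le> Re (?c * ?e n)"
        unfolding k(2) using b by (intro lattice_phase[OF k(1), where b="\<lambda>i. b $ i"]) (simp add: TT_def z_def)
    qed
    also have "\<dots> = Re (?c * (\<Sum>n\<in>S. ?e n))"
      by (simp only: sum_distrib_left Re_sum)
    also have "\<dots> \<le> cmod (?c * (\<Sum>n\<in>S. ?e n))" by (rule complex_Re_le_cmod)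
    also have "\<dots> = cmod (\<Sum>n\<in>S. ?e n)" by (simp add: norm_mult)
    finally show "x \<in> X"
      using x a by (auto simp: X_def focus_set_def T_def)
  qed
  show Xsets: "X \<in> sets torus"
  proof -
    define F where "F t = {x. real (card S) / 2 \<le> cmod (\<Sum>n\<in>S. cis (real_vec n \<bullet> x - t * (norm (real_vec n))\<^sup>2))}" for t
    have "closed (F t)" for t
      unfolding F_def by (intro closed_Collect_le continuous_intros)
    then have "(\<Union>t\<in>T. F t) \<in> sets borel"
      using fT by (intro borel_closed closed_UN) auto
    moreover have "X = (\<Union>t\<in>T. F t) \<inter> torus_box"
      unfolding X_def focus_set_def F_def by blast
    ultimately show ?thesis
      by (simp only: borel_Int_box_sets_torus)
  qed
  have "focus_const ?d \<le> real (D div 8) * (?\<rho> / (2 * pi)) ^ ?d"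
  proof -
    have "D \<le> 16 * (D div 8)" using design_D_bounds(1) by presburger
    then have "real D \<le> 16 * real (D div 8)" by linarith
    then have "real g ^ ?d / 16 \<le> real (D div 8)" using design_D_bounds(3) by linarith
    then have "real g ^ ?d / 16 * (?\<rho> / (2 * pi)) ^ ?d \<le> real (D div 8) * (?\<rho> / (2 * pi)) ^ ?d"
      by (intro mult_right_mono) auto
    moreover have "real g ^ ?d * (?\<rho> / (2 * pi)) ^ ?d = (1 / (4 * pi * real ?d)) ^ ?d"
      using g0 by (simp add: power_mult_distrib[symmetric] mult_ac)
    ultimately show ?thesis by (simp add: focus_const_def)
  qed
  also have "\<dots> \<le> (\<Sum>a\<in>{1..D div 8}. measure torus (A a))"
    using sum_mono[of "{1..D div 8}" "\<lambda>_. (?\<rho> / (2 * pi)) ^ ?d" "\<lambda>a. measure torus (A a)"] Ameas by simp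
  also have "\<dots> = measure torus (\<Union>a\<in>{1..D div 8}. A a)"
    using Asets disj by (intro finite_measure.finite_measure_finite_Union[OF finite_measure_torus, symmetric]) auto
  also have "\<dots> \<le> measure torus X"
    using sub Xsets by (rule finite_measure.finite_measure_mono[OF finite_measure_torus])
  finally show "focus_const ?d \<le> measure torus X" .
qed

end

text \<open>
  Negative \<open>s\<close> is reduced to \<open>s = 0\<close> by monotonicity. The weights are then at most a constant times
  \<open>g powr ((d + 2) s)\<close>, which is \<open>o(g ^ d)\<close>.
\<close>
theorem ex_focusing_frequencies:
  fixes s \<epsilon> :: real and p :: nat
  assumes d2: "CARD('d::finite) \<ge> 2" and s: "s < real CARD('d) / (real CARD('d) + 2)"
    and p1: "p \<ge> 1" and \<epsilon>: "\<epsilon> > 0"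
  obtains S :: "(int ^ 'd) set" and T :: "real set" where
    "finite S" "S \<noteq> {}" "finite T" "T \<subseteq> {0<..<1 / real p}"
    "\<And>n. n \<in> S \<Longrightarrow> real p \<le> infnorm (real_vec n)"
    "\<And>n. n \<in> S \<Longrightarrow> (1 + (norm (real_vec n))\<^sup>2) powr s \<le> \<epsilon> * real (card S)"
    "1 / \<epsilon> \<le> real (card S)"
    "focus_set S T \<in> sets torus" "focus_const CARD('d) \<le> measure torus (focus_set S T)"
proof -
  let ?d = "CARD('d)"
  define \<sigma> where "\<sigma> = max s 0"
  have \<sigma>0: "\<sigma> \<ge> 0" "s \<le> \<sigma>" by (auto simp: \<sigma>_def)
  have "\<sigma> < real ?d / (real ?d + 2)" using s d2 by (simp add: \<sigma>_def)
  then have ex: "(real ?d + 2) * \<sigma> - real ?d < 0" by (simp add: field_simps)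
  define C where "C = (17 * (real p)\<^sup>2 * real ?d) powr \<sigma>"
  have "(\<lambda>g. C * real g powr ((real ?d + 2) * \<sigma> - real ?d)) \<longlonglongrightarrow> 0"
    by (intro tendsto_mult_right_zero tendsto_neg_powr[OF ex] filterlim_real_sequentially)
  then have "eventually (\<lambda>g. C * real g powr ((real ?d + 2) * \<sigma> - real ?d) < \<epsilon>) sequentially"
    using \<epsilon> by (rule order_tendstoD)
  then obtain G where G: "\<And>g. g \<ge> G \<Longrightarrow> C * real g powr ((real ?d + 2) * \<sigma> - real ?d) < \<epsilon>"
    by (auto simp: eventually_sequentially)
  define G' where "G' = max (max 4 G) (nat \<lceil>1 / \<epsilon>\<rceil>)"
  obtain g D :: nat and m :: "'d \<Rightarrow> int ^ 'd" and v where gG: "g \<ge> G'" and des: "design g D m v"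
    using ex_design[OF d2, of G'] by blast
  have g4: "g \<ge> 4" and gG1: "g \<ge> G" and ge: "real g \<ge> 1 / \<epsilon>"
    using gG by (auto simp: G'_def nat_le_iff ceiling_le_iff)
  note L = large_set_design[OF des d2 g4 p1]
  let ?S = "lattice_freq p m v ` cube_index g"
  let ?T = "(\<lambda>a. 2 * pi * real a / ((real p)\<^sup>2 * real D)) ` {1..D div 8}"
  have g0: "real g > 0" using g4 by simp
  show ?thesis
  proof (rule that[of ?S ?T])
    show "finite ?S" "finite ?T" by (rule L)+
    show "?T \<subseteq> {0<..<1 / real p}" by (rule L)
    have "card ?S \<noteq> 0" unfolding L(2) using g4 by simp
    then show "?S \<noteq> {}" by (metis card.empty)
    show "real p \<le> infnorm (real_vec n)" if n: "n \<in> ?S" for n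
    proof -
      obtain k where "n = lattice_freq p m v k" using n by (rule imageE)
      then show ?thesis by (simp only: infnorm_lattice_freq[OF des d2 g4 p1])
    qed
    have "real g ^ 1 \<le> real g ^ ?d" using g4 d2 by (intro power_increasing) auto
    then show "1 / \<epsilon> \<le> real (card ?S)" unfolding L(2) of_nat_power power_one_right using ge by linarith
    show "(1 + (norm (real_vec n))\<^sup>2) powr s \<le> \<epsilon> * real (card ?S)" if n: "n \<in> ?S" for n
    proof -
      have b: "1 + (norm (real_vec n))\<^sup>2 \<le> 17 * (real p)\<^sup>2 * real ?d * real g ^ (?d + 2)"
      proof -
        obtain k where "n = lattice_freq p m v k" "k \<in> cube_index g" using n by (rule imageE)
        then show ?thesis by (simp only: norm_lattice_freq[OF des d2 g4 p1])
      qed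
      have "(1 + (norm (real_vec n))\<^sup>2) powr s \<le> (1 + (norm (real_vec n))\<^sup>2) powr \<sigma>"
        using \<sigma>0 by (intro powr_mono) auto
      also have "\<dots> \<le> (17 * (real p)\<^sup>2 * real ?d * real g ^ (?d + 2)) powr \<sigma>"
        using \<sigma>0 b by (intro powr_mono2) auto
      also have "\<dots> = C * (real g powr (real ?d + 2)) powr \<sigma>"
      proof -
        have e: "real g ^ (?d + 2) = real g powr (real ?d + 2)"
          using powr_realpow[OF g0, of "?d + 2"] by (simp only: of_nat_add of_nat_numeral)
        show ?thesis unfolding e C_def by (rule powr_mult)
      qed
      also have "\<dots> = C * real g powr ((real ?d + 2) * \<sigma> - real ?d) * real g powr real ?d"
        by (simp add: powr_powr powr_add[symmetric] mult.assoc)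
      also have "\<dots> \<le> \<epsilon> * real g powr real ?d"
        using G[OF gG1] by (intro mult_right_mono) auto
      also have "\<dots> = \<epsilon> * real (card ?S)"
        unfolding L(2) using g0 by (simp add: powr_realpow)
      finally show ?thesis .
    qed
    show "focus_set ?S ?T \<in> sets torus" "focus_const ?d \<le> measure torus (focus_set ?S ?T)"
      by (rule L)+
  qed
qed

section \<open>Failure of the maximal inequality\<close>

lemma maximal_not_bounded:
  fixes s C :: real
  assumes d2: "CARD('d::finite) \<ge> 2" and s: "s < real CARD('d) / (real CARD('d) + 2)"
  shows "\<exists>f :: real ^ 'd \<Rightarrow> complex. trig_poly f \<and> \<not> weak_L2_norm (maximal_poly f) \<le> ennreal (C * sobolev_norm s f)"
proof -
  let ?\<kappa> = "focus_const CARD('d)"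
  have \<kappa>: "?\<kappa> > 0" by (rule focus_const_pos) simp
  define \<epsilon> where "\<epsilon> = ?\<kappa> / (16 * (C\<^sup>2 + 1))"
  have C1: "C\<^sup>2 + 1 > 0" by (simp add: add_nonneg_pos)
  have \<epsilon>: "\<epsilon> > 0" using \<kappa> C1 by (simp add: \<epsilon>_def)
  obtain S :: "(int ^ 'd) set" and T where S: "finite S" "S \<noteq> {}" and T: "T \<subseteq> {0<..<1 / real 1}"
    and pw: "\<And>n. n \<in> S \<Longrightarrow> (1 + (norm (real_vec n))\<^sup>2) powr s \<le> \<epsilon> * real (card S)"
    and X: "focus_set S T \<in> sets torus" "?\<kappa> \<le> measure torus (focus_set S T)"
    by (rule ex_focusing_frequencies[OF d2 s order_refl \<epsilon>]; rule that)
  define F where "F = real (card S)"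
  have F: "F > 0" using S by (simp add: F_def card_gt_0_iff)
  define f :: "real ^ 'd \<Rightarrow> complex" where "f = (\<lambda>x. \<Sum>n\<in>S. 1 * cis (real_vec n \<bullet> x))"
  have tp: "trig_poly f"
    unfolding trig_poly_def f_def by (rule exI[of _ S], rule exI[of _ "\<lambda>_. 1"]) (simp add: S)
  have fo: "fourier f n = (if n \<in> S then 1 else 0)" for n
    unfolding f_def by (rule fourier_trig[OF S(1)])
  have supp: "{n. fourier f n \<noteq> 0} = S" by (auto simp: fo)
  have ev: "evolution_poly t f x = (\<Sum>n\<in>S. cis (real_vec n \<bullet> x - t * (norm (real_vec n))\<^sup>2))" for t x
    unfolding evolution_poly_def supp by (rule sum.cong) (simp_all add: evolution_term_def fo)
  have sob: "sobolev_norm s f \<le> sqrt \<epsilon> * F"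
  proof -
    have "(\<Sum>\<^sub>\<infinity>n. sobolev_term s f n) = (\<Sum>\<^sub>\<infinity>n\<in>S. (1 + (norm (real_vec n))\<^sup>2) powr s)"
      by (rule infsum_cong_neutral) (auto simp: sobolev_term_def fo)
    also have "\<dots> = (\<Sum>n\<in>S. (1 + (norm (real_vec n))\<^sup>2) powr s)"
      using S by simp
    also have "\<dots> \<le> (\<Sum>n\<in>S. \<epsilon> * F)"
      unfolding F_def by (intro sum_mono pw)
    also have "\<dots> = \<epsilon> * F\<^sup>2" by (simp add: F_def power2_eq_square)
    finally have "sobolev_norm s f \<le> sqrt (\<epsilon> * F\<^sup>2)"
      unfolding sobolev_norm_def by (rule real_sqrt_le_mono)
    then show ?thesis using F by (simp add: real_sqrt_mult)
  qed
  have sob0: "0 \<le> sobolev_norm s f"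
    unfolding sobolev_norm_def by (intro real_sqrt_ge_zero infsum_nonneg) (simp add: sobolev_term_def)
  let ?Y = "{x\<in>torus_box. maximal_poly f x > ennreal (F / 4)}"
  have Y: "x \<in> ?Y \<longleftrightarrow> x \<in> torus_box \<and> (\<exists>t\<in>{0<..<1}. F / 4 < cmod (evolution_poly t f x))" for x
    using F by (auto simp: maximal_poly_def less_SUP_iff ennreal_less_iff)
  have Ysets: "?Y \<in> sets torus"
  proof -
    have "open (\<Union>t\<in>{0<..<1}. {x. F / 4 < cmod (evolution_poly t f x)})"
      unfolding ev by (intro open_UN ballI open_Collect_less continuous_intros)
    then have "(\<Union>t\<in>{0<..<1}. {x. F / 4 < cmod (evolution_poly t f x)}) \<inter> torus_box \<in> sets torus"
      by (intro borel_Int_box_sets_torus borel_open)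
    moreover have "(\<Union>t\<in>{0<..<1}. {x. F / 4 < cmod (evolution_poly t f x)}) \<inter> torus_box = ?Y"
      using Y by blast
    ultimately show ?thesis by simp
  qed
  have "focus_set S T \<subseteq> ?Y"
  proof
    fix x assume "x \<in> focus_set S T"
    then obtain t where "x \<in> torus_box" "t \<in> T" "F / 2 \<le> cmod (evolution_poly t f x)"
      unfolding focus_set_def ev F_def by blast
    then show "x \<in> ?Y"
      unfolding Y using T F by (intro conjI bexI[of _ t]) auto
  qed
  then have "?\<kappa> \<le> measure torus ?Y"
    using X(2) finite_measure.finite_measure_mono[OF finite_measure_torus _ Ysets, of "focus_set S T"] by linarith
  then have "F / 4 * sqrt ?\<kappa> \<le> F / 4 * sqrt (measure torus ?Y)"
    using F by (intro mult_left_mono real_sqrt_le_mono) auto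
  then have "ennreal (F / 4 * sqrt ?\<kappa>) \<le> ennreal (F / 4 * sqrt (measure torus ?Y))"
    by (rule ennreal_leI)
  also have "\<dots> \<le> weak_L2_norm (maximal_poly f)"
    unfolding weak_L2_norm_def using F by (intro SUP_upper) auto
  finally have low: "ennreal (F / 4 * sqrt ?\<kappa>) \<le> weak_L2_norm (maximal_poly f)" .
  have "C * sobolev_norm s f \<le> \<bar>C\<bar> * (sqrt \<epsilon> * F)"
    using sob sob0 by (intro order_trans[OF _ mult_left_mono[OF sob]] mult_right_mono) auto
  also have "\<dots> < F / 4 * sqrt ?\<kappa>"
  proof -
    have "C\<^sup>2 * (16 * \<epsilon>) < ?\<kappa>"
      using \<kappa> C1 by (simp add: \<epsilon>_def field_simps)
    then have "sqrt (C\<^sup>2 * (16 * \<epsilon>)) < sqrt ?\<kappa>" by (rule real_sqrt_less_mono)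
    then have "4 * (\<bar>C\<bar> * sqrt \<epsilon>) < sqrt ?\<kappa>"
      using real_sqrt_pow2[of 4] by (simp add: real_sqrt_mult)
    then have "F * (4 * (\<bar>C\<bar> * sqrt \<epsilon>)) < F * sqrt ?\<kappa>"
      using F by (rule mult_strict_left_mono)
    then show ?thesis by (simp add: mult_ac)
  qed
  finally have "C * sobolev_norm s f < F / 4 * sqrt ?\<kappa>" .
  then have "ennreal (C * sobolev_norm s f) < ennreal (F / 4 * sqrt ?\<kappa>)"
    using F \<kappa> by (intro ennreal_lessI) auto
  then have "\<not> weak_L2_norm (maximal_poly f) \<le> ennreal (C * sobolev_norm s f)"
    using low by (meson leD order_trans)
  then show ?thesis using tp by blast
qed

section \<open>Maximal truncations of exponential sums\<close>

lemma finite_infnorm_le: "finite {n :: int ^ 'd::finite. infnorm (real_vec n) \<le> r}"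
proof -
  have "{n :: int ^ 'd. infnorm (real_vec n) \<le> r} \<subseteq> (\<lambda>f. \<chi> i. f i) ` PiE UNIV (\<lambda>_. {- \<lceil>r\<rceil>..\<lceil>r\<rceil>})"
  proof
    fix n :: "int ^ 'd" assume n: "n \<in> {n. infnorm (real_vec n) \<le> r}"
    have "n $ i \<in> {- \<lceil>r\<rceil>..\<lceil>r\<rceil>}" for i
    proof -
      have "\<bar>real_of_int (n $ i)\<bar> \<le> r"
        using n component_le_infnorm_cart[of "real_vec n" i] by (simp add: real_vec_def)
      then show ?thesis by (simp add: le_ceiling_iff) linarith
    qed
    then have "(\<lambda>i. n $ i) \<in> PiE UNIV (\<lambda>_. {- \<lceil>r\<rceil>..\<lceil>r\<rceil>})" by (auto simp: PiE_def)
    then show "n \<in> (\<lambda>f. \<chi> i. f i) ` PiE UNIV (\<lambda>_. {- \<lceil>r\<rceil>..\<lceil>r\<rceil>})"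
      by (intro image_eqI[of _ _ "\<lambda>i. n $ i"]) auto
  qed
  then show ?thesis
    by (rule finite_subset) (intro finite_imageI finite_PiE; simp)
qed

text \<open>
  The cube truncation at \<open>|n|\<^sub>\<infinity> \<le> L\<close> of the evolution of an exponential sum, and a function that
  dominates the squares of all these truncations when \<open>1 \<le> |n|\<^sub>\<infinity> \<le> M\<close> on \<open>S\<close>.
\<close>
definition trunc_sum :: "(int ^ 'd::finite) set \<Rightarrow> nat \<Rightarrow> real \<Rightarrow> real ^ 'd \<Rightarrow> complex" where
  "trunc_sum S L t x = (\<Sum>n\<in>{n\<in>S. infnorm (real_vec n) \<le> real L}. cis (real_vec n \<bullet> x - t * (norm (real_vec n))\<^sup>2))"

definition trunc_majorant :: "(int ^ 'd::finite) set \<Rightarrow> nat \<Rightarrow> real \<Rightarrow> real ^ 'd \<Rightarrow> real" where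
  "trunc_majorant S M t x = (\<Sum>l<M. real (card {n\<in>S. real l < infnorm (real_vec n) \<and> infnorm (real_vec n) \<le> real (Suc l)})
      * (cmod (trunc_sum S (Suc l) t x) + cmod (trunc_sum S l t x)))"

lemma cmod_trunc_sum_le: "finite S \<Longrightarrow> cmod (trunc_sum S L t x) \<le> real (card S)"
proof -
  assume S: "finite S"
  have "cmod (trunc_sum S L t x) \<le> real (card {n\<in>S. infnorm (real_vec n) \<le> real L})"
    unfolding trunc_sum_def by (rule order_trans[OF norm_sum]) simp
  also have "\<dots> \<le> real (card S)"
    using S by (intro of_nat_mono card_mono) auto
  finally show ?thesis .
qed

lemma trunc_sum_full:
  assumes "\<And>n. n \<in> S \<Longrightarrow> infnorm (real_vec n) \<le> real L"
  shows "trunc_sum S L t x = (\<Sum>n\<in>S. cis (real_vec n \<bullet> x - t * (norm (real_vec n))\<^sup>2))"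
proof -
  have "{n\<in>S. infnorm (real_vec n) \<le> real L} = S" using assms by blast
  then show ?thesis by (simp add: trunc_sum_def)
qed

lemma continuous_trunc_sum: "continuous_on A (trunc_sum S L t)"
  unfolding trunc_sum_def by (intro continuous_intros)

lemma trunc_majorant_nonneg: "0 \<le> trunc_majorant S M t x"
  unfolding trunc_majorant_def by (intro sum_nonneg) auto

text \<open>
  The square of the modulus of a truncation is the sum of its increments over consecutive levels, and
  \<open>|z|\<^sup>2 - |w|\<^sup>2 \<le> |z - w| (|z| + |w|)\<close>, where \<open>|z - w|\<close> is at most the number of frequencies on a level.
\<close>
lemma trunc_sum_bound:
  assumes S: "finite S" and lo: "\<And>n. n \<in> S \<Longrightarrow> 1 \<le> infnorm (real_vec n)"
    and hi: "\<And>n. n \<in> S \<Longrightarrow> infnorm (real_vec n) \<le> real M"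
  shows "(cmod (trunc_sum S L t x))\<^sup>2 \<le> trunc_majorant S M t x"
proof -
  let ?s = "\<lambda>l. trunc_sum S l t x"
  let ?a = "\<lambda>l. real (card {n\<in>S. real l < infnorm (real_vec n) \<and> infnorm (real_vec n) \<le> real (Suc l)})"
  have s0: "?s 0 = 0"
  proof -
    have "{n\<in>S. infnorm (real_vec n) \<le> real 0} = {}" using lo by fastforce
    then show ?thesis unfolding trunc_sum_def by (simp only: sum.empty)
  qed
  have step: "(cmod (?s (Suc l)))\<^sup>2 \<le> (cmod (?s l))\<^sup>2 + ?a l * (cmod (?s (Suc l)) + cmod (?s l))" for l
  proof -
    define A where "A = {n\<in>S. infnorm (real_vec n) \<le> real l}"
    define B where "B = {n\<in>S. real l < infnorm (real_vec n) \<and> infnorm (real_vec n) \<le> real (Suc l)}"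
    let ?e = "\<lambda>n. cis (real_vec n \<bullet> x - t * (norm (real_vec n))\<^sup>2)"
    have AB: "{n\<in>S. infnorm (real_vec n) \<le> real (Suc l)} = A \<union> B"
      unfolding A_def B_def by auto
    have "?s (Suc l) = sum ?e (A \<union> B)"
      unfolding trunc_sum_def AB ..
    also have "\<dots> = sum ?e A + sum ?e B"
      by (rule sum.union_disjoint) (use S in \<open>auto simp: A_def B_def\<close>)
    also have "sum ?e A = ?s l"
      unfolding trunc_sum_def A_def ..
    finally have "cmod (?s (Suc l)) \<le> cmod (?s l) + cmod (sum ?e B)"
      by (simp only: norm_triangle_ineq)
    also have "\<dots> \<le> cmod (?s l) + ?a l"
      unfolding B_def by (intro add_left_mono order_trans[OF norm_sum]) simp
    finally have d: "cmod (?s (Suc l)) - cmod (?s l) \<le> ?a l"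
      by (simp only: diff_le_eq add.commute)
    have "(cmod (?s (Suc l)))\<^sup>2 - (cmod (?s l))\<^sup>2 = (cmod (?s (Suc l)) - cmod (?s l)) * (cmod (?s (Suc l)) + cmod (?s l))"
      by (simp add: power2_eq_square algebra_simps)
    also have "\<dots> \<le> ?a l * (cmod (?s (Suc l)) + cmod (?s l))"
      using d by (intro mult_right_mono) auto
    finally show ?thesis by linarith
  qed
  have part: "(cmod (?s L))\<^sup>2 \<le> trunc_majorant S L t x" for L
  proof (induction L)
    case 0
    then show ?case by (simp add: s0 trunc_majorant_def)
  next
    case (Suc L)
    then show ?case using step[of L] by (simp add: trunc_majorant_def)
  qed
  show ?thesis
  proof (cases "L \<le> M")
    case True
    have "trunc_majorant S L t x \<le> trunc_majorant S M t x"
      unfolding trunc_majorant_def using True by (intro sum_mono2) auto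
    then show ?thesis using part[of L] by linarith
  next
    case False
    have "?s L = ?s M"
      using False hi by (subst (1 2) trunc_sum_full) force+
    then show ?thesis using part[of M] by simp
  qed
qed

lemma integrable_torus_const: "integrable (torus :: (real ^ 'd::finite) measure) (\<lambda>_. c :: 'b::{banach, second_countable_topology})"
  by (rule finite_measure.integrable_const[OF finite_measure_torus])

lemma integrable_trunc:
  assumes S: "finite S"
  shows "integrable torus (\<lambda>x. cmod (trunc_sum S L t x))"
    and "integrable torus (\<lambda>x. (cmod (trunc_sum S L t x))\<^sup>2)"
    and "integrable torus (trunc_majorant S M t)"
proof -
  show 1: "integrable torus (\<lambda>x. cmod (trunc_sum S L t x))" for L
    using cmod_trunc_sum_le[OF S]
    by (intro integrable_torus_continuous[where B = "real (card S)"] continuous_intros continuous_trunc_sum) auto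
  have "(cmod (trunc_sum S L t x))\<^sup>2 \<le> (real (card S))\<^sup>2" for x
    using cmod_trunc_sum_le[OF S] by (intro power_mono) auto
  then show "integrable torus (\<lambda>x. (cmod (trunc_sum S L t x))\<^sup>2)"
    by (intro integrable_torus_continuous[where B = "(real (card S))\<^sup>2"] continuous_intros continuous_trunc_sum) auto
  show "integrable torus (trunc_majorant S M t)"
    unfolding trunc_majorant_def[abs_def] using 1 by auto
qed

lemma integral_cmod_trunc_sum_le:
  assumes S: "finite S"
  shows "(\<integral>x. cmod (trunc_sum S L t x) \<partial>torus) \<le> sqrt (real (card S))"
proof (cases "S = {}")
  case True
  then show ?thesis by (simp add: trunc_sum_def)
next
  case False
  define F where "F = real (card S)"
  have F: "F > 0" using S False by (simp add: F_def card_gt_0_iff)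
  let ?S = "{n\<in>S. infnorm (real_vec n) \<le> real L}"
  have eq: "trunc_sum S L t x = (\<Sum>n\<in>?S. cis (- t * (norm (real_vec n))\<^sup>2) * cis (real_vec n \<bullet> x))" for x
    by (simp add: trunc_sum_def cis_mult add.commute)
  have "(\<integral>x. (cmod (trunc_sum S L t x))\<^sup>2 \<partial>torus) = (\<Sum>n\<in>?S. (cmod (cis (- t * (norm (real_vec n))\<^sup>2)))\<^sup>2)"
    unfolding eq using S by (intro parseval_trig) simp
  also have "\<dots> = real (card ?S)" by simp
  also have "\<dots> \<le> F"
    unfolding F_def using S by (intro of_nat_mono card_mono) auto
  finally have sq: "(\<integral>x. (cmod (trunc_sum S L t x))\<^sup>2 \<partial>torus) \<le> F" .
  have "(\<integral>x. cmod (trunc_sum S L t x) \<partial>torus)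
      \<le> (\<integral>x. (1 / (2 * sqrt F)) * (cmod (trunc_sum S L t x))\<^sup>2 + sqrt F / 2 \<partial>torus)"
  proof (rule integral_mono)
    fix x
    let ?y = "cmod (trunc_sum S L t x)"
    \<comment> \<open>Integration of this inequality of the means replaces the Cauchy-Schwarz inequality.\<close>
    have "0 \<le> (?y - sqrt F)\<^sup>2" by simp
    then have "2 * ?y * sqrt F \<le> ?y\<^sup>2 + sqrt F * sqrt F" by (simp add: power2_eq_square algebra_simps)
    then show "?y \<le> (1 / (2 * sqrt F)) * ?y\<^sup>2 + sqrt F / 2"
      using F by (simp add: field_simps)
    show "integrable torus (\<lambda>x. cmod (trunc_sum S L t x))"
      by (rule integrable_trunc(1)[OF S])
    show "integrable torus (\<lambda>x. (1 / (2 * sqrt F)) * (cmod (trunc_sum S L t x))\<^sup>2 + sqrt F / 2)"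
      by (intro Bochner_Integration.integrable_add integrable_mult_right integrable_trunc(2)[OF S] integrable_torus_const)
  qed
  also have "\<dots> = (1 / (2 * sqrt F)) * (\<integral>x. (cmod (trunc_sum S L t x))\<^sup>2 \<partial>torus) + sqrt F / 2"
    using integrable_trunc(2)[OF S]
    by (subst Bochner_Integration.integral_add) (simp_all add: integrable_torus_const measure_torus_box)
  also have "\<dots> \<le> (1 / (2 * sqrt F)) * F + sqrt F / 2"
    using sq F by (intro add_right_mono mult_left_mono) auto
  also have "\<dots> = sqrt F"
    using F real_sqrt_mult_self[of F] by (simp add: field_simps)
  finally show ?thesis by (simp add: F_def)
qed

lemma integral_trunc_majorant_le:
  assumes S: "finite S"
  shows "(\<integral>x. trunc_majorant S M t x \<partial>torus) \<le> 2 * real (card S) * sqrt (real (card S))"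
proof -
  let ?A = "\<lambda>l. {n\<in>S. real l < infnorm (real_vec n) \<and> infnorm (real_vec n) \<le> real (Suc l)}"
  have "(\<integral>x. trunc_majorant S M t x \<partial>torus)
      = (\<Sum>l<M. real (card (?A l)) * ((\<integral>x. cmod (trunc_sum S (Suc l) t x) \<partial>torus) + (\<integral>x. cmod (trunc_sum S l t x) \<partial>torus)))"
    unfolding trunc_majorant_def using integrable_trunc(1)[OF S]
    by (subst Bochner_Integration.integral_sum) auto
  also have "\<dots> \<le> (\<Sum>l<M. real (card (?A l)) * (2 * sqrt (real (card S))))"
    using integral_cmod_trunc_sum_le[OF S, of _ t]
    by (intro sum_mono mult_left_mono) (simp_all only: mult_2 add_mono of_nat_0_le_iff)
  also have "\<dots> = real (\<Sum>l<M. card (?A l)) * (2 * sqrt (real (card S)))"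
    by (simp only: of_nat_sum sum_distrib_right)
  also have "(\<Sum>l<M. card (?A l)) = card (\<Union>l<M. ?A l)"
  proof (rule card_UN_disjoint[symmetric])
    have "l = l'" if "n \<in> ?A l" "n \<in> ?A l'" for n l l'
      using that by (cases l l' rule: linorder_cases) auto
    then show "\<forall>i\<in>{..<M}. \<forall>j\<in>{..<M}. i \<noteq> j \<longrightarrow> ?A i \<inter> ?A j = {}" by blast
  qed (use S in auto)
  also have "real (card (\<Union>l<M. ?A l)) * (2 * sqrt (real (card S))) \<le> real (card S) * (2 * sqrt (real (card S)))"
    using S by (intro mult_right_mono of_nat_mono card_mono) auto
  finally show ?thesis by (simp add: mult_ac)
qed

section \<open>Series of exponential sums with separated frequencies\<close>

lemma AE_summable_geometric:
  fixes f :: "nat \<Rightarrow> real ^ 'd::finite \<Rightarrow> real"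
  assumes int: "\<And>j. integrable torus (f j)" and nn: "\<And>j x. 0 \<le> f j x"
    and le: "\<And>j. (\<integral>x. f j x \<partial>torus) \<le> (1 / 2) ^ j"
  shows "AE x in torus. summable (\<lambda>j. f j x)"
    and "integrable torus (\<lambda>x. \<Sum>j. f j x)"
proof -
  have sum: "summable (\<lambda>j. \<integral>x. f j x \<partial>torus)"
    by (rule summable_comparison_test'[where g = "\<lambda>j. (1 / 2) ^ j" and N = 0])
      (use le nn in \<open>auto intro!: integral_nonneg_AE\<close>)
  have nonneg: "0 \<le> (\<integral>x. f j x \<partial>torus)" for j
    using nn by (intro integral_nonneg_AE) auto
  have m: "(\<lambda>x. ennreal (f j x)) \<in> borel_measurable torus" for j
    using int[of j] by (intro measurable_compose[OF _ measurable_ennreal]) (rule borel_measurable_integrable)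
  have "(\<integral>\<^sup>+x. (\<Sum>j. ennreal (f j x)) \<partial>torus) = (\<Sum>j. \<integral>\<^sup>+x. ennreal (f j x) \<partial>torus)"
    using m by (rule nn_integral_suminf)
  also have "\<dots> = (\<Sum>j. ennreal (\<integral>x. f j x \<partial>torus))"
    using int nn by (simp add: nn_integral_eq_integral)
  also have "\<dots> = ennreal (\<Sum>j. \<integral>x. f j x \<partial>torus)"
    using nonneg sum by (rule suminf_ennreal2)
  finally have "(\<integral>\<^sup>+x. (\<Sum>j. ennreal (f j x)) \<partial>torus) \<noteq> \<infinity>"
    by simp
  then have "AE x in torus. (\<Sum>j. ennreal (f j x)) \<noteq> \<infinity>"
    using m by (intro nn_integral_PInf_AE) auto
  then show ae: "AE x in torus. summable (\<lambda>j. f j x)"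
    by eventually_elim (use nn in \<open>auto intro!: summable_suminf_not_top\<close>)
  show "integrable torus (\<lambda>x. \<Sum>j. f j x)"
    using int ae nn sum by (intro integrable_suminf) auto
qed

text \<open>
  The weights \<open>4\<^sup>j\<close> turn square summability of the maximal bounds, which can be integrated termwise, into
  geometric decay.
\<close>
lemma weighted_square_bound:
  fixes R :: "nat \<Rightarrow> real"
  assumes "\<And>j. 0 \<le> R j" and "summable (\<lambda>j. 4 ^ j * (R j)\<^sup>2)"
  shows "R j \<le> sqrt (\<Sum>j. 4 ^ j * (R j)\<^sup>2) * (1 / 2) ^ j"
proof -
  have "4 ^ j * (R j)\<^sup>2 \<le> (\<Sum>j. 4 ^ j * (R j)\<^sup>2)"
    using assms sum_le_suminf[of "\<lambda>j. 4 ^ j * (R j)\<^sup>2" "{j}"] by simp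
  moreover have "4 ^ j * (R j)\<^sup>2 = (2 ^ j * R j)\<^sup>2"
    using power_mult_distrib[of "2 :: real" 2 j] by (simp add: power_mult_distrib power2_eq_square)
  ultimately have "2 ^ j * R j \<le> sqrt (\<Sum>j. 4 ^ j * (R j)\<^sup>2)"
    by (simp add: real_le_rsqrt)
  then show ?thesis by (simp add: field_simps)
qed

text \<open>
  The Fourier coefficients of the formal series \<open>\<Sum>\<^sub>j c\<^sub>j \<Sum>\<^sub>n\<^sub>\<in>\<^sub>S\<^sub>j exp (\<i> n \<bullet> x)\<close>. The sum over \<open>j\<close> is finite because
  \<open>S\<^sub>j\<close> will contain only frequencies with \<open>|n|\<^sub>\<infinity> \<ge> j + 1\<close>.
\<close>
definition series_coeff :: "(nat \<Rightarrow> (int ^ 'd::finite) set) \<Rightarrow> (nat \<Rightarrow> real) \<Rightarrow> int ^ 'd \<Rightarrow> real" where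
  "series_coeff S c n = (\<Sum>j<nat \<lceil>infnorm (real_vec n)\<rceil>. if n \<in> S j then c j else 0)"

text \<open>
  The cube truncations of the series at time \<open>t\<close>, their limit (arbitrary where it does not exist), the
  value at time \<open>t\<close> of one piece, and a bound for all truncations of that piece.
\<close>
definition series_partial ::
    "(nat \<Rightarrow> (int ^ 'd::finite) set) \<Rightarrow> (nat \<Rightarrow> real) \<Rightarrow> real \<Rightarrow> nat \<Rightarrow> real ^ 'd \<Rightarrow> complex" where
  "series_partial S c t L x = (\<Sum>n | infnorm (real_vec n) \<le> real L.
     complex_of_real (series_coeff S c n) * cis (real_vec n \<bullet> x - t * (norm (real_vec n))\<^sup>2))"

definition series_limit ::
    "(nat \<Rightarrow> (int ^ 'd::finite) set) \<Rightarrow> (nat \<Rightarrow> real) \<Rightarrow> real \<Rightarrow> real ^ 'd \<Rightarrow> complex" where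
  "series_limit S c t x = lim (\<lambda>L. series_partial S c t L x)"

definition piece_value ::
    "(nat \<Rightarrow> (int ^ 'd::finite) set) \<Rightarrow> (nat \<Rightarrow> real) \<Rightarrow> nat \<Rightarrow> real \<Rightarrow> real ^ 'd \<Rightarrow> complex" where
  "piece_value S c j t x = complex_of_real (c j) * (\<Sum>n\<in>S j. cis (real_vec n \<bullet> x - t * (norm (real_vec n))\<^sup>2))"

definition piece_bound ::
    "(nat \<Rightarrow> (int ^ 'd::finite) set) \<Rightarrow> (nat \<Rightarrow> real) \<Rightarrow> (nat \<Rightarrow> nat) \<Rightarrow> nat \<Rightarrow> real \<Rightarrow> real ^ 'd \<Rightarrow> real" where
  "piece_bound S c M j t x = c j * sqrt (trunc_majorant (S j) (M j) t x)"

text \<open>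
  The last hypothesis bounds the squared \<open>L\<^sup>2\<close> norm of the maximal truncations of the piece \<open>j\<close> at any
  one time.
\<close>
context
  fixes S :: "nat \<Rightarrow> (int ^ 'd::finite) set" and c :: "nat \<Rightarrow> real" and M :: "nat \<Rightarrow> nat"
  assumes fin: "\<And>j. finite (S j)"
    and range: "\<And>j. \<forall>n\<in>S j. real (Suc j) \<le> infnorm (real_vec n) \<and> infnorm (real_vec n) \<le> real (M j)"
    and c0: "\<And>j. 0 \<le> c j"
    and small: "\<And>j. (c j)\<^sup>2 * (2 * real (card (S j)) * sqrt (real (card (S j)))) \<le> (1 / 8) ^ j"
begin

lemma freq_lower: "n \<in> S j \<Longrightarrow> real (Suc j) \<le> infnorm (real_vec n)"
  and freq_upper: "n \<in> S j \<Longrightarrow> infnorm (real_vec n) \<le> real (M j)"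
  using range by blast+

lemma series_coeff_eq:
  assumes "infnorm (real_vec n) \<le> real L"
  shows "series_coeff S c n = (\<Sum>j<L. if n \<in> S j then c j else 0)"
  unfolding series_coeff_def
proof (rule sum.mono_neutral_left)
  show "{..<nat \<lceil>infnorm (real_vec n)\<rceil>} \<subseteq> {..<L}" using assms by auto
  show "\<forall>j\<in>{..<L} - {..<nat \<lceil>infnorm (real_vec n)\<rceil>}. (if n \<in> S j then c j else 0) = 0"
  proof
    fix j assume "j \<in> {..<L} - {..<nat \<lceil>infnorm (real_vec n)\<rceil>}"
    then have "infnorm (real_vec n) \<le> real j" by auto
    then have "n \<notin> S j" using freq_lower[of n j] by auto
    then show "(if n \<in> S j then c j else 0) = 0" by simp
  qed
qed auto

lemma series_partial_eq:
  "series_partial S c t L x = (\<Sum>j<L. complex_of_real (c j) * trunc_sum (S j) L t x)"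
proof -
  let ?N = "{n :: int ^ 'd. infnorm (real_vec n) \<le> real L}"
  let ?e = "\<lambda>n. cis (real_vec n \<bullet> x - t * (norm (real_vec n))\<^sup>2)"
  have "series_partial S c t L x = (\<Sum>n\<in>?N. \<Sum>j<L. if n \<in> S j then complex_of_real (c j) * ?e n else 0)"
    unfolding series_partial_def
  proof (rule sum.cong)
    fix n assume n: "n \<in> ?N"
    have "complex_of_real (series_coeff S c n) = (\<Sum>j<L. if n \<in> S j then complex_of_real (c j) else 0)"
      using n by (simp add: series_coeff_eq if_distrib[of complex_of_real] cong: if_cong)
    then show "complex_of_real (series_coeff S c n) * ?e n = (\<Sum>j<L. if n \<in> S j then complex_of_real (c j) * ?e n else 0)"
      by (simp add: sum_distrib_right if_distrib[of "\<lambda>u. u * _"] cong: if_cong)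
  qed simp
  also have "\<dots> = (\<Sum>j<L. \<Sum>n\<in>?N. if n \<in> S j then complex_of_real (c j) * ?e n else 0)"
    by (rule sum.swap)
  also have "\<dots> = (\<Sum>j<L. complex_of_real (c j) * trunc_sum (S j) L t x)"
  proof (rule sum.cong)
    fix j
    have "(\<Sum>n\<in>?N. if n \<in> S j then complex_of_real (c j) * ?e n else 0)
        = (\<Sum>n\<in>?N \<inter> S j. complex_of_real (c j) * ?e n)"
      by (rule sum.inter_restrict[OF finite_infnorm_le, symmetric])
    also have "?N \<inter> S j = {n\<in>S j. infnorm (real_vec n) \<le> real L}" by blast
    finally show "(\<Sum>n\<in>?N. if n \<in> S j then complex_of_real (c j) * ?e n else 0)
        = complex_of_real (c j) * trunc_sum (S j) L t x"
      by (simp only: trunc_sum_def sum_distrib_left)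
  qed simp
  finally show ?thesis .
qed

lemma piece_bound_nonneg: "0 \<le> piece_bound S c M j t x"
  unfolding piece_bound_def by (intro mult_nonneg_nonneg c0 real_sqrt_ge_zero trunc_majorant_nonneg)

lemma cmod_piece_le: "cmod (complex_of_real (c j) * trunc_sum (S j) L t x) \<le> piece_bound S c M j t x"
proof -
  have lo1: "1 \<le> infnorm (real_vec n)" if "n \<in> S j" for n
    using freq_lower[OF that] by simp
  have "(cmod (trunc_sum (S j) L t x))\<^sup>2 \<le> trunc_majorant (S j) (M j) t x"
    by (rule trunc_sum_bound[OF fin lo1 freq_upper])
  then have "cmod (trunc_sum (S j) L t x) \<le> sqrt (trunc_majorant (S j) (M j) t x)"
    by (rule real_le_rsqrt)
  then show ?thesis
    unfolding piece_bound_def norm_mult using c0[of j] by (simp add: mult_left_mono)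
qed

lemma cmod_piece_value_le: "cmod (piece_value S c j t x) \<le> piece_bound S c M j t x"
  using cmod_piece_le[of j "M j" t x] freq_upper by (simp add: trunc_sum_full piece_value_def)

lemma piece_bound_sq: "(piece_bound S c M j t x)\<^sup>2 = (c j)\<^sup>2 * trunc_majorant (S j) (M j) t x"
  by (simp add: piece_bound_def power_mult_distrib trunc_majorant_nonneg)

lemma integrable_piece_bound_sq: "integrable torus (\<lambda>x. (piece_bound S c M j t x)\<^sup>2)"
  unfolding piece_bound_sq using integrable_trunc(3)[OF fin] by simp

lemma integral_piece_bound_sq_le:
  "(\<integral>x. (piece_bound S c M j t x)\<^sup>2 \<partial>torus) \<le> (c j)\<^sup>2 * (2 * real (card (S j)) * sqrt (real (card (S j))))"
  unfolding piece_bound_sq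
  using integral_trunc_majorant_le[OF fin] by (simp add: mult_left_mono)

lemma
  shows AE_summable_weighted: "AE x in torus. summable (\<lambda>j. 4 ^ j * (piece_bound S c M j t x)\<^sup>2)"
    and integrable_weighted: "integrable torus (\<lambda>x. \<Sum>j. 4 ^ j * (piece_bound S c M j t x)\<^sup>2)"
proof -
  have 1: "integrable torus (\<lambda>x. 4 ^ j * (piece_bound S c M j t x)\<^sup>2)" for j
    using integrable_piece_bound_sq by simp
  have 2: "(\<integral>x. 4 ^ j * (piece_bound S c M j t x)\<^sup>2 \<partial>torus) \<le> (1 / 2) ^ j" for j
  proof -
    have "(\<integral>x. (piece_bound S c M j t x)\<^sup>2 \<partial>torus) \<le> (1 / 8) ^ j"
      using integral_piece_bound_sq_le small order_trans by blast
    then have "4 ^ j * (\<integral>x. (piece_bound S c M j t x)\<^sup>2 \<partial>torus) \<le> 4 ^ j * (1 / 8) ^ j"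
      by (rule mult_left_mono) simp
    also have "4 ^ j * (1 / 8) ^ j = (1 / 2 :: real) ^ j"
      by (simp add: power_mult_distrib[symmetric])
    finally show ?thesis by simp
  qed
  show "AE x in torus. summable (\<lambda>j. 4 ^ j * (piece_bound S c M j t x)\<^sup>2)"
    by (rule AE_summable_geometric(1)[OF 1 _ 2]) simp
  show "integrable torus (\<lambda>x. \<Sum>j. 4 ^ j * (piece_bound S c M j t x)\<^sup>2)"
    by (rule AE_summable_geometric(2)[OF 1 _ 2]) simp
qed

lemma summable_piece_bound:
  assumes "summable (\<lambda>j. 4 ^ j * (piece_bound S c M j t x)\<^sup>2)"
  shows "summable (\<lambda>j. piece_bound S c M j t x)"
    and "(\<Sum>j. piece_bound S c M j t x) \<le> 2 * sqrt (\<Sum>j. 4 ^ j * (piece_bound S c M j t x)\<^sup>2)"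
proof -
  let ?W = "sqrt (\<Sum>j. 4 ^ j * (piece_bound S c M j t x)\<^sup>2)"
  note b = weighted_square_bound[OF piece_bound_nonneg assms]
  have g: "(\<lambda>j. ?W * (1 / 2) ^ j) sums (?W * 2)"
    using sums_mult[OF geometric_sums[of "1 / 2 :: real"]] by simp
  show s: "summable (\<lambda>j. piece_bound S c M j t x)"
    by (rule summable_comparison_test'[where N = 0, OF sums_summable[OF g]])
      (use b piece_bound_nonneg in auto)
  have "(\<Sum>j. piece_bound S c M j t x) \<le> (\<Sum>j. ?W * (1 / 2) ^ j)"
    using b s sums_summable[OF g] by (intro suminf_le) auto
  then show "(\<Sum>j. piece_bound S c M j t x) \<le> 2 * ?W"
    using sums_unique[OF g] by simp
qed

lemma series_partial_tendsto:
  assumes "summable (\<lambda>j. piece_bound S c M j t x)"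
  shows "(\<lambda>L. series_partial S c t L x) \<longlonglongrightarrow> (\<Sum>j. piece_value S c j t x)"
    and "summable (\<lambda>j. cmod (piece_value S c j t x))"
    and "cmod (series_partial S c t L x) \<le> (\<Sum>j. piece_bound S c M j t x)"
proof -
  let ?a = "\<lambda>j L. complex_of_real (c j) * trunc_sum (S j) L t x"
  have lim: "(\<lambda>L. ?a j L) \<longlonglongrightarrow> piece_value S c j t x" for j
  proof (rule tendsto_eventually)
    show "eventually (\<lambda>L. ?a j L = piece_value S c j t x) sequentially"
      using eventually_ge_at_top[of "M j"]
    proof eventually_elim
      case (elim L)
      have "infnorm (real_vec n) \<le> real L" if "n \<in> S j" for n
        using freq_upper[OF that] elim by linarith
      then show ?case by (simp add: trunc_sum_full piece_value_def)
    qed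
  qed
  have "eventually (\<lambda>(k,n). norm (?a k n) \<le> piece_bound S c M k t x) (at_top \<times>\<^sub>F sequentially)"
    by (rule always_eventually) (use cmod_piece_le in auto)
  note T = tannerys_theorem[OF lim this assms sequentially_bot]
  have zero: "?a j L = 0" if "L \<le> j" for j L
  proof -
    have "{n\<in>S j. infnorm (real_vec n) \<le> real L} = {}"
      using freq_lower[of _ j] that by force
    then show ?thesis unfolding trunc_sum_def by (simp only: sum.empty mult_zero_right)
  qed
  have "(\<Sum>j. ?a j L) = series_partial S c t L x" for L
    unfolding series_partial_eq using zero by (intro suminf_finite) auto
  then show "(\<lambda>L. series_partial S c t L x) \<longlonglongrightarrow> (\<Sum>j. piece_value S c j t x)"
    using T by simp
  show "summable (\<lambda>j. cmod (piece_value S c j t x))"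
    using T by blast
  have "cmod (series_partial S c t L x) \<le> (\<Sum>j<L. piece_bound S c M j t x)"
    unfolding series_partial_eq by (intro order_trans[OF norm_sum] sum_mono cmod_piece_le)
  also have "\<dots> \<le> (\<Sum>j. piece_bound S c M j t x)"
    using assms piece_bound_nonneg by (intro sum_le_suminf) auto
  finally show "cmod (series_partial S c t L x) \<le> (\<Sum>j. piece_bound S c M j t x)" .
qed

lemma series_limit_eq:
  assumes "summable (\<lambda>j. piece_bound S c M j t x)"
  shows "series_limit S c t x = (\<Sum>j. piece_value S c j t x)"
    and "convergent (\<lambda>L. series_partial S c t L x)"
  using series_partial_tendsto(1)[OF assms] unfolding series_limit_def convergent_def
  by (auto intro: limI)

lemma AE_series:
  "AE x in torus. (\<lambda>L. series_partial S c t L x) \<longlonglongrightarrow> series_limit S c t x \<and>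
     (\<forall>L. (cmod (series_partial S c t L x))\<^sup>2 \<le> 4 * (\<Sum>j. 4 ^ j * (piece_bound S c M j t x)\<^sup>2)) \<and>
     (cmod (series_limit S c t x))\<^sup>2 \<le> 4 * (\<Sum>j. 4 ^ j * (piece_bound S c M j t x)\<^sup>2)"
  using AE_summable_weighted[of t]
proof eventually_elim
  case (elim x)
  note s = summable_piece_bound[OF elim]
  let ?W = "\<Sum>j. 4 ^ j * (piece_bound S c M j t x)\<^sup>2"
  have W: "0 \<le> ?W" using elim by (intro suminf_nonneg) auto
  have lim: "(\<lambda>L. series_partial S c t L x) \<longlonglongrightarrow> series_limit S c t x"
    using series_partial_tendsto(1)[OF s(1)] series_limit_eq(1)[OF s(1)] by simp
  have "cmod (series_partial S c t L x) \<le> 2 * sqrt ?W" for L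
    using series_partial_tendsto(3)[OF s(1)] s(2) order_trans by blast
  then have b: "(cmod (series_partial S c t L x))\<^sup>2 \<le> 4 * ?W" for L
    using power_mono[of "cmod (series_partial S c t L x)" "2 * sqrt ?W" 2] W by (simp add: power_mult_distrib)
  have "(\<lambda>L. (cmod (series_partial S c t L x))\<^sup>2) \<longlonglongrightarrow> (cmod (series_limit S c t x))\<^sup>2"
    using lim by (intro tendsto_intros)
  then have "(cmod (series_limit S c t x))\<^sup>2 \<le> 4 * ?W"
    using b by (intro LIMSEQ_le_const2) auto
  then show ?case using lim b by blast
qed

lemma continuous_series_partial: "continuous_on A (series_partial S c t L)"
  unfolding series_partial_def[abs_def] by (intro continuous_intros)

lemma series_limit_borel: "series_limit S c t \<in> borel_measurable borel"
  unfolding series_limit_def[abs_def]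
  by (rule borel_measurable_lim_metric) (intro borel_measurable_continuous_onI continuous_series_partial)

lemma torus_periodic_series_limit: "torus_periodic (series_limit S c t)"
proof -
  have "series_partial S c t L (x + axis i (2 * pi)) = series_partial S c t L x" for L x i
  proof -
    have "cis (real_vec n \<bullet> (x + axis i (2 * pi)) - t * (norm (real_vec n))\<^sup>2)
        = cis (real_vec n \<bullet> x - t * (norm (real_vec n))\<^sup>2)" for n :: "int ^ 'd"
      using torus_periodic_cis[of n "- t * (norm (real_vec n))\<^sup>2"] by (simp add: torus_periodic_def)
    then show ?thesis unfolding series_partial_def by (simp only:)
  qed
  then show ?thesis by (simp add: torus_periodic_def series_limit_def)
qed

lemma L2_series_limit: "L2_torus (series_limit S c t)"
  unfolding L2_torus_def
proof (intro conjI torus_periodic_series_limit borel_measurable_torus series_limit_borel)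
  show "integrable torus (\<lambda>x. (cmod (series_limit S c t x))\<^sup>2)"
  proof (rule Bochner_Integration.integrable_bound)
    show "integrable torus (\<lambda>x. 4 * (\<Sum>j. 4 ^ j * (piece_bound S c M j t x)\<^sup>2))"
      using integrable_weighted by simp
    show "(\<lambda>x. (cmod (series_limit S c t x))\<^sup>2) \<in> borel_measurable torus"
      using borel_measurable_torus[OF series_limit_borel[of t]] by measurable
    show "AE x in torus. norm ((cmod (series_limit S c t x))\<^sup>2) \<le> norm (4 * (\<Sum>j. 4 ^ j * (piece_bound S c M j t x)\<^sup>2))"
      using AE_series[of t] by eventually_elim auto
  qed
qed

lemma fourier_series_partial:
  assumes "infnorm (real_vec n) \<le> real L"
  shows "fourier (series_partial S c t L) n = complex_of_real (series_coeff S c n) * cis (- t * (norm (real_vec n))\<^sup>2)"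
proof -
  have "series_partial S c t L = (\<lambda>x. \<Sum>n | infnorm (real_vec n) \<le> real L.
     (complex_of_real (series_coeff S c n) * cis (- t * (norm (real_vec n))\<^sup>2)) * cis (real_vec n \<bullet> x))"
    unfolding series_partial_def[abs_def] by (simp add: cis_mult add.commute mult.assoc)
  then show ?thesis
    using assms by (simp only: fourier_trig[OF finite_infnorm_le] mem_Collect_eq if_True)
qed

text \<open>
  Fourier coefficients pass to the limit by dominated convergence.
\<close>
lemma fourier_series_limit:
  "fourier (series_limit S c t) n = complex_of_real (series_coeff S c n) * cis (- t * (norm (real_vec n))\<^sup>2)"
proof -
  let ?e = "\<lambda>x. cis (- (real_vec n \<bullet> x))"
  let ?W = "\<lambda>x. \<Sum>j. 4 ^ j * (piece_bound S c M j t x)\<^sup>2"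
  have em: "(\<lambda>x. ?e x) \<in> borel_measurable torus"
    by (intro borel_measurable_torus borel_measurable_continuous_onI continuous_intros)
  have "(\<lambda>L. \<integral>x. series_partial S c t L x * ?e x \<partial>torus) \<longlonglongrightarrow> (\<integral>x. series_limit S c t x * ?e x \<partial>torus)"
  proof (rule integral_dominated_convergence[where w = "\<lambda>x. 1 + 4 * ?W x"])
    show "(\<lambda>x. series_limit S c t x * ?e x) \<in> borel_measurable torus"
      using borel_measurable_torus[OF series_limit_borel[of t]] em by measurable
    show "(\<lambda>x. series_partial S c t L x * ?e x) \<in> borel_measurable torus" for L
      by (intro borel_measurable_torus borel_measurable_continuous_onI continuous_intros continuous_series_partial)
    show "integrable torus (\<lambda>x. 1 + 4 * ?W x)"
      using integrable_weighted integrable_torus_const by (intro Bochner_Integration.integrable_add integrable_mult_right)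
    show "AE x in torus. (\<lambda>L. series_partial S c t L x * ?e x) \<longlonglongrightarrow> series_limit S c t x * ?e x"
      using AE_series[of t] by eventually_elim (auto intro: tendsto_mult_right)
    show "AE x in torus. norm (series_partial S c t L x * ?e x) \<le> 1 + 4 * ?W x" for L
      using AE_series[of t]
    proof eventually_elim
      case (elim x)
      have "y \<le> 1 + y\<^sup>2" for y :: real
      proof -
        have "2 * y \<le> 1 + y\<^sup>2" using zero_le_power2[of "y - 1"] by (simp add: power2_eq_square algebra_simps)
        then show ?thesis using zero_le_power2[of y] by linarith
      qed
      then have "cmod (series_partial S c t L x) \<le> 1 + (cmod (series_partial S c t L x))\<^sup>2" .
      also have "\<dots> \<le> 1 + 4 * ?W x" using elim by auto
      finally show ?case by (simp add: norm_mult)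
    qed
  qed
  then have lim: "(\<lambda>L. fourier (series_partial S c t L) n) \<longlonglongrightarrow> fourier (series_limit S c t) n"
    unfolding fourier_def .
  have "(\<lambda>L. fourier (series_partial S c t L) n) \<longlonglongrightarrow>
      complex_of_real (series_coeff S c n) * cis (- t * (norm (real_vec n))\<^sup>2)"
  proof (rule tendsto_eventually)
    show "eventually (\<lambda>L. fourier (series_partial S c t L) n =
        complex_of_real (series_coeff S c n) * cis (- t * (norm (real_vec n))\<^sup>2)) sequentially"
      using eventually_ge_at_top[of "nat \<lceil>infnorm (real_vec n)\<rceil>"]
    proof eventually_elim
      case (elim L)
      then have "infnorm (real_vec n) \<le> real L" by linarith
      then show ?case by (rule fourier_series_partial)
    qed
  qed
  then show ?thesis using lim LIMSEQ_unique by blast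
qed

lemma fourier_series_initial: "fourier (series_limit S c 0) n = complex_of_real (series_coeff S c n)"
  by (simp add: fourier_series_limit)

lemma cube_truncation_series: "cube_truncation L t (series_limit S c 0) x = series_partial S c t L x"
  unfolding cube_truncation_def evolution_term_def series_partial_def fourier_series_initial ..

lemma evolution_value_series: "evolution_value t (series_limit S c 0) = series_limit S c t"
  by (rule ext) (simp only: evolution_value_def cube_truncation_series series_limit_def[of S c t])

lemma is_evolution_series: "is_evolution t (series_limit S c 0) (series_limit S c t)"
  unfolding is_evolution_def fourier_series_initial
  using L2_series_limit fourier_series_limit by blast

lemma finite_sobolev_series:
  assumes sep: "\<And>i j n. i < j \<Longrightarrow> n \<in> S j \<Longrightarrow> real (M i) < infnorm (real_vec n)"
    and sob: "\<And>j. (c j)\<^sup>2 * (\<Sum>n\<in>S j. (1 + (norm (real_vec n))\<^sup>2) powr s) \<le> (1 / 2) ^ j"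
  shows "finite_sobolev s (series_limit S c 0)"
  unfolding finite_sobolev_def
proof (rule nonneg_bounded_partial_sums_imp_summable_on)
  let ?f = "series_limit S c 0"
  let ?w = "\<lambda>n. (1 + (norm (real_vec n))\<^sup>2) powr s"
  show "0 \<le> sobolev_term s ?f n" for n by (simp add: sobolev_term_def)
  have uniq: "i = j" if "n \<in> S i" "n \<in> S j" for n i j
    using that sep freq_upper by (metis linorder_neqE_nat not_less)
  have coeff: "sobolev_term s ?f n \<le> (\<Sum>j<L. if n \<in> S j then (c j)\<^sup>2 * ?w n else 0)"
    if "infnorm (real_vec n) \<le> real L" for n L
  proof (cases "\<exists>j<L. n \<in> S j")
    case True
    then obtain j where j: "j < L" "n \<in> S j" by blast
    have iff: "n \<in> S i \<longleftrightarrow> i = j" for i using uniq j by blast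
    have "series_coeff S c n = c j"
      using series_coeff_eq[OF that] j(1) by (simp add: iff sum.delta)
    then show ?thesis
      using j(1) by (simp add: sobolev_term_def fourier_series_initial iff sum.delta mult.commute)
  next
    case False
    then have "series_coeff S c n = 0"
      using series_coeff_eq[OF that] by (auto intro!: sum.neutral)
    then show ?thesis
      by (simp add: sobolev_term_def fourier_series_initial sum_nonneg)
  qed
  have bound: "sum (sobolev_term s ?f) X \<le> 2" if "finite X" for X
  proof -
    define L where "L = nat \<lceil>Max (insert 0 ((\<lambda>n. infnorm (real_vec n)) ` X))\<rceil>"
    have L: "infnorm (real_vec n) \<le> real L" if "n \<in> X" for n
    proof -
      have "infnorm (real_vec n) \<le> Max (insert 0 ((\<lambda>n. infnorm (real_vec n)) ` X))"
        using \<open>finite X\<close> that by (intro Max_ge) auto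
      then show ?thesis unfolding L_def by linarith
    qed
    have "sum (sobolev_term s ?f) X \<le> (\<Sum>n\<in>X. \<Sum>j<L. if n \<in> S j then (c j)\<^sup>2 * ?w n else 0)"
      using coeff L by (intro sum_mono) auto
    also have "\<dots> = (\<Sum>j<L. \<Sum>n\<in>X. if n \<in> S j then (c j)\<^sup>2 * ?w n else 0)"
      by (rule sum.swap)
    also have "\<dots> = (\<Sum>j<L. \<Sum>n\<in>X \<inter> S j. (c j)\<^sup>2 * ?w n)"
      using that by (simp add: sum.inter_restrict)
    also have "\<dots> \<le> (\<Sum>j<L. \<Sum>n\<in>S j. (c j)\<^sup>2 * ?w n)"
      using fin by (intro sum_mono sum_mono2) auto
    also have "\<dots> \<le> (\<Sum>j<L. (1 / 2) ^ j)"
      using sob by (intro sum_mono) (simp add: sum_distrib_left)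
    also have "\<dots> \<le> (\<Sum>j. (1 / 2) ^ j)"
      by (intro sum_le_suminf) (auto simp: summable_geometric)
    also have "\<dots> = 2" using suminf_geometric[of "1 / 2 :: real"] by simp
    finally show ?thesis .
  qed
  then show "eventually (\<lambda>X. sum (sobolev_term s ?f) X \<le> 2) (finite_subsets_at_top UNIV)"
    by (intro eventually_finite_subsets_at_top_weakI) auto
qed

end

section \<open>Choice of the pieces\<close>

text \<open>
  The requirements on the piece with index \<open>j\<close>, where \<open>\<tau>\<close> bounds the number of times used by the earlier
  pieces and \<open>\<sigma>\<close> bounds the sup norm of the sum of the earlier pieces: the piece reaches the modulus
  \<open>j + \<sigma>\<close> at times below \<open>1 / (j + 1)\<close>, it is small in \<open>H\<^sup>s\<close>, and its maximal truncations at
  \<open>\<tau> + 1\<close> times are small together.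
\<close>
definition good_piece ::
  "real \<Rightarrow> nat \<Rightarrow> nat \<Rightarrow> real \<Rightarrow> (int ^ 'd::finite) set \<Rightarrow> real set \<Rightarrow> real \<Rightarrow> nat \<Rightarrow> bool" where
  "good_piece s j \<tau> \<sigma> S T c M \<longleftrightarrow>
     finite S \<and> finite T \<and> T \<subseteq> {0<..<1 / real (Suc j)} \<and>
     (\<forall>n\<in>S. real (Suc j) \<le> infnorm (real_vec n) \<and> infnorm (real_vec n) \<le> real M) \<and>
     0 \<le> c \<and> c * real (card S) / 2 = real j + \<sigma> \<and>
     c\<^sup>2 * (2 * real (card S) * sqrt (real (card S))) * (1 + real \<tau>) \<le> (1 / 8) ^ j \<and>
     c\<^sup>2 * (\<Sum>n\<in>S. (1 + (norm (real_vec n))\<^sup>2) powr s) \<le> (1 / 2) ^ j \<and>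
     focus_set S T \<in> sets torus \<and> focus_const CARD('d) \<le> measure torus (focus_set S T)"

lemma ex_good_piece:
  fixes s \<sigma> :: real and j \<tau> M0 :: nat
  assumes d2: "CARD('d::finite) \<ge> 2" and s: "s < real CARD('d) / (real CARD('d) + 2)" and \<sigma>: "\<sigma> \<ge> 0"
  shows "\<exists>(S :: (int ^ 'd) set) T c M. good_piece s j \<tau> \<sigma> S T c M \<and> M0 \<le> M \<and>
     (\<forall>n\<in>S. real M0 < infnorm (real_vec n))"
proof -
  define \<mu> where "\<mu> = real j + \<sigma>"
  have \<mu>0: "\<mu> \<ge> 0" using \<sigma> by (simp add: \<mu>_def)
  define B where "B = 8 ^ j * (8 * \<mu>\<^sup>2 * (1 + real \<tau>))"
  have B0: "B \<ge> 0" by (simp add: B_def)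
  define \<epsilon> where "\<epsilon> = min (1 / (2 ^ j * (4 * \<mu>\<^sup>2 + 1))) (1 / (B\<^sup>2 + 1))"
  have pos1: "4 * \<mu>\<^sup>2 + 1 > 0" "B\<^sup>2 + 1 > 0" by (simp_all add: add_nonneg_pos)
  have \<epsilon>: "\<epsilon> > 0" using pos1 by (simp add: \<epsilon>_def)
  define p where "p = max (Suc j) (Suc M0)"
  have p1: "1 \<le> p" by (simp add: p_def)
  obtain S :: "(int ^ 'd) set" and T where S: "finite S" "S \<noteq> {}" and T: "finite T" "T \<subseteq> {0<..<1 / real p}"
    and inf: "\<And>n. n \<in> S \<Longrightarrow> real p \<le> infnorm (real_vec n)"
    and pw: "\<And>n. n \<in> S \<Longrightarrow> (1 + (norm (real_vec n))\<^sup>2) powr s \<le> \<epsilon> * real (card S)"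
    and card: "1 / \<epsilon> \<le> real (card S)"
    and X: "focus_set S T \<in> sets torus" "focus_const CARD('d) \<le> measure torus (focus_set S T)"
    by (rule ex_focusing_frequencies[OF d2 s p1 \<epsilon>]; rule that)
  define F where "F = real (card S)"
  have F: "F > 0" using S by (simp add: F_def card_gt_0_iff)
  define c where "c = 2 * \<mu> / F"
  define M where "M = max M0 (nat \<lceil>Max ((\<lambda>n. infnorm (real_vec n)) ` S)\<rceil>)"
  have hi: "infnorm (real_vec n) \<le> real M" if "n \<in> S" for n
  proof -
    have "infnorm (real_vec n) \<le> Max ((\<lambda>n. infnorm (real_vec n)) ` S)"
      using S that by (intro Max_ge) auto
    then show ?thesis unfolding M_def by linarith
  qed
  have FB: "B\<^sup>2 \<le> F"
  proof -
    have "\<epsilon> \<le> 1 / (B\<^sup>2 + 1)" by (simp add: \<epsilon>_def)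
    then have "B\<^sup>2 + 1 \<le> 1 / \<epsilon>" using \<epsilon> pos1 by (simp add: field_simps)
    then show ?thesis using card by (simp add: F_def)
  qed
  have c1: "c\<^sup>2 * (2 * F * sqrt F) * (1 + real \<tau>) \<le> (1 / 8) ^ j"
  proof -
    have sq: "sqrt F * sqrt F = F" using F by simp
    have "B \<le> sqrt F" using FB by (rule real_le_rsqrt)
    then have "8 ^ j * (8 * \<mu>\<^sup>2 * (1 + real \<tau>)) / sqrt F \<le> 1"
      using F by (simp add: B_def)
    moreover have "c\<^sup>2 * (2 * F * sqrt F) * (1 + real \<tau>) = 8 * \<mu>\<^sup>2 * (1 + real \<tau>) / sqrt F"
    proof -
      have "c\<^sup>2 * (2 * F * sqrt F) = 8 * \<mu>\<^sup>2 * (sqrt F / F)"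
        using F by (simp add: c_def power2_eq_square field_simps)
      also have "sqrt F / F = 1 / sqrt F"
        using F sq by (simp add: field_simps)
      finally show ?thesis by simp
    qed
    ultimately show ?thesis by (simp add: power_divide field_simps)
  qed
  have c2: "c\<^sup>2 * (\<Sum>n\<in>S. (1 + (norm (real_vec n))\<^sup>2) powr s) \<le> (1 / 2) ^ j"
  proof -
    have "(\<Sum>n\<in>S. (1 + (norm (real_vec n))\<^sup>2) powr s) \<le> (\<Sum>n\<in>S. \<epsilon> * F)"
      unfolding F_def by (intro sum_mono pw)
    also have "\<dots> = \<epsilon> * F\<^sup>2" by (simp add: F_def power2_eq_square)
    finally have "c\<^sup>2 * (\<Sum>n\<in>S. (1 + (norm (real_vec n))\<^sup>2) powr s) \<le> c\<^sup>2 * (\<epsilon> * F\<^sup>2)"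
      by (rule mult_left_mono) simp
    also have "\<dots> = 4 * \<mu>\<^sup>2 * \<epsilon>"
      using F by (simp add: c_def power2_eq_square)
    also have "\<dots> \<le> (4 * \<mu>\<^sup>2 + 1) * (1 / (2 ^ j * (4 * \<mu>\<^sup>2 + 1)))"
      using \<epsilon> by (intro mult_mono) (auto simp: \<epsilon>_def)
    also have "\<dots> = (1 / 2) ^ j"
      using pos1 by (simp add: power_divide)
    finally show ?thesis .
  qed
  have "T \<subseteq> {0<..<1 / real (Suc j)}"
  proof
    fix t assume "t \<in> T"
    then have "0 < t" "t < 1 / real p" using T by auto
    moreover have "1 / real p \<le> 1 / real (Suc j)"
      by (intro divide_left_mono) (auto simp: p_def)
    ultimately show "t \<in> {0<..<1 / real (Suc j)}" by auto
  qed
  moreover have "real (Suc j) \<le> infnorm (real_vec n)" "real M0 < infnorm (real_vec n)" if "n \<in> S" for n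
  proof -
    have "real (Suc j) \<le> real p" "real M0 < real p" unfolding p_def by auto
    then show "real (Suc j) \<le> infnorm (real_vec n)" "real M0 < infnorm (real_vec n)"
      using inf[OF that] by linarith+
  qed
  moreover have "0 \<le> c" using \<mu>0 F by (simp add: c_def)
  moreover have "c * F / 2 = real j + \<sigma>" using F by (simp add: c_def \<mu>_def)
  ultimately have "good_piece s j \<tau> \<sigma> S T c M"
    unfolding good_piece_def F_def[symmetric] using S T X hi c1 c2 by blast
  moreover have "M0 \<le> M" by (simp add: M_def)
  ultimately show ?thesis
    using \<open>\<And>n. n \<in> S \<Longrightarrow> real M0 < infnorm (real_vec n)\<close> by blast
qed

lemma ex_good_pieces:
  fixes s :: real
  assumes d2: "CARD('d::finite) \<ge> 2" and s: "s < real CARD('d) / (real CARD('d) + 2)"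
  obtains S :: "nat \<Rightarrow> (int ^ 'd) set" and T :: "nat \<Rightarrow> real set" and c :: "nat \<Rightarrow> real"
    and M \<tau> :: "nat \<Rightarrow> nat" and \<sigma> :: "nat \<Rightarrow> real" where
    "\<And>j. good_piece s j (\<tau> j) (\<sigma> j) (S j) (T j) (c j) (M j)"
    "\<And>i j n. i < j \<Longrightarrow> n \<in> S j \<Longrightarrow> real (M i) < infnorm (real_vec n)"
    "\<And>j. (\<Sum>k<j. card (T k)) \<le> \<tau> j"
    "\<And>j. (\<Sum>k<j. c k * real (card (S k))) \<le> \<sigma> j"
proof -
  define P :: "nat \<Rightarrow> (int ^ 'd) set \<times> real set \<times> real \<times> nat \<times> nat \<times> real \<Rightarrow> bool" where
    "P j = (\<lambda>(S, T, c, M, \<tau>, \<sigma>). 0 \<le> \<sigma> \<and> good_piece s j \<tau> \<sigma> S T c M)" for j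
  define Q :: "nat \<Rightarrow> (int ^ 'd) set \<times> real set \<times> real \<times> nat \<times> nat \<times> real
      \<Rightarrow> (int ^ 'd) set \<times> real set \<times> real \<times> nat \<times> nat \<times> real \<Rightarrow> bool" where
    "Q j = (\<lambda>(S, T, c, M, \<tau>, \<sigma>) (S', T', c', M', \<tau>', \<sigma>').
       M \<le> M' \<and> (\<forall>n\<in>S'. real M < infnorm (real_vec n)) \<and>
       \<tau>' = \<tau> + card T \<and> \<sigma>' = \<sigma> + c * real (card S))" for j :: nat
  have "\<exists>F. \<forall>j. P j (F j) \<and> Q j (F j) (F (Suc j))"
  proof (rule dependent_nat_choice)
    obtain S :: "(int ^ 'd) set" and T c M where "good_piece s 0 0 0 S T c M"
      using ex_good_piece[OF d2 s order_refl, where j = 0 and \<tau> = 0 and ?M0.0 = 0] by blast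
    then have "P 0 (S, T, c, M, 0, 0)" by (simp add: P_def)
    then show "\<exists>x. P 0 x" by blast
  next
    fix x j assume Px: "P j x"
    obtain S T c M \<tau> \<sigma> where x: "x = (S, T, c, M, \<tau>, \<sigma>)" by (cases x) auto
    have \<sigma>0: "0 \<le> \<sigma>" and gp: "good_piece s j \<tau> \<sigma> S T c M" using Px by (auto simp: P_def x)
    have "0 \<le> c" using gp by (simp add: good_piece_def)
    then have \<sigma>': "0 \<le> \<sigma> + c * real (card S)" using \<sigma>0 by simp
    obtain S' :: "(int ^ 'd) set" and T' c' M' where
      "good_piece s (Suc j) (\<tau> + card T) (\<sigma> + c * real (card S)) S' T' c' M'" "M \<le> M'"
      "\<forall>n\<in>S'. real M < infnorm (real_vec n)"
      using ex_good_piece[OF d2 s \<sigma>', where j = "Suc j" and \<tau> = "\<tau> + card T" and ?M0.0 = M] by blast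
    then have "P (Suc j) (S', T', c', M', \<tau> + card T, \<sigma> + c * real (card S)) \<and>
      Q j x (S', T', c', M', \<tau> + card T, \<sigma> + c * real (card S))"
      using \<sigma>' by (simp add: P_def Q_def x)
    then show "\<exists>y. P (Suc j) y \<and> Q j x y" by blast
  qed
  then obtain F where F: "\<And>j. P j (F j)" "\<And>j. Q j (F j) (F (Suc j))" by blast
  define S where "S j = fst (F j)" for j
  define T where "T j = fst (snd (F j))" for j
  define c where "c j = fst (snd (snd (F j)))" for j
  define M where "M j = fst (snd (snd (snd (F j))))" for j
  define \<tau> where "\<tau> j = fst (snd (snd (snd (snd (F j)))))" for j
  define \<sigma> where "\<sigma> j = snd (snd (snd (snd (snd (F j)))))" for j
  have Fj: "F j = (S j, T j, c j, M j, \<tau> j, \<sigma> j)" for j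
    by (simp add: S_def T_def c_def M_def \<tau>_def \<sigma>_def)
  have P: "0 \<le> \<sigma> j" "good_piece s j (\<tau> j) (\<sigma> j) (S j) (T j) (c j) (M j)" for j
    using F(1)[of j] unfolding Fj P_def by auto
  have Q: "M j \<le> M (Suc j)" "\<forall>n\<in>S (Suc j). real (M j) < infnorm (real_vec n)"
    "\<tau> (Suc j) = \<tau> j + card (T j)" "\<sigma> (Suc j) = \<sigma> j + c j * real (card (S j))" for j
    using F(2)[of j] unfolding Fj Q_def by auto
  have mono: "M i \<le> M j" if "i \<le> j" for i j
    by (rule lift_Suc_mono_le[of M, OF Q(1) that])
  show ?thesis
  proof (rule that[of \<tau> \<sigma> S T c M])
    show "good_piece s j (\<tau> j) (\<sigma> j) (S j) (T j) (c j) (M j)" for j by (rule P)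
    show "real (M i) < infnorm (real_vec n)" if ij: "i < j" and n: "n \<in> S j" for i j n
    proof -
      obtain k where k: "j = Suc k" using ij by (cases j) auto
      have "real (M i) \<le> real (M k)" using mono[of i k] ij k by simp
      also have "\<dots> < infnorm (real_vec n)" using Q(2)[of k] n k by blast
      finally show ?thesis .
    qed
    show "(\<Sum>k<j. card (T k)) \<le> \<tau> j" for j
      by (induction j) (simp_all add: Q)
    show "(\<Sum>k<j. c k * real (card (S k))) \<le> \<sigma> j" for j
      by (induction j) (simp_all add: Q P)
  qed
qed

section \<open>Divergence on a set of positive measure\<close>

lemma limsup_eq_infinity:
  fixes a :: "nat \<Rightarrow> real"
  assumes "\<And>B. \<exists>j. B < a j"
  shows "limsup (\<lambda>j. ereal (a j)) = \<infinity>"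
proof (rule ccontr)
  assume "limsup (\<lambda>j. ereal (a j)) \<noteq> \<infinity>"
  then obtain B where "limsup (\<lambda>j. ereal (a j)) < ereal B"
    using less_PInf_Ex_of_nat by auto
  then have "eventually (\<lambda>j. ereal (a j) < ereal B) sequentially"
    by (rule Limsup_lessD)
  then obtain N where N: "\<And>j. j \<ge> N \<Longrightarrow> a j < B"
    by (auto simp: eventually_sequentially)
  obtain j where j: "Max (insert B (a ` {..<N})) < a j"
    using assms by blast
  have "a j \<le> Max (insert B (a ` {..<N}))"
  proof (cases "j < N")
    case True
    then show ?thesis by (intro Max_ge) auto
  next
    case False
    then have "a j \<le> B" using N[of j] by simp
    also have "B \<le> Max (insert B (a ` {..<N}))" by (intro Max_ge) auto
    finally show ?thesis .
  qed
  then show False using j by simp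
qed

lemma measure_limsup_ge:
  fixes X :: "nat \<Rightarrow> (real ^ 'd::finite) set"
  assumes X: "\<And>k. X k \<in> sets torus" and \<kappa>: "\<And>k. \<kappa> \<le> measure torus (X k)"
  shows "(\<Inter>m. \<Union>k\<in>{m..}. X k) \<in> sets torus" and "\<kappa> \<le> measure torus (\<Inter>m. \<Union>k\<in>{m..}. X k)"
proof -
  let ?B = "\<lambda>m. \<Union>k\<in>{m..}. X k"
  have B: "?B m \<in> sets torus" for m using X by auto
  then show "(\<Inter>m. ?B m) \<in> sets torus" by auto
  have "decseq ?B" unfolding decseq_def by (intro allI impI UN_mono) auto
  then have lim: "(\<lambda>m. measure torus (?B m)) \<longlonglongrightarrow> measure torus (\<Inter>m. ?B m)"
    using B by (intro finite_measure.finite_Lim_measure_decseq[OF finite_measure_torus]) auto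
  have "\<kappa> \<le> measure torus (?B m)" for m
  proof -
    have "measure torus (X m) \<le> measure torus (?B m)"
      using B by (intro finite_measure.finite_measure_mono[OF finite_measure_torus]) auto
    then show ?thesis using \<kappa>[of m] by linarith
  qed
  then show "\<kappa> \<le> measure torus (\<Inter>m. ?B m)"
    using lim by (intro LIMSEQ_le_const) auto
qed

lemma ex_divergent:
  fixes s :: real
  assumes d2: "CARD('d::finite) \<ge> 2" and s: "s < real CARD('d) / (real CARD('d) + 2)"
  shows "\<exists>(f :: real ^ 'd \<Rightarrow> complex) (E :: (real ^ 'd) set) (t :: nat \<Rightarrow> real).
            L2_torus f \<and> finite_sobolev s f \<and>
            E \<in> sets torus \<and> measure torus E > 0 \<and>
            (\<forall>j. t j > 0) \<and> t \<longlonglongrightarrow> 0 \<and>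
            (\<forall>j. AE x in torus. convergent (\<lambda>L. cube_truncation L (t j) f x)) \<and>
            (\<forall>j. is_evolution (t j) f (evolution_value (t j) f)) \<and>
            (\<forall>x\<in>E. (\<forall>j. convergent (\<lambda>L. cube_truncation L (t j) f x)) \<and>
                   limsup (\<lambda>j. ereal (cmod (evolution_value (t j) f x))) = \<infinity> \<and>
                   \<not> ((\<lambda>\<tau>. evolution_value \<tau> f x) \<longlongrightarrow> f x) (at_right 0))"
proof -
  obtain S :: "nat \<Rightarrow> (int ^ 'd) set" and T :: "nat \<Rightarrow> real set" and c :: "nat \<Rightarrow> real"
    and M \<tau> :: "nat \<Rightarrow> nat" and \<sigma> :: "nat \<Rightarrow> real" where
    good: "\<And>j. good_piece s j (\<tau> j) (\<sigma> j) (S j) (T j) (c j) (M j)" and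
    sep: "\<And>i j n. i < j \<Longrightarrow> n \<in> S j \<Longrightarrow> real (M i) < infnorm (real_vec n)" and
    \<tau>: "\<And>j. (\<Sum>k<j. card (T k)) \<le> \<tau> j" and
    \<sigma>: "\<And>j. (\<Sum>k<j. c k * real (card (S k))) \<le> \<sigma> j"
    by (rule ex_good_pieces[OF d2 s]) blast
  let ?\<kappa> = "focus_const CARD('d)"
  let ?X = "\<lambda>k. focus_set (S k) (T k)"
  let ?q = "\<lambda>j. (c j)\<^sup>2 * (2 * real (card (S j)) * sqrt (real (card (S j))))"
  have \<kappa>: "?\<kappa> > 0" by (rule focus_const_pos) simp
  have fin: "finite (S j)" and finT: "finite (T j)" and Tsub: "T j \<subseteq> {0<..<1 / real (Suc j)}"
    and c0: "0 \<le> c j" and cF: "c j * real (card (S j)) / 2 = real j + \<sigma> j"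
    and small\<tau>: "?q j * (1 + real (\<tau> j)) \<le> (1 / 8) ^ j"
    and sob: "(c j)\<^sup>2 * (\<Sum>n\<in>S j. (1 + (norm (real_vec n))\<^sup>2) powr s) \<le> (1 / 2) ^ j"
    and X: "?X j \<in> sets torus" "?\<kappa> \<le> measure torus (?X j)" for j
    using good[of j] unfolding good_piece_def by blast+
  have range: "\<forall>n\<in>S j. real (Suc j) \<le> infnorm (real_vec n) \<and> infnorm (real_vec n) \<le> real (M j)" for j
    using good[of j] unfolding good_piece_def by blast
  have q0: "0 \<le> ?q j" for j by simp
  have small: "?q j \<le> (1 / 8) ^ j" for j
  proof -
    have "?q j * 1 \<le> ?q j * (1 + real (\<tau> j))" by (rule mult_left_mono) (use q0 in auto)
    then show ?thesis using small\<tau>[of j] by linarith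
  qed
  note ctx = fin range c0 small
  define f where "f = series_limit S c 0"
  have trunc: "cube_truncation L t f x = series_partial S c t L x" for L t x
    unfolding f_def by (rule cube_truncation_series[OF ctx])
  have val: "evolution_value t f = series_limit S c t" for t
    unfolding f_def by (rule evolution_value_series[OF ctx])
  let ?R = "piece_bound S c M"

  \<comment> \<open>The times of all the pieces are enumerated; only finitely many of them exceed any \<open>\<epsilon> > 0\<close>.\<close>
  define TT where "TT = (\<Union>k. T k)"
  have Tne: "T k \<noteq> {}" for k
  proof
    assume "T k = {}"
    then have "?X k = {}" by (simp add: focus_set_def)
    then show False using X(2)[of k] \<kappa> by simp
  qed
  have TTpos: "0 < u" if "u \<in> TT" for u using that Tsub unfolding TT_def by fastforce
  have finTT: "finite {u\<in>TT. \<epsilon> \<le> u}" if \<epsilon>: "\<epsilon> > 0" for \<epsilon>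
  proof -
    obtain K where K: "1 / real (Suc K) < \<epsilon>" using \<epsilon> nat_approx_posE by blast
    have "{u\<in>TT. \<epsilon> \<le> u} \<subseteq> (\<Union>k<K. T k)"
    proof
      fix u assume "u \<in> {u\<in>TT. \<epsilon> \<le> u}"
      then obtain k where k: "u \<in> T k" "\<epsilon> \<le> u" by (auto simp: TT_def)
      have "u < 1 / real (Suc k)" using k(1) Tsub[of k] by auto
      then have "1 / real (Suc K) < 1 / real (Suc k)" using K k(2) by linarith
      then have "k < K" by (simp add: field_simps)
      then show "u \<in> (\<Union>k<K. T k)" using k(1) by blast
    qed
    then show ?thesis by (rule finite_subset) (simp add: finT)
  qed
  have "countable TT" by (simp add: TT_def countable_finite[OF finT])
  moreover have "infinite TT"
  proof
    assume fTT: "finite TT"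
    have neTT: "TT \<noteq> {}" using Tne[of 0] by (auto simp: TT_def)
    have "0 < Min TT" using fTT neTT TTpos by simp
    then obtain K where K: "1 / real (Suc K) < Min TT" using nat_approx_posE by blast
    obtain u where u: "u \<in> T K" using Tne by blast
    then have "Min TT \<le> u" using fTT by (intro Min_le) (auto simp: TT_def)
    moreover have "u < 1 / real (Suc K)" using u Tsub[of K] by auto
    ultimately show False using K by linarith
  qed
  ultimately have bij: "bij_betw (from_nat_into TT) UNIV TT" by (rule bij_betw_from_nat_into)
  define t where "t = from_nat_into TT"
  have t_in: "t j \<in> TT" for j using bij by (auto simp: t_def bij_betw_def)
  have t_inj: "inj t" and t_range: "range t = TT"
    using bij by (auto simp: t_def bij_betw_def)
  have t_surj: "\<exists>j. t j = u" if "u \<in> TT" for u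
    using that unfolding t_range[symmetric] by blast
  have t_pos: "t j > 0" for j using TTpos t_in by blast
  have t_lim: "t \<longlonglongrightarrow> 0"
  proof (rule LIMSEQ_I)
    fix \<epsilon> :: real assume "\<epsilon> > 0"
    then have "finite (t -` {u\<in>TT. \<epsilon> \<le> u})"
      using finTT t_inj by (intro finite_vimageI) auto
    then obtain N where "\<forall>j\<in>t -` {u\<in>TT. \<epsilon> \<le> u}. j < N"
      unfolding finite_nat_set_iff_bounded by (rule exE)
    then have N: "j < N" if "\<epsilon> \<le> t j" for j
      using that t_in[of j] by simp
    have "norm (t j - 0) < \<epsilon>" if "j \<ge> N" for j
      using N[of j] that t_pos[of j] by force
    then show "\<exists>no. \<forall>n\<ge>no. norm (t n - 0) < \<epsilon>" by blast
  qed

  \<comment> \<open>\<open>\<psi> j\<close> controls the truncations of the piece \<open>j\<close> at all times used by earlier pieces. Where \<open>\<Sum>\<^sub>j \<psi> j x\<close>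
    is finite, the truncations converge at every time of the sequence, and at the times of the piece \<open>k\<close> the sum of the
    later pieces is bounded independently of \<open>k\<close>.\<close>
  define \<psi> where "\<psi> j x = 4 ^ j * (\<Sum>k<j. \<Sum>u\<in>T k. (?R j u x)\<^sup>2)" for j x
  have \<psi>0: "0 \<le> \<psi> j x" for j x by (simp add: \<psi>_def sum_nonneg)
  have \<psi>int: "integrable torus (\<psi> j)" for j
    unfolding \<psi>_def using integrable_piece_bound_sq[OF ctx]
    by (intro integrable_mult_right Bochner_Integration.integrable_sum) auto
  have \<psi>le: "(\<integral>x. \<psi> j x \<partial>torus) \<le> (1 / 2) ^ j" for j
  proof -
    have "(\<integral>x. \<psi> j x \<partial>torus) = 4 ^ j * (\<Sum>k<j. \<Sum>u\<in>T k. \<integral>x. (?R j u x)\<^sup>2 \<partial>torus)"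
      unfolding \<psi>_def using integrable_piece_bound_sq[OF ctx] by simp
    also have "\<dots> \<le> 4 ^ j * (\<Sum>k<j. \<Sum>u\<in>T k. ?q j)"
      by (intro mult_left_mono sum_mono integral_piece_bound_sq_le[OF ctx]) simp_all
    also have "(\<Sum>k<j. \<Sum>u\<in>T k. ?q j) = real (\<Sum>k<j. card (T k)) * ?q j"
      by (simp add: sum_distrib_right)
    also have "4 ^ j * \<dots> \<le> 4 ^ j * (?q j * (1 + real (\<tau> j)))"
    proof (rule mult_left_mono)
      have "real (\<Sum>k<j. card (T k)) \<le> 1 + real (\<tau> j)" using \<tau>[of j] by linarith
      then have "real (\<Sum>k<j. card (T k)) * ?q j \<le> (1 + real (\<tau> j)) * ?q j"
        using q0 by (rule mult_right_mono)
      then show "real (\<Sum>k<j. card (T k)) * ?q j \<le> ?q j * (1 + real (\<tau> j))" by (simp only: mult.commute)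
    qed simp
    also have "\<dots> \<le> 4 ^ j * (1 / 8) ^ j"
      using small\<tau> by (intro mult_left_mono) auto
    also have "\<dots> = (1 / 2) ^ j"
      by (simp add: power_mult_distrib[symmetric])
    finally show ?thesis .
  qed
  have "AE x in torus. summable (\<lambda>j. \<psi> j x)"
    by (rule AE_summable_geometric(1)[OF \<psi>int \<psi>0 \<psi>le])
  then obtain N where N: "{x \<in> space torus. \<not> summable (\<lambda>j. \<psi> j x)} \<subseteq> N" "emeasure torus N = 0" "N \<in> sets torus"
    by (rule AE_E)
  define E where "E = (\<Inter>m. \<Union>k\<in>{m..}. ?X k) - N"
  note LS = measure_limsup_ge[of ?X ?\<kappa>, OF X]
  have Esets: "E \<in> sets torus" unfolding E_def using LS(1) N(3) by blast
  have Nn: "N \<in> null_sets torus" using N(2,3) by (intro null_setsI)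
  have Epos: "measure torus E > 0"
    unfolding E_def using LS \<kappa> measure_Diff_null_set[OF LS(1) Nn] by linarith

  have good_x: "(\<forall>j. convergent (\<lambda>L. cube_truncation L (t j) f x)) \<and> (\<forall>B. \<exists>j. B < cmod (evolution_value (t j) f x))"
    if xE: "x \<in> E" for x
  proof -
    have xX: "\<exists>k\<ge>m. x \<in> ?X k" for m using xE by (auto simp: E_def)
    then have "x \<in> torus_box" by (auto simp: focus_set_def)
    then have sum: "summable (\<lambda>j. \<psi> j x)" using xE N(1) by (auto simp: E_def)
    define \<Phi> where "\<Phi> = (\<Sum>j. \<psi> j x)"
    have \<psi>\<Phi>: "\<psi> j x \<le> \<Phi>" for j
      unfolding \<Phi>_def using sum \<psi>0 sum_le_suminf[of "\<lambda>j. \<psi> j x" "{j}"] by simp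
    have R\<psi>: "4 ^ j * (?R j u x)\<^sup>2 \<le> \<psi> j x" if "u \<in> T k" "k < j" for u j k
    proof -
      have "(?R j u x)\<^sup>2 \<le> (\<Sum>u\<in>T k. (?R j u x)\<^sup>2)"
        using that finT by (intro member_le_sum) auto
      also have "\<dots> \<le> (\<Sum>k<j. \<Sum>u\<in>T k. (?R j u x)\<^sup>2)"
        using that by (intro member_le_sum) (auto intro: sum_nonneg)
      finally show ?thesis unfolding \<psi>_def by (intro mult_left_mono) auto
    qed
    have Rsum: "summable (\<lambda>j. ?R j u x)" if u: "u \<in> T k" for u k
    proof (rule summable_piece_bound(1)[OF ctx])
      show "summable (\<lambda>j. 4 ^ j * (?R j u x)\<^sup>2)"
        by (rule summable_comparison_test'[OF sum, where N = "Suc k"]) (use R\<psi>[OF u] in auto)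
    qed
    have conv: "convergent (\<lambda>L. cube_truncation L (t j) f x)" for j
    proof -
      obtain k where "t j \<in> T k" using t_in[of j] by (auto simp: TT_def)
      then show ?thesis unfolding trunc using Rsum by (intro series_limit_eq(2)[OF ctx])
    qed
    have Rtail: "?R j u x \<le> sqrt \<Phi> * (1 / 2) ^ j" if "u \<in> T k" "k < j" for u j k
    proof -
      have "(2 ^ j * ?R j u x)\<^sup>2 = 4 ^ j * (?R j u x)\<^sup>2"
        using power_mult_distrib[of "2 :: real" 2 j] by (simp add: power_mult_distrib power2_eq_square)
      then have "(2 ^ j * ?R j u x)\<^sup>2 \<le> \<Phi>" using R\<psi>[OF that] \<psi>\<Phi>[of j] by linarith
      then have "2 ^ j * ?R j u x \<le> sqrt \<Phi>" by (rule real_le_rsqrt)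
      then show ?thesis by (simp add: field_simps)
    qed
    have low: "real k - 2 * sqrt \<Phi> \<le> cmod (evolution_value u f x)"
      if u: "u \<in> T k" and big: "real (card (S k)) / 2 \<le> cmod (\<Sum>n\<in>S k. cis (real_vec n \<bullet> x - u * (norm (real_vec n))\<^sup>2))" for u k
    proof -
      let ?v = "\<lambda>j. piece_value S c j u x"
      note vs = series_partial_tendsto(2)[OF ctx Rsum[OF u]]
      have vsum: "summable ?v" using vs by (rule summable_norm_cancel)
      have head: "cmod (\<Sum>j<k. ?v j) \<le> \<sigma> k"
      proof -
        have "cmod (?v j) \<le> c j * real (card (S j))" for j
        proof -
          have "cmod (\<Sum>n\<in>S j. cis (real_vec n \<bullet> x - u * (norm (real_vec n))\<^sup>2)) \<le> real (card (S j))"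
            by (rule order_trans[OF norm_sum]) simp
          then show ?thesis using c0[of j] by (simp add: piece_value_def norm_mult mult_left_mono)
        qed
        then have "cmod (\<Sum>j<k. ?v j) \<le> (\<Sum>j<k. c j * real (card (S j)))"
          by (intro order_trans[OF norm_sum] sum_mono)
        then show ?thesis using \<sigma>[of k] by linarith
      qed
      have mid: "real k + \<sigma> k \<le> cmod (?v k)"
      proof -
        have "c k * (real (card (S k)) / 2) \<le> c k * cmod (\<Sum>n\<in>S k. cis (real_vec n \<bullet> x - u * (norm (real_vec n))\<^sup>2))"
          using big c0 by (rule mult_left_mono)
        then show ?thesis using cF[of k] c0[of k] by (simp add: piece_value_def norm_mult)
      qed
      have geo: "(\<lambda>j. sqrt \<Phi> * (1 / 2) ^ (j + Suc k)) sums (sqrt \<Phi> * (1 / 2) ^ Suc k * 2)"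
        using sums_mult[OF geometric_sums[of "1 / 2 :: real"], of "sqrt \<Phi> * (1 / 2) ^ Suc k"]
        by (simp add: power_add mult_ac)
      have tail: "cmod (\<Sum>j. ?v (j + Suc k)) \<le> 2 * sqrt \<Phi>"
      proof -
        have "0 \<le> \<Phi>" using \<psi>0 \<psi>\<Phi> order_trans by blast
        have s1: "summable (\<lambda>j. cmod (?v (j + Suc k)))"
          using vs by (subst summable_iff_shift)
        have "cmod (\<Sum>j. ?v (j + Suc k)) \<le> (\<Sum>j. cmod (?v (j + Suc k)))"
          by (rule summable_norm[OF s1])
        also have "\<dots> \<le> (\<Sum>j. sqrt \<Phi> * (1 / 2) ^ (j + Suc k))"
        proof (rule suminf_le[OF _ s1 sums_summable[OF geo]])
          fix j
          have "cmod (?v (j + Suc k)) \<le> ?R (j + Suc k) u x" by (rule cmod_piece_value_le[OF ctx])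
          also have "\<dots> \<le> sqrt \<Phi> * (1 / 2) ^ (j + Suc k)" by (rule Rtail[OF u]) simp
          finally show "cmod (?v (j + Suc k)) \<le> sqrt \<Phi> * (1 / 2) ^ (j + Suc k)" .
        qed
        also have "\<dots> = sqrt \<Phi> * (1 / 2) ^ Suc k * 2" by (rule sums_unique[OF geo, symmetric])
        also have "\<dots> \<le> sqrt \<Phi> * 1 * 2"
          using \<open>0 \<le> \<Phi>\<close> by (intro mult_right_mono mult_left_mono power_le_one) auto
        finally show ?thesis by simp
      qed
      have "evolution_value u f x = (\<Sum>j. ?v j)"
        unfolding val by (rule series_limit_eq(1)[OF ctx Rsum[OF u]])
      also have "\<dots> = (\<Sum>j. ?v (j + Suc k)) + (\<Sum>j<k. ?v j) + ?v k"
        using suminf_split_initial_segment[OF vsum, of "Suc k"] by simp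
      finally have "?v k = evolution_value u f x - (\<Sum>j. ?v (j + Suc k)) - (\<Sum>j<k. ?v j)" by simp
      then have "cmod (?v k) \<le> cmod (evolution_value u f x) + cmod (\<Sum>j. ?v (j + Suc k)) + cmod (\<Sum>j<k. ?v j)"
        using norm_triangle_ineq4[of "evolution_value u f x - (\<Sum>j. ?v (j + Suc k))" "\<Sum>j<k. ?v j"]
          norm_triangle_ineq4[of "evolution_value u f x" "\<Sum>j. ?v (j + Suc k)"] by simp
      then show ?thesis using head mid tail by linarith
    qed
    have "\<exists>j. B < cmod (evolution_value (t j) f x)" for B
    proof -
      obtain m where m: "B + 2 * sqrt \<Phi> < real m" using reals_Archimedean2 by blast
      obtain k where k: "k \<ge> m" "x \<in> ?X k" using xX by blast
      then obtain u where u: "u \<in> T k" "real (card (S k)) / 2 \<le> cmod (\<Sum>n\<in>S k. cis (real_vec n \<bullet> x - u * (norm (real_vec n))\<^sup>2))"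
        by (auto simp: focus_set_def)
      have "B < cmod (evolution_value u f x)"
        using low[OF u] m k(1) by linarith
      moreover have "u \<in> TT" using u(1) by (auto simp: TT_def)
      ultimately show ?thesis using t_surj by blast
    qed
    then show ?thesis using conv by blast
  qed

  have not_conv: "\<not> ((\<lambda>\<tau>. evolution_value \<tau> f x) \<longlongrightarrow> f x) (at_right 0)" if "x \<in> E" for x
  proof
    assume "((\<lambda>\<tau>. evolution_value \<tau> f x) \<longlongrightarrow> f x) (at_right 0)"
    moreover have "filterlim t (at_right 0) sequentially"
      using t_lim t_pos by (intro tendsto_imp_filterlim_at_right) auto
    ultimately have "(\<lambda>j. evolution_value (t j) f x) \<longlonglongrightarrow> f x"
      by (rule filterlim_compose)
    then have "Bseq (\<lambda>j. evolution_value (t j) f x)"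
      by (rule convergent_imp_Bseq[OF convergentI])
    then obtain K where "\<And>j. cmod (evolution_value (t j) f x) \<le> K"
      by (auto simp: Bseq_def)
    then show False using good_x[OF that] by (meson leD)
  qed
  have ae: "AE x in torus. convergent (\<lambda>L. cube_truncation L (t j) f x)" for j
    using AE_series[OF ctx, where t = "t j"] unfolding trunc by eventually_elim (auto simp: convergent_def)
  have L2: "L2_torus f" unfolding f_def by (rule L2_series_limit[OF ctx])
  have fs: "finite_sobolev s f" unfolding f_def by (rule finite_sobolev_series[OF ctx sep sob])
  have ise: "is_evolution u f (evolution_value u f)" for u
    unfolding val unfolding f_def by (rule is_evolution_series[OF ctx])
  show ?thesis
  proof (intro exI conjI allI ballI)
    show "L2_torus f" "finite_sobolev s f" "E \<in> sets torus" "measure torus E > 0" "t \<longlonglongrightarrow> 0"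
      by (rule L2 fs Esets Epos t_lim)+
    show "t j > 0" "AE x in torus. convergent (\<lambda>L. cube_truncation L (t j) f x)"
      "is_evolution (t j) f (evolution_value (t j) f)" for j
      by (rule t_pos ae ise)+
    fix x assume x: "x \<in> E"
    show "convergent (\<lambda>L. cube_truncation L (t j) f x)" for j
      using good_x[OF x] by blast
    show "limsup (\<lambda>j. ereal (cmod (evolution_value (t j) f x))) = \<infinity>"
      using good_x[OF x] by (intro limsup_eq_infinity) blast
    show "\<not> ((\<lambda>\<tau>. evolution_value \<tau> f x) \<longlongrightarrow> f x) (at_right 0)"
      by (rule not_conv[OF x])
  qed
qed

theorem theorem1p1:
  fixes s :: real
  assumes "CARD('d::finite) \<ge> 2"
    and "s < real CARD('d) / (real CARD('d) + 2)"
  shows "(\<nexists>C::real. \<forall>f :: real ^ 'd \<Rightarrow> complex. trig_poly f \<longrightarrow>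
            weak_L2_norm (maximal_poly f) \<le> ennreal (C * sobolev_norm s f)) \<and>
         (\<exists>(f :: real ^ 'd \<Rightarrow> complex) (E :: (real ^ 'd) set) (t :: nat \<Rightarrow> real).
            L2_torus f \<and> finite_sobolev s f \<and>
            E \<in> sets torus \<and> measure torus E > 0 \<and>
            (\<forall>j. t j > 0) \<and> t \<longlonglongrightarrow> 0 \<and>
            (\<forall>j. AE x in torus. convergent (\<lambda>L. cube_truncation L (t j) f x)) \<and>
            (\<forall>j. is_evolution (t j) f (evolution_value (t j) f)) \<and>
            (\<forall>x\<in>E. (\<forall>j. convergent (\<lambda>L. cube_truncation L (t j) f x)) \<and>
                   limsup (\<lambda>j. ereal (cmod (evolution_value (t j) f x))) = \<infinity> \<and>
                   \<not> ((\<lambda>\<tau>. evolution_value \<tau> f x) \<longlongrightarrow> f x) (at_right 0)))"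
proof (rule conjI[OF _ ex_divergent[OF assms]])
  show "\<nexists>C::real. \<forall>f :: real ^ 'd \<Rightarrow> complex. trig_poly f \<longrightarrow>
            weak_L2_norm (maximal_poly f) \<le> ennreal (C * sobolev_norm s f)"
    using maximal_not_bounded[OF assms] by metis
qed

end
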